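(* Let $p>1$ and let $a,b,w,Z\in\mathbb{R}$ satisfy either ($a>0$, $b>0$ and $\frac{Z^2}{4}<-w$) or ($a>0$, $b<0$ and $\frac{Z^2}{4}<-w<-\frac{pa^2}{(p+1)^2b}$). Let $n(-\mathcal{L}_Z)$ denote the number of negative eigenvalues of the self-adjoint operator $-\mathcal{L}_Z$. Then: 1. if $Z<0$, $n(-\mathcal{L}_Z)=2$; 2. if $Z\geq 0$, $n(-\mathcal{L}_Z)=1$.
   Context: Put $\alpha=\frac{a}{p+1}$, $\beta=\frac{b}{p}$, and let $R:(-\infty,\infty)\to(-1,1)$ be the diffeomorphism $$R(s)=\frac{\sqrt{\alpha^2-\beta w}\,\sinh((p-1)\sqrt{-w}\,s)}{\alpha+\sqrt{\alpha^2-\beta w}\,\cosh((p-1)\sqrt{-w}\,s)}.$$ Define $$\phi_{w,Z}(x)=\left[\frac{\alpha}{-w}+\frac{\sqrt{\alpha^2-\beta w}}{-w}\cosh\left((p-1)\sqrt{-w}\left(|x|+R^{-1}\left(\frac{Z}{2\sqrt{-w}}\right)\right)\right)\right]^{\frac{-1}{p-1}}.$$ The operator $-\mathcal{L}_Z$ on $L^2(\mathbb{R})$ has domain $D_Z=\{g\in H^1(\mathbb{R})\cap H^2(\mathbb{R}\setminus\{0\}) : g'(0+)-g'(0-)=-Zg(0)\}$ and acts by $$-\mathcal{L}_Zg=-g''-wg-ap\,\phi_{w,Z}^{p-1}g-b(2p-1)\phi_{w,Z}^{2p-2}g,$$ where $g''$ is computed on $\mathbb{R}\setminus\{0\}$.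 *)

theory Defs
  imports "HOL-Analysis.Analysis" "HOL-Library.Extended_Nat"
begin

text \<open>
  Elements of \<open>L\<^sup>2(\<Omega>)\<close> and of the Sobolev spaces are represented by functions; two functions that
  agree almost everywhere represent the same element. Every notion below is invariant under
  changing a function on a null set.
\<close>

definition L2 :: "real set \<Rightarrow> (real \<Rightarrow> complex) set" where
  "L2 \<Omega> = {f. set_borel_measurable lborel \<Omega> f \<and>
              set_integrable lborel \<Omega> (\<lambda>x. (cmod (f x))\<^sup>2)}"

definition test_functions :: "real set \<Rightarrow> (real \<Rightarrow> real) set" where
  "test_functions \<Omega> =
     {\<eta>. (\<forall>n x. (deriv ^^ n) \<eta> differentiable (at x)) \<and>
         (\<exists>K. compact K \<and> K \<subseteq> \<Omega> \<and> (\<forall>x. x \<notin> K \<longrightarrow> \<eta> x = 0))}"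

definition is_weak_deriv :: "real set \<Rightarrow> (real \<Rightarrow> complex) \<Rightarrow> (real \<Rightarrow> complex) \<Rightarrow> bool" where
  "is_weak_deriv \<Omega> g h \<longleftrightarrow>
     (\<forall>\<eta>\<in>test_functions \<Omega>.
        (LINT x:\<Omega>|lborel. of_real (deriv \<eta> x) * g x) = - (LINT x:\<Omega>|lborel. of_real (\<eta> x) * h x))"

text \<open>The space \<open>H\<^sup>k(\<Omega>)\<close> for open \<open>\<Omega>\<close>.\<close>

primrec sobolev :: "nat \<Rightarrow> real set \<Rightarrow> (real \<Rightarrow> complex) set" where
  "sobolev 0 \<Omega> = L2 \<Omega>"
| "sobolev (Suc k) \<Omega> = {g \<in> L2 \<Omega>. \<exists>h\<in>sobolev k \<Omega>. is_weak_deriv \<Omega> g h}"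

text \<open>For \<open>g \<in> H\<^sup>1(\<Omega>)\<close> the weak derivative is unique up to a null set, so the choice below is
  immaterial.\<close>

definition weak_deriv :: "real set \<Rightarrow> (real \<Rightarrow> complex) \<Rightarrow> (real \<Rightarrow> complex)" where
  "weak_deriv \<Omega> g = (SOME h. h \<in> L2 \<Omega> \<and> is_weak_deriv \<Omega> g h)"

definition eigenspace ::
    "(real \<Rightarrow> complex) set \<Rightarrow> ((real \<Rightarrow> complex) \<Rightarrow> (real \<Rightarrow> complex)) \<Rightarrow> real \<Rightarrow> (real \<Rightarrow> complex) set" where
  "eigenspace D A \<mu> = {g \<in> D. AE x in lborel. A g x = of_real \<mu> * g x}"

text \<open>Complex dimension of the eigenspace as a subspace of \<open>L\<^sup>2(\<real>)\<close>: the supremum of the lengths of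
  families in it that are linearly independent modulo null functions. It is \<open>0\<close> if \<open>\<mu>\<close> is not an
  eigenvalue and \<open>\<infinity>\<close> if the eigenspace is infinite-dimensional.\<close>

definition multiplicity_of ::
    "(real \<Rightarrow> complex) set \<Rightarrow> ((real \<Rightarrow> complex) \<Rightarrow> (real \<Rightarrow> complex)) \<Rightarrow> real \<Rightarrow> enat" where
  "multiplicity_of D A \<mu> =
     (SUP m\<in>{m. \<exists>f. (\<forall>i<m. f i \<in> eigenspace D A \<mu>) \<and>
                   (\<forall>c::nat \<Rightarrow> complex. (AE x in lborel. (\<Sum>i<m. c i * f i x) = 0) \<longrightarrow> (\<forall>i<m. c i = 0))}.
        enat m)"

text \<open>Negative eigenvalues counted with multiplicity; the supremum of the finite partial sums is the
  sum over all \<open>\<mu> < 0\<close>.\<close>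

definition num_neg_eigenvalues ::
    "(real \<Rightarrow> complex) set \<Rightarrow> ((real \<Rightarrow> complex) \<Rightarrow> (real \<Rightarrow> complex)) \<Rightarrow> enat" where
  "num_neg_eigenvalues D A =
     (SUP F\<in>{F. finite F \<and> F \<subseteq> {..<0}}. \<Sum>\<mu>\<in>F. multiplicity_of D A \<mu>)"

definition R_fun :: "real \<Rightarrow> real \<Rightarrow> real \<Rightarrow> real \<Rightarrow> real \<Rightarrow> real" where
  "R_fun p a b w s =
     (let \<alpha> = a / (p + 1); \<beta> = b / p in
        sqrt (\<alpha>\<^sup>2 - \<beta> * w) * sinh ((p - 1) * sqrt (- w) * s) /
        (\<alpha> + sqrt (\<alpha>\<^sup>2 - \<beta> * w) * cosh ((p - 1) * sqrt (- w) * s)))"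

text \<open>For the admissible parameters \<open>R_fun p a b w\<close> is a bijection onto \<open>(-1, 1)\<close> and
  \<open>\<bar>Z / (2 * sqrt (- w))\<bar> < 1\<close>, so \<open>inv\<close> is applied inside the range.\<close>

definition phi :: "real \<Rightarrow> real \<Rightarrow> real \<Rightarrow> real \<Rightarrow> real \<Rightarrow> real \<Rightarrow> real" where
  "phi p a b w Z x =
     (let \<alpha> = a / (p + 1); \<beta> = b / p in
        (\<alpha> / (- w) + sqrt (\<alpha>\<^sup>2 - \<beta> * w) / (- w) *
           cosh ((p - 1) * sqrt (- w) * (\<bar>x\<bar> + inv (R_fun p a b w) (Z / (2 * sqrt (- w))))))
        powr (- 1 / (p - 1)))"

text \<open>In the domain, \<open>u\<close> is the continuous representative of \<open>g \<in> H\<^sup>1(\<real>)\<close>, giving \<open>g(0)\<close>, and \<open>v\<close> is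
  the representative of \<open>g'\<close> that is continuous off \<open>0\<close>, giving \<open>g'(0+)\<close> and \<open>g'(0-)\<close>.\<close>

definition dom_L :: "real \<Rightarrow> (real \<Rightarrow> complex) set" where
  "dom_L Z =
     {g \<in> sobolev 1 UNIV \<inter> sobolev 2 (- {0}).
        \<exists>u v r l. continuous_on UNIV u \<and> (AE x in lborel. u x = g x) \<and>
                  continuous_on (- {0}) v \<and> (AE x in lborel. v x = weak_deriv (- {0}) g x) \<and>
                  (v \<longlongrightarrow> r) (at_right 0) \<and> (v \<longlongrightarrow> l) (at_left 0) \<and>
                  r - l = - of_real Z * u 0}"

definition neg_L ::
    "real \<Rightarrow> real \<Rightarrow> real \<Rightarrow> real \<Rightarrow> real \<Rightarrow> (real \<Rightarrow> complex) \<Rightarrow> (real \<Rightarrow> complex)" where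
  "neg_L p a b w Z g x =
     - weak_deriv (- {0}) (weak_deriv (- {0}) g) x - of_real w * g x
     - of_real (a * p * phi p a b w Z x powr (p - 1)) * g x
     - of_real (b * (2 * p - 1) * phi p a b w Z x powr (2 * p - 2)) * g x"

end

theory Submission
  imports Defs "HOL-Computational_Algebra.Polynomial"
begin

text \<open>
  Put \<open>k = sqrt (- w)\<close>. The operator is \<open>- g'' + (k\<^sup>2 - q (s0 + \<bar>x\<bar>)) g\<close> with a point interaction at \<open>0\<close>, where
  \<open>q\<close> decays exponentially and \<open>s0\<close> is determined by \<open>R s0 = Z / (2 * k)\<close>. An eigenvalue \<open>\<mu> < 0\<close> is
  written \<open>\<mu> = k\<^sup>2 - \<kappa>\<^sup>2\<close> with \<open>\<kappa> > k\<close>.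

  Reduction to a boundary value. On either half line the square integrable solutions of
  \<open>g'' = (\<kappa>\<^sup>2 - q) g\<close> are the multiples of the Jost solution \<open>u \<kappa>\<close>, the one that behaves like
  \<open>exp (- \<kappa> * s)\<close> at infinity (\<open>square_integrable_solution\<close>). Two multiples of it fit together at \<open>0\<close> in
  two ways only: oddly if \<open>u \<kappa> s0 = 0\<close>, evenly if \<open>u' + Z/2 * u\<close> vanishes at \<open>s0\<close>. These two
  conditions exclude each other, so all eigenvalues are simple and the number of negative ones is the
  number of \<open>\<kappa> > k\<close> that solve one of the two boundary equations (\<open>eigenfunction\<close>,
  \<open>eigenfunction_form\<close>, \<open>num_neg_eq_card\<close>).

  Counting. The derivative of the profile \<open>\<phi>\<close> of the standing wave solves the equation at \<open>\<kappa> = k\<close>; up to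
  a negative factor it is \<open>u0 = R * \<phi>\<close>, which has the sign of \<open>s\<close>. By the choice of \<open>s0\<close>,
  \<open>u0' + Z/2 * u0 = R' * \<phi> > 0\<close> at \<open>s0\<close> (\<open>zero_mode\<close>). Both boundary values depend continuously on \<open>\<kappa>\<close>,
  and for large \<open>\<kappa>\<close> they have the signs of \<open>exp (- \<kappa> * s)\<close> and of its derivative, positive and negative.
  At \<open>\<kappa> = k\<close> the even one is positive, and the odd one has the sign of \<open>s0\<close>.
  Hence the even equation always has a solution \<open>\<kappa> > k\<close>, and the odd one has a solution if \<open>s0 < 0\<close>,
  that is if \<open>Z < 0\<close>. There are no others. To the right of \<open>0\<close>, where \<open>u0 > 0\<close>, comparison of Wronskians
  makes \<open>u \<kappa>\<close> positive. To the left of \<open>0\<close>, where \<open>u0 < 0\<close>, the Picone quantity \<open>u0\<^sup>2 * y * y'\<close> with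
  \<open>y = u \<kappa> / u0\<close> is strictly increasing, so \<open>u \<kappa>\<close> has at most one zero, and it has none beyond \<open>s0\<close> when
  the even equation holds. Positivity on the half line then excludes a second value of \<open>\<kappa>\<close> for either
  equation, again by a Wronskian that increases to \<open>0\<close>.

  Two analytic tools carry this. In the variable \<open>y = exp (- c * s)\<close> the Jost solution is a fixed point of
  a contraction on bounded continuous functions of \<open>(y, \<kappa>)\<close>, which yields its continuity in \<open>\<kappa>\<close>
  (\<open>volterra_fixed_point\<close>). Explicit bump functions give the fundamental lemma of the calculus of
  variations, which turns weak derivatives into classical ones and identifies weak derivatives almost
  everywhere (\<open>weak_deriv_classical\<close>, \<open>weak_deriv_AE_eq\<close>).
\<close>

section \<open>Smooth bump functions\<close>

definition smooth :: "(real \<Rightarrow> real) \<Rightarrow> bool" where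
  "smooth f \<longleftrightarrow> (\<forall>n x. (deriv ^^ n) f differentiable (at x))"

text \<open>
  Exhibiting a family of functions that is closed under differentiation avoids formulas for the higher
  derivatives.
\<close>

lemma smooth_coinduct:
  assumes "f \<in> F"
    and "\<And>f. f \<in> F \<Longrightarrow> \<exists>g\<in>F. \<forall>x. (f has_real_derivative g x) (at x)"
  shows "smooth f"
proof -
  have dF: "deriv f \<in> F" if f: "f \<in> F" for f
  proof -
    obtain g where g: "g \<in> F" "\<And>x. (f has_real_derivative g x) (at x)"
      using assms(2)[OF f] by blast
    have "deriv f = g" using g(2) by (auto intro: DERIV_imp_deriv)
    thus ?thesis using g by simp
  qed
  have "(deriv ^^ n) f \<in> F" for n by (induction n) (use assms(1) dF in auto)
  thus ?thesis unfolding smooth_def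
    using assms(2) real_differentiable_def by blast
qed

lemma smooth_deriv: "smooth f \<Longrightarrow> smooth (deriv f)"
  unfolding smooth_def by (metis comp_apply funpow_Suc_right)

lemma smooth_has_derivative: "smooth f \<Longrightarrow> (f has_real_derivative deriv f x) (at x)"
  unfolding smooth_def by (metis DERIV_deriv_iff_real_differentiable funpow_0)

lemma smooth_continuous: "smooth f \<Longrightarrow> continuous_on S f"
  by (meson DERIV_continuous_on has_field_derivative_at_within smooth_has_derivative)

lemma smooth_lin:
  assumes "smooth f" "smooth g"
  shows "smooth (\<lambda>x. f x + c * g x)"
proof (rule smooth_coinduct[where F="{\<lambda>x. f x + c * g x | f g. smooth f \<and> smooth g}"])
  fix h assume "h \<in> {\<lambda>x. f x + c * g x | f g. smooth f \<and> smooth g}"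
  then obtain f g where h: "h = (\<lambda>x. f x + c * g x)" "smooth f" "smooth g" by auto
  show "\<exists>h'\<in>{\<lambda>x. f x + c * g x | f g. smooth f \<and> smooth g}. \<forall>x. (h has_real_derivative h' x) (at x)"
    unfolding h(1)
    by (rule bexI[of _ "\<lambda>x. deriv f x + c * deriv g x"])
      (use h(2,3) smooth_deriv smooth_has_derivative in \<open>auto intro!: derivative_eq_intros\<close>)
qed (use assms in auto)

lemma smooth_antideriv:
  assumes "\<And>x. (f has_real_derivative g x) (at x)" "smooth g"
  shows "smooth f"
proof (rule smooth_coinduct[where F="insert f {g. smooth g}"])
  fix h assume "h \<in> insert f {g. smooth g}"
  then show "\<exists>h'\<in>insert f {g. smooth g}. \<forall>x. (h has_real_derivative h' x) (at x)"
    using assms smooth_deriv smooth_has_derivative by (metis insert_iff mem_Collect_eq)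
qed auto

lemma test_functions_alt:
  "\<eta> \<in> test_functions \<Omega> \<longleftrightarrow> smooth \<eta> \<and> (\<exists>K. compact K \<and> K \<subseteq> \<Omega> \<and> (\<forall>x. x \<notin> K \<longrightarrow> \<eta> x = 0))"
  by (simp add: test_functions_def smooth_def)

lemma test_function_support:
  assumes "\<eta> \<in> test_functions \<Omega>"
  obtains K where "compact K" "K \<subseteq> \<Omega>" "\<And>x. x \<notin> K \<Longrightarrow> \<eta> x = 0" "\<And>x. x \<notin> K \<Longrightarrow> deriv \<eta> x = 0"
proof -
  obtain K where K: "compact K" "K \<subseteq> \<Omega>" "\<And>x. x \<notin> K \<Longrightarrow> \<eta> x = 0"
    using assms unfolding test_functions_alt by auto
  have "deriv \<eta> x = 0" if "x \<notin> K" for x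
  proof -
    have "open (-K)" using K(1) by (simp add: compact_imp_closed open_Compl)
    then have "eventually (\<lambda>y. \<eta> y = 0) (nhds x)"
      using that K(3) by (metis (mono_tags, lifting) ComplD ComplI eventually_nhds)
    then have "deriv \<eta> x = deriv (\<lambda>_. 0) x" by (rule deriv_cong_ev) auto
    thus ?thesis by simp
  qed
  thus ?thesis using K that by blast
qed

lemma deriv_test_function:
  assumes "\<eta> \<in> test_functions \<Omega>"
  shows "deriv \<eta> \<in> test_functions \<Omega>"
proof -
  obtain K where "compact K" "K \<subseteq> \<Omega>" "\<And>x. x \<notin> K \<Longrightarrow> deriv \<eta> x = 0"
    using test_function_support[OF assms] by metis
  moreover have "smooth (deriv \<eta>)" using assms smooth_deriv by (simp add: test_functions_alt)
  ultimately show ?thesis unfolding test_functions_alt by blast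
qed

text \<open>
  A polynomial over a power of \<open>(x - c) * (d - x)\<close>, times the standard bump
  \<open>exp (- \<epsilon> / ((x - c) * (d - x)))\<close>: a family that contains the bump and is closed under
  differentiation. As \<open>\<epsilon>\<close> tends to \<open>0\<close> the bump increases to the indicator function of \<open>(c, d)\<close>.
\<close>

definition bump :: "real \<Rightarrow> real \<Rightarrow> real \<Rightarrow> real poly \<Rightarrow> nat \<Rightarrow> real \<Rightarrow> real" where
  "bump \<epsilon> c d P N x = (if c < x \<and> x < d
     then poly P x / ((x - c) * (d - x)) ^ N * exp (- \<epsilon> / ((x - c) * (d - x))) else 0)"

lemma power_le_exp:
  fixes t :: real assumes "t \<ge> 0" shows "t ^ n \<le> fact n * exp t"
proof -
  have s: "(\<lambda>k. t ^ k /\<^sub>R fact k) sums exp t" by (rule exp_converges)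
  have "(\<Sum>k\<in>{n}. t ^ k /\<^sub>R fact k) \<le> exp t"
    unfolding sums_unique[OF s] by (rule sum_le_suminf[OF sums_summable[OF s]]) (use assms in auto)
  thus ?thesis by (simp add: field_simps)
qed

text \<open>
  The exponential beats every power of the vanishing denominator. A quadratic bound is all that is
  needed for the derivative to exist and vanish at the end points, and outside \<open>(c, d)\<close> in general.
\<close>

lemma bump_quadratic_bound:
  assumes "\<epsilon> > 0"
  shows "\<exists>K. \<forall>x y. \<not> (c < x \<and> x < d) \<longrightarrow> \<bar>bump \<epsilon> c d P N y\<bar> \<le> K * (y - x)\<^sup>2"
proof -
  define F where "F = fact (N + 2) / \<epsilon> ^ (N + 2)"
  have "bounded (poly P ` {c..d})"
    by (intro compact_imp_bounded compact_continuous_image) (auto intro: continuous_intros)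
  then obtain M where M: "\<And>y. y \<in> {c..d} \<Longrightarrow> \<bar>poly P y\<bar> \<le> M" "M > 0"
    unfolding bounded_pos by (metis imageI real_norm_def)
  have "\<bar>bump \<epsilon> c d P N y\<bar> \<le> M * F * (d - c)\<^sup>2 * (y - x)\<^sup>2" if x: "\<not> (c < x \<and> x < d)" for x y
  proof (cases "c < y \<and> y < d")
    case True
    define D where "D = (y - c) * (d - y)"
    have D: "D > 0" using True by (simp add: D_def)
    have "(\<epsilon> / D) ^ (N + 2) \<le> fact (N + 2) * exp (\<epsilon> / D)"
      by (rule power_le_exp) (use D assms in auto)
    hence e: "exp (- \<epsilon> / D) \<le> F * D ^ (N + 2)"
      using D assms by (simp add: F_def field_simps exp_minus power_divide)
    have Dle: "D \<le> (d - c) * \<bar>y - x\<bar>"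
    proof (cases "x \<le> c")
      case True
      have "D \<le> (y - x) * (d - c)"
        unfolding D_def using True \<open>c < y \<and> y < d\<close> by (intro mult_mono) auto
      thus ?thesis using True \<open>c < y \<and> y < d\<close> by (simp add: mult.commute)
    next
      case False
      hence "D \<le> (d - c) * (x - y)"
        unfolding D_def using x \<open>c < y \<and> y < d\<close> by (intro mult_mono) auto
      thus ?thesis using False x \<open>c < y \<and> y < d\<close> by simp
    qed
    have "\<bar>bump \<epsilon> c d P N y\<bar> = \<bar>poly P y\<bar> / D ^ N * exp (- \<epsilon> / D)"
      using True D by (simp add: bump_def D_def[symmetric] abs_mult)
    also have "\<dots> \<le> M / D ^ N * (F * D ^ (N + 2))"
      using M True D e by (intro mult_mono divide_right_mono) auto
    also have "\<dots> = M * F * D\<^sup>2" using D by (simp add: power_add power2_eq_square)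
    also have "\<dots> \<le> M * F * ((d - c) * \<bar>y - x\<bar>)\<^sup>2"
      using Dle D M assms by (intro mult_left_mono power_mono) (auto simp: F_def)
    finally show ?thesis by (simp add: power_mult_distrib mult.assoc)
  qed (use M assms in \<open>auto simp: bump_def F_def\<close>)
  thus ?thesis by blast
qed

lemma bump_has_derivative:
  fixes c d :: real and P :: "real poly" and N :: nat
  assumes "\<epsilon> > 0"
  defines "D \<equiv> [:- c, 1:] * [:d, - 1:]"
  defines "P' \<equiv> pderiv P * D ^ 2 - smult (of_nat N) (P * pderiv D * D) + smult \<epsilon> (P * pderiv D)"
  shows "(bump \<epsilon> c d P N has_real_derivative bump \<epsilon> c d P' (N + 2) x) (at x)"
proof (cases "c < x \<and> x < d")
  case True
  have pD: "poly D y = (y - c) * (d - y)" for y by (simp add: D_def algebra_simps)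
  have pos: "poly D x > 0" unfolding pD using True by simp
  have *: "((\<lambda>y. poly P y / poly D y ^ N * exp (- \<epsilon> / poly D y)) has_real_derivative
      poly P' x / poly D x ^ (N + 2) * exp (- \<epsilon> / poly D x)) (at x)"
  proof -
    have e: "poly P' x / poly D x ^ (N + 2) * exp (- \<epsilon> / poly D x) =
      (poly (pderiv P) x / poly D x ^ N - of_nat N * poly P x * poly (pderiv D) x / poly D x ^ (N + 1)) * exp (- \<epsilon> / poly D x)
      + poly P x / poly D x ^ N * (exp (- \<epsilon> / poly D x) * (\<epsilon> * poly (pderiv D) x / poly D x ^ 2))"
      unfolding P'_def using pos by (simp add: field_simps power_add power2_eq_square)
    have d1: "((\<lambda>y. poly P y / poly D y ^ N) has_real_derivative
       poly (pderiv P) x / poly D x ^ N - of_nat N * poly P x * poly (pderiv D) x / poly D x ^ (N + 1)) (at x)"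
    proof (cases N)
      case (Suc n)
      have "((\<lambda>y. poly P y / poly D y ^ Suc n) has_real_derivative
        (poly (pderiv P) x * poly D x ^ Suc n - poly P x * (real (Suc n) * poly D x ^ n * poly (pderiv D) x))
          / (poly D x ^ Suc n * poly D x ^ Suc n)) (at x)"
        by (rule derivative_eq_intros poly_DERIV refl)+ (use pos in \<open>auto simp: poly_DERIV\<close>)
      moreover have "(poly (pderiv P) x * poly D x ^ Suc n - poly P x * (real (Suc n) * poly D x ^ n * poly (pderiv D) x))
          / (poly D x ^ Suc n * poly D x ^ Suc n) =
        poly (pderiv P) x / poly D x ^ N - of_nat N * poly P x * poly (pderiv D) x / poly D x ^ (N + 1)"
        unfolding Suc using pos by (simp add: field_simps)
      ultimately show ?thesis using Suc by simp
    qed (auto simp: poly_DERIV)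
    have d2: "((\<lambda>y. exp (- \<epsilon> / poly D y)) has_real_derivative
       exp (- \<epsilon> / poly D x) * (\<epsilon> * poly (pderiv D) x / poly D x ^ 2)) (at x)"
      using pos by (auto intro!: derivative_eq_intros simp: poly_DERIV power2_eq_square)
    show ?thesis unfolding e by (rule DERIV_mult'[OF d1 d2, THEN DERIV_cong]) (simp only: add.commute mult.commute)
  qed
  have "(bump \<epsilon> c d P N has_real_derivative poly P' x / poly D x ^ (N + 2) * exp (- \<epsilon> / poly D x)) (at x)"
    by (rule has_field_derivative_transform_within_open[OF *, of "{c<..<d}"])
      (use True in \<open>auto simp: bump_def pD\<close>)
  thus ?thesis using True by (simp add: bump_def pD)
next
  case False
  obtain K where K: "\<And>x y. \<not> (c < x \<and> x < d) \<Longrightarrow> \<bar>bump \<epsilon> c d P N y\<bar> \<le> K * (y - x)\<^sup>2"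
    using bump_quadratic_bound[OF assms(1)] by blast
  have z: "bump \<epsilon> c d P N x = 0" "bump \<epsilon> c d P' (N+2) x = 0"
    using False by (auto simp: bump_def)
  have "((\<lambda>y. (bump \<epsilon> c d P N y - bump \<epsilon> c d P N x) / (y - x)) \<longlongrightarrow> 0) (at x)"
  proof (rule Lim_null_comparison)
    show "eventually (\<lambda>y. norm ((bump \<epsilon> c d P N y - bump \<epsilon> c d P N x) / (y - x)) \<le> K * \<bar>y - x\<bar>) (at x)"
      unfolding eventually_at_filter
    proof (rule always_eventually, intro allI impI)
      fix y assume "y \<noteq> x"
      show "norm ((bump \<epsilon> c d P N y - bump \<epsilon> c d P N x) / (y - x)) \<le> K * \<bar>y - x\<bar>"
        using K[OF False, of y] \<open>y \<noteq> x\<close>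
        by (simp add: z divide_le_eq mult.assoc power2_eq_square[symmetric])
    qed
    show "((\<lambda>y. K * \<bar>y - x\<bar>) \<longlongrightarrow> 0) (at x)" by (auto intro!: tendsto_eq_intros)
  qed
  thus ?thesis unfolding has_field_derivative_iff z by (simp add: z)
qed

lemma smooth_bump: "\<epsilon> > 0 \<Longrightarrow> smooth (bump \<epsilon> c d P N)"
  by (rule smooth_coinduct[where F="{bump \<epsilon> c d P N | P N. True}"])
    (use bump_has_derivative in blast)+

abbreviation "std_bump \<epsilon> c d \<equiv> bump \<epsilon> c d 1 0"

lemma bump_test_function:
  assumes "\<epsilon> > 0" "{c..d} \<subseteq> \<Omega>"
  shows "std_bump \<epsilon> c d \<in> test_functions \<Omega>"
  unfolding test_functions_alt using assms smooth_bump
  by (auto intro!: exI[of _ "{c..d}"] simp: bump_def)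

section \<open>The fundamental lemma of the calculus of variations\<close>

text \<open>
  Intervals generate the Borel sets, so the integral over every Borel set vanishes, and a density is
  determined by these integrals.
\<close>

lemma AE_zero_box_of_interval_integrals:
  fixes f :: "real \<Rightarrow> complex"
  assumes int: "set_integrable lborel {c<..<d} f"
    and zero: "\<And>a b. c \<le> a \<Longrightarrow> a < b \<Longrightarrow> b \<le> d \<Longrightarrow> (LINT x:{a<..<b}|lborel. f x) = 0"
  shows "AE x in lborel. x \<in> {c<..<d} \<longrightarrow> f x = 0"
proof -
  define F where "F = (\<lambda>x. indicator {c<..<d} x *\<^sub>R f x)"
  have iF: "integrable lborel F" using int by (simp add: set_integrable_def F_def)
  have F_int: "integrable lborel (\<lambda>x. indicator A x *\<^sub>R F x)" if "A \<in> sets borel" for A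
    using integrable_mult_indicator[OF _ iF, of A] that by simp
  have box: "(LINT x:{a<..<b}|lborel. F x) = 0" for a b
  proof (cases "max a c < min b d")
    case True
    have "(LINT x:{a<..<b}|lborel. F x) = (LINT x:{max a c<..<min b d}|lborel. f x)"
      unfolding set_lebesgue_integral_def F_def
      by (rule Bochner_Integration.integral_cong) (auto simp: indicator_def)
    thus ?thesis using zero[of "max a c" "min b d"] True by simp
  next
    case False
    have "(\<lambda>x. indicator {a<..<b} x *\<^sub>R F x) = (\<lambda>x. 0)"
      using False by (auto simp: F_def indicator_def)
    thus ?thesis by (simp add: set_lebesgue_integral_def)
  qed
  have whole: "(LINT x|lborel. F x) = 0"
  proof -
    have "(LINT x|lborel. F x) = (LINT x:{c<..<d}|lborel. F x)"
      unfolding set_lebesgue_integral_def F_def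
      by (rule Bochner_Integration.integral_cong) (auto simp: indicator_def)
    thus ?thesis using box by simp
  qed
  have all: "(LINT x:A|lborel. F x) = 0" if "A \<in> sets borel" for A
    using that
  proof (induction A rule: borel_set_induct)
    case (interval a b)
    have "(LINT x:{a..b}|lborel. F x) = (LINT x:{a<..<b}|lborel. F x)"
      by (rule set_integral_discrete_difference[of "{a, b}"]) (use interval in auto)
    then show ?case using box by simp
  next
    case (compl A)
    have "(LINT x:- A|lborel. F x) = (LINT x|lborel. F x - indicator A x *\<^sub>R F x)"
      unfolding set_lebesgue_integral_def
      by (rule Bochner_Integration.integral_cong) (auto simp: indicator_def)
    also have "\<dots> = (LINT x|lborel. F x) - (LINT x:A|lborel. F x)"
      unfolding set_lebesgue_integral_def
      by (rule Bochner_Integration.integral_diff[OF iF F_int[OF compl(1)]])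
    finally show ?case using compl whole by simp
  next
    case (union A)
    have "(LINT x:(\<Union>i. A i)|lborel. F x) = (\<Sum>i. (LINT x:A i|lborel. F x))"
      by (rule lebesgue_integral_countable_add)
        (use union F_int in \<open>auto simp: disjoint_family_on_def set_integrable_def\<close>)
    thus ?case using union by simp
  qed (simp add: set_lebesgue_integral_def)
  have "AE x in lborel. F x = 0"
    by (rule sigma_finite_measure.density_zero[OF sigma_finite_lborel iF]) (use all in simp)
  thus ?thesis by eventually_elim (auto simp: F_def)
qed

text \<open>
  The bumps on \<open>[a, b]\<close> are test functions bounded by \<open>1\<close> that converge to the indicator function of
  \<open>(a, b)\<close>, so dominated convergence passes from test functions to intervals.
\<close>

lemma interval_integral_zero_of_test:
  fixes f :: "real \<Rightarrow> complex"
  assumes ab: "a < b" "{a..b} \<subseteq> \<Omega>" and int: "set_integrable lborel {a..b} f"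
    and test: "\<And>\<eta>. \<eta> \<in> test_functions \<Omega> \<Longrightarrow> (LINT x:\<Omega>|lborel. of_real (\<eta> x) * f x) = 0"
  shows "(LINT x:{a<..<b}|lborel. f x) = 0"
proof -
  define \<eta> where "\<eta> n = std_bump (1 / real (Suc n)) a b" for n
  have int0: "set_integrable lborel {a<..<b} f"
    by (rule set_integrable_subset[OF int]) auto
  have eta: "\<eta> n x = (if a < x \<and> x < b then exp (- (1 / real (Suc n)) / ((x-a)*(b-x))) else 0)" for n x
    by (simp add: \<eta>_def bump_def)
  have cont: "continuous_on UNIV (\<eta> n)" for n
    unfolding \<eta>_def by (rule smooth_continuous[OF smooth_bump]) simp
  have m[measurable]: "\<eta> n \<in> borel_measurable borel" for n
    using cont borel_measurable_continuous_onI by blast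
  have zero: "(LINT x|lborel. of_real (\<eta> n x) * (indicator {a<..<b} x *\<^sub>R f x)) = 0" for n
  proof -
    have "(LINT x:\<Omega>|lborel. of_real (\<eta> n x) * f x) = 0"
      by (rule test) (use bump_test_function[OF _ ab(2)] in \<open>auto simp: \<eta>_def\<close>)
    also have "(LINT x:\<Omega>|lborel. of_real (\<eta> n x) * f x) = (LINT x|lborel. of_real (\<eta> n x) * (indicator {a<..<b} x *\<^sub>R f x))"
      unfolding set_lebesgue_integral_def
      by (rule Bochner_Integration.integral_cong) (use ab in \<open>auto simp: indicator_def eta subset_iff\<close>)
    finally show ?thesis .
  qed
  have "(\<lambda>n. LINT x|lborel. of_real (\<eta> n x) * (indicator {a<..<b} x *\<^sub>R f x)) \<longlonglongrightarrow>
      (LINT x|lborel. indicator {a<..<b} x *\<^sub>R f x)"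
  proof (rule integral_dominated_convergence[where w="\<lambda>x. norm (indicator {a<..<b} x *\<^sub>R f x)"])
    show "(\<lambda>x. indicator {a<..<b} x *\<^sub>R f x) \<in> borel_measurable lborel"
      using int0 by (auto simp: set_integrable_def)
    then show "(\<lambda>x. of_real (\<eta> n x) * (indicator {a<..<b} x *\<^sub>R f x)) \<in> borel_measurable lborel" for n
      by measurable
    show "integrable lborel (\<lambda>x. norm (indicator {a<..<b} x *\<^sub>R f x))"
      using int0 unfolding set_integrable_def by (rule integrable_norm)
    show "AE x in lborel. (\<lambda>n. of_real (\<eta> n x) * (indicator {a<..<b} x *\<^sub>R f x)) \<longlonglongrightarrow> indicator {a<..<b} x *\<^sub>R f x"
    proof (rule AE_I2)
      fix x
      show "(\<lambda>n. of_real (\<eta> n x) * (indicator {a<..<b} x *\<^sub>R f x)) \<longlonglongrightarrow> indicator {a<..<b} x *\<^sub>R f x"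
      proof (cases "a < x \<and> x < b")
        case True
        have "(\<lambda>n. exp (- (1 / real (Suc n)) / ((x-a)*(b-x)))) \<longlonglongrightarrow> exp (- 0 / ((x-a)*(b-x)))"
          by (intro tendsto_intros) (use LIMSEQ_inverse_real_of_nat True in \<open>auto simp: inverse_eq_divide\<close>)
        hence "(\<lambda>n. \<eta> n x) \<longlonglongrightarrow> 1" using True by (simp add: eta)
        hence "(\<lambda>n. of_real (\<eta> n x) * (indicator {a<..<b} x *\<^sub>R f x)) \<longlonglongrightarrow> of_real 1 * (indicator {a<..<b} x *\<^sub>R f x)"
          by (intro tendsto_intros)
        thus ?thesis by simp
      qed auto
    qed
    show "AE x in lborel. norm (of_real (\<eta> n x) * (indicator {a<..<b} x *\<^sub>R f x)) \<le> norm (indicator {a<..<b} x *\<^sub>R f x)" for n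
    proof (rule AE_I2)
      fix x
      have "\<bar>\<eta> n x\<bar> \<le> 1" by (auto simp: eta)
      thus "norm (of_real (\<eta> n x) * (indicator {a<..<b} x *\<^sub>R f x)) \<le> norm (indicator {a<..<b} x *\<^sub>R f x)"
        by (auto simp: norm_mult indicator_def intro: mult_left_le_one_le)
    qed
  qed
  hence "(\<lambda>n. 0) \<longlonglongrightarrow> (LINT x:{a<..<b}|lborel. f x)"
    unfolding zero set_lebesgue_integral_def .
  thus ?thesis by (metis LIMSEQ_const_iff)
qed

lemma AE_zero_of_test_integrals:
  fixes f :: "real \<Rightarrow> complex"
  assumes "open \<Omega>"
    and int: "\<And>a b. {a..b} \<subseteq> \<Omega> \<Longrightarrow> set_integrable lborel {a..b} f"
    and test: "\<And>\<eta>. \<eta> \<in> test_functions \<Omega> \<Longrightarrow> (LINT x:\<Omega>|lborel. of_real (\<eta> x) * f x) = 0"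
  shows "AE x in lborel. x \<in> \<Omega> \<longrightarrow> f x = 0"
proof -
  have box: "AE x in lborel. x \<in> {c<..<d} \<longrightarrow> f x = 0" if "{c..d} \<subseteq> \<Omega>" for c d
  proof (rule AE_zero_box_of_interval_integrals)
    show "set_integrable lborel {c<..<d} f"
      by (rule set_integrable_subset[OF int[OF that]]) auto
    show "(LINT x:{a<..<b}|lborel. f x) = 0" if "c \<le> a" "a < b" "b \<le> d" for a b
      by (rule interval_integral_zero_of_test[of a b \<Omega>])
        (use that \<open>{c..d} \<subseteq> \<Omega>\<close> test int[of a b] in \<open>auto simp: subset_iff\<close>)
  qed
  define B where "B = {(c, d). c \<in> \<rat> \<and> d \<in> \<rat> \<and> {c..d} \<subseteq> \<Omega>}"
  have "countable B"
    by (rule countable_subset[of _ "\<rat> \<times> \<rat>"]) (auto simp: B_def countable_rat)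
  hence "AE x in lborel. \<forall>(c,d)\<in>B. x \<in> {c<..<d} \<longrightarrow> f x = 0"
    by (subst AE_ball_countable) (auto simp: B_def intro: box[simplified])
  thus ?thesis
  proof eventually_elim
    case (elim x)
    show ?case
    proof
      assume "x \<in> \<Omega>"
      then obtain e where e: "e > 0" "ball x e \<subseteq> \<Omega>" using assms(1) openE by blast
      obtain c where c: "c \<in> \<rat>" "x - e < c" "c < x" using Rats_dense_in_real[of "x - e" x] e by auto
      obtain d where d: "d \<in> \<rat>" "x < d" "d < x + e" using Rats_dense_in_real[of x "x + e"] e by auto
      have "{c..d} \<subseteq> \<Omega>" using e(2) c d by (auto simp: ball_def dist_real_def subset_iff)
      hence "(c, d) \<in> B" using c d by (simp add: B_def)
      thus "f x = 0" using elim c d by auto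
    qed
  qed
qed

section \<open>Weak derivatives on the line\<close>

lemma L2_locally_integrable:
  assumes "f \<in> L2 \<Omega>" "{a..b} \<subseteq> \<Omega>"
  shows "set_integrable lborel {a..b} f"
proof -
  have m: "set_borel_measurable lborel \<Omega> f" and i: "set_integrable lborel \<Omega> (\<lambda>x. (cmod (f x))\<^sup>2)"
    using assms(1) by (auto simp: L2_def)
  have "set_integrable lborel {a..b} (\<lambda>x. 1 + (cmod (f x))\<^sup>2)"
  proof (intro set_integral_add(1))
    show "set_integrable lborel {a..b} (\<lambda>x. 1::real)"
      by (intro borel_integrable_atLeastAtMost') auto
    show "set_integrable lborel {a..b} (\<lambda>x. (cmod (f x))\<^sup>2)"
      by (rule set_integrable_subset[OF i]) (use assms in auto)
  qed
  moreover have "set_borel_measurable lborel {a..b} f"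
    using set_borel_measurable_subset[OF m] assms(2) by simp
  ultimately show ?thesis
  proof (rule set_integrable_bound)
    show "AE x in lborel. x \<in> {a..b} \<longrightarrow> norm (f x) \<le> norm (1 + (cmod (f x))\<^sup>2)"
    proof (intro AE_I2 impI)
      fix x
      have "0 \<le> (cmod (f x) - 1)\<^sup>2" by simp
      hence "2 * cmod (f x) \<le> 1 + (cmod (f x))\<^sup>2" by (simp add: power2_diff)
      hence "cmod (f x) \<le> 1 + (cmod (f x))\<^sup>2" using norm_ge_zero[of "f x"] by linarith
      thus "norm (f x) \<le> norm (1 + (cmod (f x))\<^sup>2)" by simp
    qed
  qed
qed

lemma test_mult_integrable:
  assumes "\<eta> \<in> test_functions \<Omega>" "f \<in> L2 \<Omega>" "open \<Omega>"
  shows "set_integrable lborel \<Omega> (\<lambda>x. of_real (\<eta> x) * f x)"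
proof -
  have m: "set_borel_measurable lborel \<Omega> f" and i: "set_integrable lborel \<Omega> (\<lambda>x. (cmod (f x))\<^sup>2)"
    using assms(2) by (auto simp: L2_def)
  obtain K where K: "compact K" "K \<subseteq> \<Omega>" "\<And>x. x \<notin> K \<Longrightarrow> \<eta> x = 0" and s: "smooth \<eta>"
    using assms(1) unfolding test_functions_alt by auto
  have c: "continuous_on S \<eta>" for S using s by (rule smooth_continuous)
  have "integrable lborel (\<lambda>x. indicator K x *\<^sub>R (\<eta> x)\<^sup>2)"
    by (intro borel_integrable_compact K continuous_intros c)
  hence "set_integrable lborel \<Omega> (\<lambda>x. (\<eta> x)\<^sup>2)"
    unfolding set_integrable_def
    by (rule Bochner_Integration.integrable_cong[THEN iffD1, rotated 2])
      (use K in \<open>auto simp: indicator_def\<close>)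
  hence "set_integrable lborel \<Omega> (\<lambda>x. (\<eta> x)\<^sup>2 + (cmod (f x))\<^sup>2)" using i by simp
  moreover have "set_borel_measurable lborel \<Omega> (\<lambda>x. of_real (\<eta> x) * f x)"
  proof -
    have [measurable]: "\<eta> \<in> borel_measurable borel" using c borel_measurable_continuous_onI by blast
    have [measurable]: "(\<lambda>x. indicator \<Omega> x *\<^sub>R f x) \<in> borel_measurable borel"
      using m by (simp add: set_borel_measurable_def)
    have "(\<lambda>x. of_real (\<eta> x) * (indicator \<Omega> x *\<^sub>R f x)) \<in> borel_measurable lborel" by measurable
    thus ?thesis unfolding set_borel_measurable_def by simp
  qed
  ultimately show ?thesis
  proof (rule set_integrable_bound)
    show "AE x in lborel. x \<in> \<Omega> \<longrightarrow> norm (of_real (\<eta> x) * f x) \<le> norm ((\<eta> x)\<^sup>2 + (cmod (f x))\<^sup>2)"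
    proof (intro AE_I2 impI)
      fix x
      have "0 \<le> (\<bar>\<eta> x\<bar> - cmod (f x))\<^sup>2" by simp
      hence "2 * (\<bar>\<eta> x\<bar> * cmod (f x)) \<le> (\<eta> x)\<^sup>2 + (cmod (f x))\<^sup>2" by (simp add: power2_diff)
      moreover have "0 \<le> \<bar>\<eta> x\<bar> * cmod (f x)" by simp
      ultimately show "norm (of_real (\<eta> x) * f x) \<le> norm ((\<eta> x)\<^sup>2 + (cmod (f x))\<^sup>2)"
        unfolding norm_mult norm_of_real real_norm_def by linarith
    qed
  qed
qed

lemma weak_deriv_unique:
  assumes "open \<Omega>" "h1 \<in> L2 \<Omega>" "h2 \<in> L2 \<Omega>" "is_weak_deriv \<Omega> g h1" "is_weak_deriv \<Omega> g h2"
  shows "AE x in lborel. x \<in> \<Omega> \<longrightarrow> h1 x = h2 x"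
proof -
  have "AE x in lborel. x \<in> \<Omega> \<longrightarrow> h1 x - h2 x = 0"
  proof (rule AE_zero_of_test_integrals[OF assms(1)])
    show "set_integrable lborel {a..b} (\<lambda>x. h1 x - h2 x)" if "{a..b} \<subseteq> \<Omega>" for a b
      using L2_locally_integrable assms(2,3) that by (intro set_integral_diff) auto
    fix \<eta> assume \<eta>: "\<eta> \<in> test_functions \<Omega>"
    have "(LINT x:\<Omega>|lborel. of_real (\<eta> x) * (h1 x - h2 x)) =
       (LINT x:\<Omega>|lborel. of_real (\<eta> x) * h1 x) - (LINT x:\<Omega>|lborel. of_real (\<eta> x) * h2 x)"
      unfolding right_diff_distrib
      by (rule set_integral_diff(2)) (use test_mult_integrable[OF \<eta> _ assms(1)] assms in auto)
    also have "\<dots> = 0"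
      using assms(4,5)[unfolded is_weak_deriv_def, rule_format, OF \<eta>] by simp
    finally show "(LINT x:\<Omega>|lborel. of_real (\<eta> x) * (h1 x - h2 x)) = 0" .
  qed
  thus ?thesis by eventually_elim simp
qed

lemma sobolev_subset_L2: "sobolev k \<Omega> \<subseteq> L2 \<Omega>"
  by (cases k) auto

lemma weak_deriv_spec:
  assumes "g \<in> sobolev (Suc k) \<Omega>"
  shows "weak_deriv \<Omega> g \<in> L2 \<Omega> \<and> is_weak_deriv \<Omega> g (weak_deriv \<Omega> g)"
proof -
  have "\<exists>h. h \<in> L2 \<Omega> \<and> is_weak_deriv \<Omega> g h"
    using assms sobolev_subset_L2 by fastforce
  thus ?thesis unfolding weak_deriv_def by (rule someI_ex)
qed

lemma weak_deriv_AE_eq: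
  assumes "open \<Omega>" "h \<in> L2 \<Omega>" "is_weak_deriv \<Omega> g h"
  shows "weak_deriv \<Omega> g \<in> L2 \<Omega>" "is_weak_deriv \<Omega> g (weak_deriv \<Omega> g)"
    "AE x in lborel. x \<in> \<Omega> \<longrightarrow> weak_deriv \<Omega> g x = h x"
proof -
  show *: "weak_deriv \<Omega> g \<in> L2 \<Omega>" "is_weak_deriv \<Omega> g (weak_deriv \<Omega> g)"
    unfolding weak_deriv_def using someI[of "\<lambda>h. h \<in> L2 \<Omega> \<and> is_weak_deriv \<Omega> g h"] assms by auto
  show "AE x in lborel. x \<in> \<Omega> \<longrightarrow> weak_deriv \<Omega> g x = h x"
    by (rule weak_deriv_unique[OF assms(1) *(1) assms(2) *(2) assms(3)])
qed

text \<open>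
  The derivative of a test function is again a test function, and against those the two weak
  derivatives of \<open>g\<close> have the same integrals.
\<close>

lemma is_weak_deriv_transfer:
  assumes "is_weak_deriv \<Omega> g h1" "is_weak_deriv \<Omega> g h2" "is_weak_deriv \<Omega> h1 j"
  shows "is_weak_deriv \<Omega> h2 j"
  unfolding is_weak_deriv_def
proof
  fix \<eta> assume \<eta>: "\<eta> \<in> test_functions \<Omega>"
  have "(LINT x:\<Omega>|lborel. of_real (deriv \<eta> x) * h1 x) = (LINT x:\<Omega>|lborel. of_real (deriv \<eta> x) * h2 x)"
    using assms(1,2)[unfolded is_weak_deriv_def, rule_format, OF deriv_test_function[OF \<eta>]] by simp
  thus "(LINT x:\<Omega>|lborel. of_real (deriv \<eta> x) * h2 x) = - (LINT x:\<Omega>|lborel. of_real (\<eta> x) * j x)"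
    using assms(3)[unfolded is_weak_deriv_def, rule_format, OF \<eta>] by simp
qed

text \<open>
  Membership in \<open>H\<^sup>2\<close> gives some first weak derivative that has a weak derivative in \<open>L\<^sup>2\<close>; the transfer
  lemma moves this to the chosen first weak derivative.
\<close>

lemma second_weak_deriv_spec:
  assumes "g \<in> sobolev 2 \<Omega>"
  shows "weak_deriv \<Omega> (weak_deriv \<Omega> g) \<in> L2 \<Omega>"
    "is_weak_deriv \<Omega> (weak_deriv \<Omega> g) (weak_deriv \<Omega> (weak_deriv \<Omega> g))"
proof -
  obtain h j where hj: "is_weak_deriv \<Omega> g h" "j \<in> L2 \<Omega>" "is_weak_deriv \<Omega> h j"
    using assms by (auto simp: numeral_2_eq_2)
  have "is_weak_deriv \<Omega> g (weak_deriv \<Omega> g)"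
    using weak_deriv_spec[of g 1] assms by (simp add: numeral_2_eq_2)
  from is_weak_deriv_transfer[OF hj(1) this hj(3)] hj(2)
  have "\<exists>j. j \<in> L2 \<Omega> \<and> is_weak_deriv \<Omega> (weak_deriv \<Omega> g) j" by blast
  from someI_ex[OF this]
  show "weak_deriv \<Omega> (weak_deriv \<Omega> g) \<in> L2 \<Omega>"
    "is_weak_deriv \<Omega> (weak_deriv \<Omega> g) (weak_deriv \<Omega> (weak_deriv \<Omega> g))"
    unfolding weak_deriv_def[of \<Omega> "weak_deriv \<Omega> g"] by auto
qed

lemma continuous_AE_zero_imp_zero:
  fixes f :: "real \<Rightarrow> 'a::real_normed_vector"
  assumes "open S" "continuous_on S f" "AE x in lborel. x \<in> S \<longrightarrow> f x = 0" "x \<in> S"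
  shows "f x = 0"
proof (rule ccontr)
  assume nz: "f x \<noteq> 0"
  have "open (S \<inter> f -` (- {0}))" (is "open ?U")
    using assms(1,2) by (simp add: continuous_open_preimage open_Compl)
  moreover have "?U \<noteq> {}" using nz assms(4) by auto
  ultimately have "\<not> negligible ?U" by (rule open_not_negligible)
  moreover have "?U \<in> null_sets lborel"
    using assms(3) \<open>open ?U\<close> by (subst AE_iff_null_sets) (auto elim!: eventually_mono)
  ultimately show False
    by (simp add: negligible_iff_null_sets null_sets_completionI)
qed

text \<open>
  Replaces a function by a representative that is continuous on an interval containing the support of
  the test function, so that the calculus on compact intervals applies.
\<close>

lemma LINT_test_localize:
  fixes g g0 :: "real \<Rightarrow> complex"
  assumes supp: "\<And>x. x \<notin> {a..b} \<Longrightarrow> \<eta> x = 0" and ab: "{a..b} \<subseteq> \<Omega>" and \<eta>: "continuous_on UNIV \<eta>"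
    and g: "set_borel_measurable lborel \<Omega> g" "continuous_on {a..b} g0"
    and eq: "AE x in lborel. x \<in> {a..b} \<longrightarrow> g0 x = g x"
  shows "(LINT x:\<Omega>|lborel. of_real (\<eta> x) * g x) = (LINT x:{a..b}|lborel. of_real (\<eta> x) * g0 x)"
proof -
  have m1[measurable]: "\<eta> \<in> borel_measurable borel" using \<eta> borel_measurable_continuous_onI by blast
  have m2[measurable]: "(\<lambda>x. indicator \<Omega> x *\<^sub>R g x) \<in> borel_measurable borel"
    using g by (simp add: set_borel_measurable_def)
  have m3[measurable]: "(\<lambda>x. indicator {a..b} x *\<^sub>R g0 x) \<in> borel_measurable borel"
    using borel_measurable_continuous_on_indicator[OF atLeastAtMost_borel g(2)] .
  have "(\<lambda>x. of_real (\<eta> x) * (indicator \<Omega> x *\<^sub>R g x)) \<in> borel_measurable lborel" by measurable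
  moreover have "(\<lambda>x. of_real (\<eta> x) * (indicator {a..b} x *\<^sub>R g0 x)) \<in> borel_measurable lborel" by measurable
  moreover have "AE x in lborel. of_real (\<eta> x) * (indicator \<Omega> x *\<^sub>R g x) = of_real (\<eta> x) * (indicator {a..b} x *\<^sub>R g0 x)"
    using eq
  proof eventually_elim
    case (elim x)
    thus ?case using supp[of x] ab by (cases "x \<in> {a..b}") (auto simp: indicator_def)
  qed
  ultimately have "(LINT x|lborel. of_real (\<eta> x) * (indicator \<Omega> x *\<^sub>R g x)) = (LINT x|lborel. of_real (\<eta> x) * (indicator {a..b} x *\<^sub>R g0 x))"
    by (rule integral_cong_AE)
  thus ?thesis by (simp add: set_lebesgue_integral_def)
qed

lemma antiderivative_of_compact_support:
  fixes \<psi> :: "real \<Rightarrow> real"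
  assumes c: "continuous_on UNIV \<psi>" and supp: "\<And>x. x \<notin> {l..r} \<Longrightarrow> \<psi> x = 0"
    and z: "integral {l..r} \<psi> = 0" and "l \<le> r"
  obtains \<zeta> where "\<And>x. (\<zeta> has_real_derivative \<psi> x) (at x)" "\<And>x. x \<notin> {l..r} \<Longrightarrow> \<zeta> x = 0"
proof
  define \<zeta> where "\<zeta> x = integral {l - 1..x} \<psi>" for x
  have int: "\<psi> integrable_on {u..v}" for u v
    by (rule integrable_continuous_real) (rule continuous_on_subset[OF c], simp)
  have left: "\<zeta> x = 0" if "x < l" for x
  proof -
    have "integral {l - 1..x} \<psi> = integral {l - 1..x} (\<lambda>_. 0)"
      by (rule integral_cong) (use that supp in auto)
    thus ?thesis by (simp add: \<zeta>_def)
  qed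
  show "(\<zeta> has_real_derivative \<psi> x) (at x)" for x
  proof (cases "x < l")
    case True
    have "(\<zeta> has_real_derivative 0) (at x)"
      by (rule has_field_derivative_transform_within_open[of "\<lambda>_. 0" 0 _ "{..<l}"]) (use True left in auto)
    thus ?thesis using True supp by auto
  next
    case False
    have "(\<zeta> has_real_derivative \<psi> x) (at x within {l - 1..x + 1})"
      unfolding \<zeta>_def by (rule integral_has_real_derivative)
        (use False continuous_on_subset[OF c] in auto)
    moreover have "at x within {l - 1..x + 1} = at x"
      by (rule at_within_interior) (use False in auto)
    ultimately show ?thesis by simp
  qed
  show "\<zeta> x = 0" if "x \<notin> {l..r}" for x
  proof (cases "x < l")
    case False
    hence x: "r < x" using that by auto
    have "\<zeta> x = integral {l - 1..l} \<psi> + integral {l..x} \<psi>"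
      unfolding \<zeta>_def by (rule Henstock_Kurzweil_Integration.integral_combine[symmetric]) (use False int in auto)
    also have "integral {l..x} \<psi> = integral {l..r} \<psi> + integral {r..x} \<psi>"
      by (rule Henstock_Kurzweil_Integration.integral_combine[symmetric]) (use x assms int in auto)
    also have "integral {r..x} \<psi> = integral {r..x} (\<lambda>_. 0)"
      by (rule integral_spike[of "{r}"]) (use supp in auto)
    also have "integral {l - 1..l} \<psi> = integral {l-1..l} (\<lambda>_. 0)"
      by (rule integral_spike[of "{l}"]) (use supp in auto)
    finally show ?thesis using z by simp
  qed (use left in auto)
qed

text \<open>
  The lemma of du Bois-Reymond. With a fixed bump \<open>\<rho>\<close> of integral \<open>I\<close>, every test function \<open>\<eta>\<close> is the
  derivative of a test function up to the multiple \<open>(\<integral>\<eta>) / I\<close> of \<open>\<rho>\<close>. Hence \<open>\<integral> \<eta> * F = (\<integral>\<eta>) * C\<close> where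
  \<open>C\<close> does not depend on \<open>\<eta>\<close>, and \<open>F - C\<close> vanishes by the fundamental lemma.
\<close>

lemma constant_of_zero_weak_deriv:
  fixes F :: "real \<Rightarrow> complex"
  assumes ab: "a < b" and F: "continuous_on {a..b} F"
    and test: "\<And>\<eta>. \<eta> \<in> test_functions {a<..<b} \<Longrightarrow> (LINT x:{a..b}|lborel. of_real (deriv \<eta> x) * F x) = 0"
  obtains C where "\<And>x. x \<in> {a<..<b} \<Longrightarrow> F x = C"
proof -
  \<comment> \<open>The bump lives on the middle third, so that its support is a compact subset of \<open>(a, b)\<close>.\<close>
  define a1 b1 where "a1 = (2 * a + b) / 3" and "b1 = (a + 2 * b) / 3"
  have a1b1: "a < a1" "a1 < b1" "b1 < b" using ab by (auto simp: a1_def b1_def)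
  define \<rho> where "\<rho> = std_bump 1 a1 b1"
  have \<rho>s: "smooth \<rho>" unfolding \<rho>_def by (rule smooth_bump) simp
  have \<rho>0: "\<rho> x = 0" if "x \<notin> {a1..b1}" for x using that by (auto simp: \<rho>_def bump_def)
  have \<rho>nn: "\<rho> x \<ge> 0" for x by (auto simp: \<rho>_def bump_def)
  have sint: "\<psi> integrable_on {u..v}" if "smooth \<psi>" for \<psi> u v
    by (rule integrable_continuous_real) (rule smooth_continuous[OF that])
  define I where "I = integral {a..b} \<rho>"
  have I: "I > 0"
  proof -
    have "I \<ge> 0" unfolding I_def by (rule integral_nonneg[OF sint[OF \<rho>s]]) (use \<rho>nn in auto)
    moreover have "I \<noteq> 0"
    proof
      assume "I = 0"
      hence "(\<rho> has_integral 0) {a..b}" using sint[OF \<rho>s] unfolding I_def by (metis integrable_integral)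
      hence "\<rho> ((a1 + b1) / 2) = 0"
        using has_integral_0_cbox_imp_0[of a b \<rho> "(a1 + b1) / 2"] smooth_continuous[OF \<rho>s] \<rho>nn a1b1 by simp
      thus False using a1b1 by (auto simp: \<rho>_def bump_def)
    qed
    ultimately show ?thesis by simp
  qed
  define C where "C = (LINT x:{a..b}|lborel. of_real (\<rho> x) * F x) / of_real I"
  have sintF: "set_integrable lborel {a..b} (\<lambda>x. of_real (\<psi> x) * F x)" if "smooth \<psi>" for \<psi>
    by (intro borel_integrable_atLeastAtMost' continuous_intros F smooth_continuous that)
  have "AE x in lborel. x \<in> {a<..<b} \<longrightarrow> F x - C = 0"
  proof (rule AE_zero_of_test_integrals)
    show "set_integrable lborel {u..v} (\<lambda>x. F x - C)" if "{u..v} \<subseteq> {a<..<b}" for u v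
      by (intro borel_integrable_atLeastAtMost' continuous_intros continuous_on_subset[OF F])
        (use that in \<open>auto simp: subset_iff\<close>)
    fix \<eta> assume \<eta>: "\<eta> \<in> test_functions {a<..<b}"
    obtain K where K: "compact K" "K \<subseteq> {a<..<b}" "\<And>x. x \<notin> K \<Longrightarrow> \<eta> x = 0" and \<eta>s: "smooth \<eta>"
      using \<eta> unfolding test_functions_alt by auto
    have "compact (K \<union> {a1..b1})" "K \<union> {a1..b1} \<noteq> {}" using K(1) a1b1 by auto
    then obtain l r where lr: "l \<in> K \<union> {a1..b1}" "r \<in> K \<union> {a1..b1}" "\<And>x. x \<in> K \<union> {a1..b1} \<Longrightarrow> l \<le> x \<and> x \<le> r"
      using compact_attains_inf[of "K \<union> {a1..b1}"] compact_attains_sup[of "K \<union> {a1..b1}"] by blast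
    have lr': "a < l" "l \<le> r" "r < b" using lr K(2) a1b1 by (auto simp: subset_iff)
    define J where "J = integral {a..b} \<eta>"
    define \<psi> where "\<psi> = (\<lambda>x. \<eta> x + (- J / I) * \<rho> x)"
    have \<psi>s: "smooth \<psi>" unfolding \<psi>_def by (rule smooth_lin[OF \<eta>s \<rho>s])
    have \<psi>0: "\<psi> x = 0" if "x \<notin> {l..r}" for x
    proof -
      have "x \<notin> K \<union> {a1..b1}" using that lr(3) by auto
      thus ?thesis using K(3) \<rho>0 by (simp add: \<psi>_def)
    qed
    have "integral {a..b} \<psi> = J + (- J / I) * I"
      unfolding \<psi>_def J_def I_def
      by (subst Henstock_Kurzweil_Integration.integral_add[OF sint[OF \<eta>s] integrable_on_mult_right[OF sint[OF \<rho>s]]])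
        (simp only: integral_mult_right)
    hence "integral {a..b} \<psi> = 0" using I by simp
    moreover have "integral {l..r} \<psi> = integral {a..b} \<psi>"
    proof -
      have "integral {a..b} \<psi> = integral {a..l} \<psi> + integral {l..b} \<psi>"
        by (rule Henstock_Kurzweil_Integration.integral_combine[symmetric]) (use lr' sint \<psi>s in auto)
      also have "integral {l..b} \<psi> = integral {l..r} \<psi> + integral {r..b} \<psi>"
        by (rule Henstock_Kurzweil_Integration.integral_combine[symmetric]) (use lr' sint \<psi>s in auto)
      also have "integral {r..b} \<psi> = integral {r..b} (\<lambda>_. 0)"
        by (rule integral_spike[of "{r}"]) (use \<psi>0 in auto)
      also have "integral {a..l} \<psi> = integral {a..l} (\<lambda>_. 0)"
        by (rule integral_spike[of "{l}"]) (use \<psi>0 in auto)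
      finally show ?thesis by simp
    qed
    ultimately obtain \<zeta> where \<zeta>: "\<And>x. (\<zeta> has_real_derivative \<psi> x) (at x)" "\<And>x. x \<notin> {l..r} \<Longrightarrow> \<zeta> x = 0"
      using antiderivative_of_compact_support[OF smooth_continuous[OF \<psi>s] \<psi>0] lr'(2) by metis
    have "smooth \<zeta>" by (rule smooth_antideriv[OF \<zeta>(1) \<psi>s])
    hence "\<zeta> \<in> test_functions {a<..<b}"
      unfolding test_functions_alt using \<zeta>(2) lr' by (auto intro!: exI[of _ "{l..r}"])
    moreover have "deriv \<zeta> = \<psi>" using \<zeta>(1) by (auto intro: DERIV_imp_deriv)
    ultimately have "(LINT x:{a..b}|lborel. of_real (\<psi> x) * F x) = 0" using test by metis
    also have "(LINT x:{a..b}|lborel. of_real (\<psi> x) * F x) =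
       (LINT x:{a..b}|lborel. of_real (\<eta> x) * F x + of_real (- J / I) * (of_real (\<rho> x) * F x))"
      by (simp add: \<psi>_def algebra_simps)
    also have "\<dots> = (LINT x:{a..b}|lborel. of_real (\<eta> x) * F x) + of_real (- J / I) * (LINT x:{a..b}|lborel. of_real (\<rho> x) * F x)"
      by (subst set_integral_add(2)[OF sintF[OF \<eta>s] set_integrable_mult_right[OF sintF[OF \<rho>s]]])
        (simp only: set_integral_mult_right)
    finally have 1: "(LINT x:{a..b}|lborel. of_real (\<eta> x) * F x) = of_real J * C"
      using I by (simp add: C_def field_simps)
    have 2: "(LINT x:{a..b}|lborel. of_real (\<eta> x)) = (of_real J :: complex)"
      unfolding J_def using set_borel_integral_eq_integral(2)[of "{a..b}" \<eta>]
      by (simp add: set_integral_complex_of_real borel_integrable_atLeastAtMost' smooth_continuous[OF \<eta>s])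
    have "(LINT x:{a<..<b}|lborel. of_real (\<eta> x) * (F x - C)) = (LINT x:{a..b}|lborel. of_real (\<eta> x) * (F x - C))"
      by (rule set_integral_discrete_difference[of "{a, b}"]) (use ab in auto)
    also have "\<dots> = (LINT x:{a..b}|lborel. of_real (\<eta> x) * F x) - (LINT x:{a..b}|lborel. of_real (\<eta> x) * C)"
      unfolding right_diff_distrib
      by (rule set_integral_diff(2)) (auto intro!: sintF \<eta>s borel_integrable_atLeastAtMost' continuous_intros smooth_continuous F)
    also have "\<dots> = 0" by (simp add: 1 2)
    finally show "(LINT x:{a<..<b}|lborel. of_real (\<eta> x) * (F x - C)) = 0" .
  qed auto
  hence "F x = C" if "x \<in> {a<..<b}" for x
  proof -
    have "continuous_on {a<..<b} (\<lambda>x. F x - C)"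
      by (rule continuous_on_diff[OF continuous_on_subset[OF F]]) auto
    thus ?thesis
      using continuous_AE_zero_imp_zero[of "{a<..<b}" "\<lambda>x. F x - C" x] \<open>AE x in lborel. _\<close> that by auto
  qed
  thus ?thesis using that by blast
qed

text \<open>
  The continuous representative \<open>g0\<close> minus an antiderivative of \<open>h0\<close> has weak derivative \<open>0\<close>, hence is
  constant.
\<close>

lemma weak_deriv_classical:
  fixes g h g0 h0 :: "real \<Rightarrow> complex"
  assumes ab: "a < b" "{a..b} \<subseteq> \<Omega>" and wd: "is_weak_deriv \<Omega> g h"
    and gm: "set_borel_measurable lborel \<Omega> g" and hm: "set_borel_measurable lborel \<Omega> h"
    and g0: "continuous_on {a..b} g0" and h0: "continuous_on {a..b} h0"
    and g0g: "AE x in lborel. x \<in> {a..b} \<longrightarrow> g0 x = g x" and h0h: "AE x in lborel. x \<in> {a..b} \<longrightarrow> h0 x = h x"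
    and x: "x \<in> {a<..<b}"
  shows "(g0 has_vector_derivative h0 x) (at x)"
proof -
  define H where "H x = integral {a..x} h0" for x
  have dH: "(H has_vector_derivative h0 x) (at x within {a..b})" if "x \<in> {a..b}" for x
    unfolding H_def using integral_has_vector_derivative[OF h0 that] .
  have cH: "continuous_on {a..b} H"
    using dH by (meson continuous_on_eq_continuous_within has_vector_derivative_continuous)
  have cF: "continuous_on {a..b} (\<lambda>x. g0 x - H x)" by (intro continuous_intros g0 cH)
  have test: "(LINT x:{a..b}|lborel. of_real (deriv \<eta> x) * (g0 x - H x)) = 0"
    if \<eta>: "\<eta> \<in> test_functions {a<..<b}" for \<eta>
  proof -
    obtain K where K: "compact K" "K \<subseteq> {a<..<b}" "\<And>x. x \<notin> K \<Longrightarrow> \<eta> x = 0" "\<And>x. x \<notin> K \<Longrightarrow> deriv \<eta> x = 0"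
      using test_function_support[OF \<eta>] by metis
    have sub: "{a<..<b} \<subseteq> {a..b}" by auto
    have \<eta>s: "smooth \<eta>" using \<eta> by (simp add: test_functions_alt)
    have \<eta>\<Omega>: "\<eta> \<in> test_functions \<Omega>"
      unfolding test_functions_alt using \<eta>s K(1,3) order_trans[OF K(2) order_trans[OF sub ab(2)]] by blast
    have K': "x \<notin> {a..b} \<Longrightarrow> \<eta> x = 0" "x \<notin> {a..b} \<Longrightarrow> deriv \<eta> x = 0" for x
      using K(3,4) K(2) sub by blast+
    have c: "continuous_on S \<eta>" "continuous_on S (deriv \<eta>)" for S
      using \<eta>s smooth_deriv smooth_continuous by blast+
    have "(LINT x:{a..b}|lborel. of_real (deriv \<eta> x) * g0 x) = - (LINT x:{a..b}|lborel. of_real (\<eta> x) * h0 x)"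
      using wd[unfolded is_weak_deriv_def, rule_format, OF \<eta>\<Omega>]
      using LINT_test_localize[OF K'(2) ab(2) c(2) gm g0 g0g] LINT_test_localize[OF K'(1) ab(2) c(1) hm h0 h0h]
      by simp
    moreover have "(LINT x:{a..b}|lborel. of_real (deriv \<eta> x) * H x) = - (LINT x:{a..b}|lborel. of_real (\<eta> x) * h0 x)"
    proof -
      have "(LINT x:{a..b}|lborel. of_real (deriv \<eta> x) * H x + of_real (\<eta> x) * h0 x) = of_real (\<eta> b) * H b - of_real (\<eta> a) * H a"
        unfolding set_lebesgue_integral_def
      proof (rule integral_FTC_atLeastAtMost)
        fix x assume "a \<le> x" "x \<le> b"
        have "((\<lambda>x. \<eta> x *\<^sub>R H x) has_vector_derivative (\<eta> x *\<^sub>R h0 x + deriv \<eta> x *\<^sub>R H x)) (at x within {a..b})"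
          by (rule has_vector_derivative_scaleR)
            (use dH \<open>a \<le> x\<close> \<open>x \<le> b\<close> smooth_has_derivative[OF \<eta>s] in \<open>auto intro: has_field_derivative_at_within\<close>)
        thus "((\<lambda>x. of_real (\<eta> x) * H x) has_vector_derivative of_real (deriv \<eta> x) * H x + of_real (\<eta> x) * h0 x) (at x within {a..b})"
          by (simp add: scaleR_conv_of_real add.commute)
      qed (use ab in \<open>auto intro!: continuous_intros c cH h0\<close>)
      also have "\<dots> = 0"
      proof -
        have "a \<notin> K" "b \<notin> K" using K(2) by auto
        thus ?thesis using K(3) by simp
      qed
      also have "(LINT x:{a..b}|lborel. of_real (deriv \<eta> x) * H x + of_real (\<eta> x) * h0 x) =
         (LINT x:{a..b}|lborel. of_real (deriv \<eta> x) * H x) + (LINT x:{a..b}|lborel. of_real (\<eta> x) * h0 x)"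
        by (rule set_integral_add(2)) (auto intro!: borel_integrable_atLeastAtMost' continuous_intros c cH h0)
      finally show ?thesis by (simp add: eq_neg_iff_add_eq_0)
    qed
    moreover have "(LINT x:{a..b}|lborel. of_real (deriv \<eta> x) * (g0 x - H x)) =
       (LINT x:{a..b}|lborel. of_real (deriv \<eta> x) * g0 x) - (LINT x:{a..b}|lborel. of_real (deriv \<eta> x) * H x)"
      unfolding right_diff_distrib
      by (rule set_integral_diff(2)) (auto intro!: borel_integrable_atLeastAtMost' continuous_intros c cH g0)
    ultimately show ?thesis by simp
  qed
  obtain C where C: "\<And>x. x \<in> {a<..<b} \<Longrightarrow> g0 x - H x = C"
    using constant_of_zero_weak_deriv[OF ab(1) cF test] by blast
  have "(H has_vector_derivative h0 x) (at x)"
    using dH[of x] x at_within_interior[of x "{a..b}"] by simp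
  hence "((\<lambda>x. H x + C) has_vector_derivative h0 x) (at x)"
    by (auto intro!: derivative_eq_intros)
  thus ?thesis
    by (rule has_vector_derivative_transform_within_open[where S="{a<..<b}"]) (use x C in \<open>auto simp: algebra_simps\<close>)
qed

section \<open>Jost solutions of an exponentially decaying potential\<close>

text \<open>
  The potential is \<open>q s = c * y * r y\<close> with \<open>y = exp (- c * s)\<close>. This variable maps the half line
  \<open>[s, \<infinity>]\<close> to the compact interval \<open>[0, y]\<close> and \<open>q s ds\<close> to \<open>- r y dy\<close>, so that all integrals to infinity
  become integrals of continuous functions over \<open>[0, 1]\<close>.
\<close>

locale jost =
  fixes c k C :: real and r :: "real \<Rightarrow> real"
  assumes c_pos: "c > 0" and k_pos: "k > 0" and C_pos: "C > 0"
    and r_cont: "continuous_on {0..} r" and r_bound: "\<And>y. y \<ge> 0 \<Longrightarrow> \<bar>r y\<bar> \<le> C"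
begin

definition q :: "real \<Rightarrow> real" where "q s = c * exp (- c * s) * r (exp (- c * s))"

text \<open>
  The rate of the exponential weight that makes the integral operator below a contraction with
  factor \<open>1/2\<close> on the whole half line at once.
\<close>

definition lam :: real where "lam = C / k"

lemma lam_pos: "lam > 0" using C_pos k_pos by (simp add: lam_def)

lemma continuous_on_r: "continuous_on S f \<Longrightarrow> (\<And>x. x \<in> S \<Longrightarrow> f x \<ge> 0) \<Longrightarrow> continuous_on S (\<lambda>x. r (f x))"
  by (rule continuous_on_compose2[OF r_cont]) auto

text \<open>
  Writing a solution of \<open>f'' = (\<kappa>\<^sup>2 - q) f\<close> as \<open>exp (- \<kappa> * s) * m y\<close>, the condition \<open>m 0 = 1\<close> turns the
  equation into the Volterra equation
  \<open>m y = 1 - y / (2 * \<kappa>) * \<integral>\<^sub>0\<^sup>1 (1 - \<tau> powr (2 * \<kappa> / c)) * r (y * \<tau>) * m (y * \<tau>) d\<tau>\<close>.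
  The next two definitions express it for \<open>n = exp (- lam * y) * m\<close>. Clamping to \<open>y \<ge> 0\<close> and \<open>\<kappa> \<ge> k\<close> makes
  the operator act on bounded continuous functions on the whole plane, a complete space.
\<close>

definition kern :: "(real \<times> real \<Rightarrow> real) \<Rightarrow> real \<times> real \<Rightarrow> real \<Rightarrow> real" where
  "kern n p \<tau> = (let y = max 0 (fst p); \<kappa> = max k (snd p) in
     (1 - \<tau> powr (2 * \<kappa> / c)) * r (y * \<tau>) * exp (- lam * y * (1 - \<tau>)) * n (y * \<tau>, \<kappa>))"

definition volterra :: "(real \<times> real \<Rightarrow> real) \<Rightarrow> real \<times> real \<Rightarrow> real" where
  "volterra n p = (let y = max 0 (fst p); \<kappa> = max k (snd p) in
     exp (- lam * y) - y / (2 * \<kappa>) * integral {0..1} (kern n p))"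

lemma continuous_on_kern:
  assumes "continuous_on UNIV n"
  shows "continuous_on (UNIV \<times> {0..1}) (\<lambda>(p, \<tau>). kern n p \<tau>)"
proof -
  have n: "continuous_on S (\<lambda>x. n (f x))" if "continuous_on S f" for S and f :: "(real \<times> real) \<times> real \<Rightarrow> real \<times> real"
    by (rule continuous_on_compose2[OF assms that]) auto
  show ?thesis
    unfolding kern_def Let_def case_prod_beta
    by (intro continuous_intros continuous_on_r n continuous_on_powr')
      (use c_pos k_pos in \<open>auto simp: max_def\<close>)
qed

lemma kern_integrable:
  assumes "continuous_on UNIV n" shows "kern n p integrable_on {0..1}"
proof (rule integrable_continuous_real)
  have "continuous_on {0..1} (\<lambda>\<tau>. case (p, \<tau>) of (p, \<tau>) \<Rightarrow> kern n p \<tau>)"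
    by (rule continuous_on_compose2[OF continuous_on_kern[OF assms]]) (auto intro!: continuous_intros)
  thus "continuous_on {0..1} (kern n p)" by simp
qed

lemma continuous_on_volterra:
  assumes "continuous_on UNIV n" shows "continuous_on UNIV (volterra n)"
proof -
  have "continuous_on UNIV (\<lambda>p. integral (cbox 0 1) (kern n p))"
    by (rule integral_continuous_on_param) (use continuous_on_kern[OF assms] in simp)
  thus ?thesis unfolding volterra_def Let_def
    by (intro continuous_intros) (use k_pos in auto)
qed

text \<open>
  The gain from the weight: integrating it over \<open>[0, y]\<close> yields the factor \<open>1 / lam\<close>,
  uniformly in \<open>y\<close>.
\<close>

lemma weight_integral:
  assumes "y \<ge> 0"
  shows "(\<lambda>\<tau>. exp (- lam * y * (1 - \<tau>))) integrable_on {0..1}"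
    "y * integral {0..1} (\<lambda>\<tau>. exp (- lam * y * (1 - \<tau>))) \<le> 1 / lam"
proof -
  show i: "(\<lambda>\<tau>. exp (- lam * y * (1 - \<tau>))) integrable_on {0..1}"
    by (intro integrable_continuous_real continuous_intros)
  show "y * integral {0..1} (\<lambda>\<tau>. exp (- lam * y * (1 - \<tau>))) \<le> 1 / lam"
  proof (cases "y = 0")
    case False
    have "((\<lambda>\<tau>. exp (- lam * y * (1 - \<tau>))) has_integral
        exp (- lam * y * (1 - 1)) / (lam * y) - exp (- lam * y * (1 - 0)) / (lam * y)) {0..1}"
      by (rule fundamental_theorem_of_calculus)
        (use False lam_pos in \<open>auto intro!: derivative_eq_intros simp: has_real_derivative_iff_has_vector_derivative[symmetric]\<close>)
    hence "y * integral {0..1} (\<lambda>\<tau>. exp (- lam * y * (1 - \<tau>))) = (1 - exp (- lam * y)) / lam"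
      using False lam_pos by (auto simp: integral_unique field_simps)
    also have "\<dots> \<le> 1 / lam" using lam_pos by (intro divide_right_mono) auto
    finally show ?thesis .
  qed (use lam_pos in simp)
qed

lemma powr_unit: "0 \<le> \<tau> \<Longrightarrow> \<tau> \<le> 1 \<Longrightarrow> \<nu> > 0 \<Longrightarrow> 0 \<le> \<tau> powr \<nu> \<and> \<tau> powr \<nu> \<le> (1::real)"
  using powr_le_one_le[of \<tau>] by (cases "\<tau> = 0") (auto simp: powr_le1)

lemma kern_integral_bound:
  assumes n: "continuous_on UNIV n" and b: "\<And>p. \<bar>n p\<bar> \<le> M"
  defines "y p \<equiv> max 0 (fst p)" and "\<kappa> p \<equiv> max k (snd p)"
  shows "\<bar>y p / (2 * \<kappa> p) * integral {0..1} (kern n p)\<bar> \<le> M / 2"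
proof -
  have y0: "y p \<ge> 0" and k0: "\<kappa> p \<ge> k" by (auto simp: y_def \<kappa>_def)
  have M: "M \<ge> 0" using b[of p] by linarith
  have "norm (integral {0..1} (kern n p)) \<le> integral {0..1} (\<lambda>\<tau>. C * M * exp (- lam * y p * (1 - \<tau>)))"
  proof (rule integral_norm_bound_integral[OF kern_integrable[OF n]])
    show "(\<lambda>\<tau>. C * M * exp (- lam * y p * (1 - \<tau>))) integrable_on {0..1}"
      by (intro integrable_continuous_real continuous_intros)
    fix \<tau> :: real assume \<tau>: "\<tau> \<in> {0..1}"
    have "\<bar>1 - \<tau> powr (2 * \<kappa> p / c)\<bar> \<le> 1"
      using powr_unit[of \<tau> "2 * \<kappa> p / c"] \<tau> k0 k_pos c_pos by auto
    moreover have "\<bar>r (y p * \<tau>)\<bar> \<le> C" using \<tau> y0 by (intro r_bound) auto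
    ultimately have "\<bar>1 - \<tau> powr (2 * \<kappa> p / c)\<bar> * \<bar>r (y p * \<tau>)\<bar> * \<bar>exp (- lam * y p * (1 - \<tau>))\<bar> * \<bar>n (y p * \<tau>, \<kappa> p)\<bar>
      \<le> 1 * C * \<bar>exp (- lam * y p * (1 - \<tau>))\<bar> * M"
      by (intro mult_mono b) (use C_pos in auto)
    thus "norm (kern n p \<tau>) \<le> C * M * exp (- lam * y p * (1 - \<tau>))"
      unfolding kern_def Let_def y_def[symmetric] \<kappa>_def[symmetric] by (simp add: abs_mult mult_ac)
  qed
  hence "\<bar>integral {0..1} (kern n p)\<bar> \<le> C * M * integral {0..1} (\<lambda>\<tau>. exp (- lam * y p * (1 - \<tau>)))"
    by simp
  hence "y p * \<bar>integral {0..1} (kern n p)\<bar> \<le> y p * (C * M * integral {0..1} (\<lambda>\<tau>. exp (- lam * y p * (1 - \<tau>))))"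
    using y0 by (rule mult_left_mono)
  also have "\<dots> = C * M * (y p * integral {0..1} (\<lambda>\<tau>. exp (- lam * y p * (1 - \<tau>))))" by simp
  also have "\<dots> \<le> C * M * (1 / lam)"
    by (intro mult_left_mono weight_integral(2) y0) (use C_pos M in auto)
  also have "\<dots> = k * M" using C_pos k_pos by (simp add: lam_def)
  also have "\<dots> \<le> \<kappa> p * M" using k0 M by (rule mult_right_mono)
  finally have "y p * \<bar>integral {0..1} (kern n p)\<bar> \<le> \<kappa> p * M" .
  thus ?thesis using y0 k0 k_pos by (simp add: abs_mult field_simps)
qed

lemma kern_diff: "kern n1 p \<tau> - kern n2 p \<tau> = kern (\<lambda>p. n1 p - n2 p) p \<tau>"
  by (simp add: kern_def Let_def algebra_simps)

lemma volterra_fixed_point: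
  "\<exists>n. continuous_on UNIV n \<and> (\<forall>p. \<bar>n p\<bar> \<le> 2) \<and> (\<forall>p. volterra n p = n p)"
proof -
  define T :: "((real \<times> real) \<Rightarrow>\<^sub>C real) \<Rightarrow> ((real \<times> real) \<Rightarrow>\<^sub>C real)" where "T n = Bcontfun (volterra (apply_bcontfun n))" for n
  have e: "exp (- lam * max 0 y) \<le> 1" for y using lam_pos by (auto simp: mult_le_0_iff)
  have ap: "apply_bcontfun (T n) = volterra (apply_bcontfun n)" for n
  proof -
    have "volterra (apply_bcontfun n) \<in> bcontfun"
    proof (rule bcontfun_normI)
      show "continuous_on UNIV (volterra (apply_bcontfun n))" by (rule continuous_on_volterra) simp
      fix p
      have "\<bar>max 0 (fst p) / (2 * max k (snd p)) * integral {0..1} (kern (apply_bcontfun n) p)\<bar> \<le> norm n / 2"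
        by (rule kern_integral_bound) (use norm_bounded[of n] in auto)
      thus "norm (volterra (apply_bcontfun n) p) \<le> 1 + norm n / 2"
        unfolding volterra_def Let_def real_norm_def using e[of "fst p"] exp_gt_zero[of "- lam * max 0 (fst p)"] by linarith
    qed
    thus ?thesis unfolding T_def by (rule Bcontfun_inverse)
  qed
  have "\<exists>!n. T n = n"
  proof (rule banach_fix_type)
    show "\<forall>n1 n2. dist (T n1) (T n2) \<le> 1 / 2 * dist n1 n2"
    proof (intro allI dist_bound)
      fix n1 n2 :: "(real \<times> real) \<Rightarrow>\<^sub>C real" and p
      have "kern (apply_bcontfun n1) p integrable_on {0..1}" "kern (apply_bcontfun n2) p integrable_on {0..1}"
        by (auto intro!: kern_integrable)
      hence "integral {0..1} (\<lambda>\<tau>. kern (apply_bcontfun n1) p \<tau> - kern (apply_bcontfun n2) p \<tau>) =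
          integral {0..1} (kern (apply_bcontfun n1) p) - integral {0..1} (kern (apply_bcontfun n2) p)"
        by (rule Henstock_Kurzweil_Integration.integral_diff)
      hence "integral {0..1} (kern (\<lambda>p. apply_bcontfun n1 p - apply_bcontfun n2 p) p) =
          integral {0..1} (kern (apply_bcontfun n1) p) - integral {0..1} (kern (apply_bcontfun n2) p)"
        by (simp only: kern_diff)
      hence "volterra (apply_bcontfun n1) p - volterra (apply_bcontfun n2) p =
         - (max 0 (fst p) / (2 * max k (snd p)) * integral {0..1} (kern (\<lambda>p. apply_bcontfun n1 p - apply_bcontfun n2 p) p))"
        by (simp only: volterra_def Let_def right_diff_distrib)
      moreover have "\<bar>max 0 (fst p) / (2 * max k (snd p)) * integral {0..1} (kern (\<lambda>p. apply_bcontfun n1 p - apply_bcontfun n2 p) p)\<bar> \<le> dist n1 n2 / 2"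
      proof (rule kern_integral_bound)
        show "continuous_on UNIV (\<lambda>p. apply_bcontfun n1 p - apply_bcontfun n2 p)"
          by (intro continuous_on_diff continuous_on_apply_bcontfun)
        show "\<bar>apply_bcontfun n1 p - apply_bcontfun n2 p\<bar> \<le> dist n1 n2" for p
          using dist_bounded[of n1 p n2] by (simp only: dist_real_def)
      qed
      ultimately show "dist (apply_bcontfun (T n1) p) (apply_bcontfun (T n2) p) \<le> 1 / 2 * dist n1 n2"
        by (simp add: ap dist_real_def)
    qed
  qed auto
  then obtain n where n: "T n = n" by (rule ex1E)
  have fp: "volterra (apply_bcontfun n) p = apply_bcontfun n p" for p
    using ap[of n] unfolding n by (rule fun_cong[OF sym])
  have "norm n \<le> 1 + norm n / 2"
  proof (rule norm_bound)
    fix p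
    have "\<bar>max 0 (fst p) / (2 * max k (snd p)) * integral {0..1} (kern (apply_bcontfun n) p)\<bar> \<le> norm n / 2"
      by (rule kern_integral_bound) (use norm_bounded[of n] in auto)
    thus "norm (apply_bcontfun n p) \<le> 1 + norm n / 2"
      unfolding fp[of p, symmetric] volterra_def Let_def real_norm_def using e[of "fst p"] exp_gt_zero[of "- lam * max 0 (fst p)"] by linarith
  qed
  hence "\<bar>apply_bcontfun n p\<bar> \<le> 2" for p using norm_bounded[of n p] by simp
  thus ?thesis using fp by (intro exI[of _ "apply_bcontfun n"]) auto
qed

definition nfix :: "real \<times> real \<Rightarrow> real" where
  "nfix = (SOME n. continuous_on UNIV n \<and> (\<forall>p. \<bar>n p\<bar> \<le> 2) \<and> (\<forall>p. volterra n p = n p))"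

lemma nfix: "continuous_on UNIV nfix" "\<bar>nfix p\<bar> \<le> 2" "volterra nfix p = nfix p"
  unfolding nfix_def using someI_ex[OF volterra_fixed_point] by blast+

text \<open>
  The amplitude \<open>m\<close> of the Jost solution, without the weight.
\<close>

definition m :: "real \<Rightarrow> real \<Rightarrow> real" where "m y \<kappa> = exp (lam * y) * nfix (y, \<kappa>)"

lemma m_cont: "continuous_on S f \<Longrightarrow> continuous_on S g \<Longrightarrow> continuous_on S (\<lambda>x. m (f x) (g x))"
  unfolding m_def by (intro continuous_intros continuous_on_compose2[OF nfix(1)]) auto

lemma m_bound: "\<bar>m y \<kappa>\<bar> \<le> 2 * exp (lam * y)"
  unfolding m_def using nfix(2)[of "(y, \<kappa>)"] by (simp add: abs_mult)

lemma m_eq: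
  assumes "y \<ge> 0" "\<kappa> \<ge> k"
  shows "m y \<kappa> = 1 - y / (2 * \<kappa>) * integral {0..1} (\<lambda>\<tau>. (1 - \<tau> powr (2 * \<kappa> / c)) * r (y * \<tau>) * m (y * \<tau>) \<kappa>)"
proof -
  have "kern nfix (y, \<kappa>) \<tau> = exp (- lam * y) * ((1 - \<tau> powr (2 * \<kappa> / c)) * r (y * \<tau>) * m (y * \<tau>) \<kappa>)" for \<tau>
  proof -
    have "exp (- lam * y * (1 - \<tau>)) = exp (- lam * y) * exp (lam * (y * \<tau>))"
      by (simp add: mult_exp_exp algebra_simps)
    thus ?thesis using assms by (simp add: kern_def Let_def m_def max_def mult_ac)
  qed
  hence "kern nfix (y, \<kappa>) = (\<lambda>\<tau>. exp (- lam * y) * ((1 - \<tau> powr (2 * \<kappa> / c)) * r (y * \<tau>) * m (y * \<tau>) \<kappa>))"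
    by (rule ext)
  hence "nfix (y, \<kappa>) = exp (- lam * y) - y / (2 * \<kappa>) *
      (exp (- lam * y) * integral {0..1} (\<lambda>\<tau>. (1 - \<tau> powr (2 * \<kappa> / c)) * r (y * \<tau>) * m (y * \<tau>) \<kappa>))"
    using nfix(3)[of "(y, \<kappa>)"] assms by (simp add: volterra_def Let_def)
  hence "m y \<kappa> = (exp (lam * y) * exp (- lam * y)) * (1 - y / (2 * \<kappa>) *
      integral {0..1} (\<lambda>\<tau>. (1 - \<tau> powr (2 * \<kappa> / c)) * r (y * \<tau>) * m (y * \<tau>) \<kappa>))"
    unfolding m_def[of y \<kappa>] by (simp only: right_diff_distrib mult_ac mult_1_right)
  thus ?thesis by (simp only: mult_exp_exp) simp
qed

text \<open>
  The two halves of the integral in the Volterra equation. \<open>P\<close> is also the derivative of the amplitude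
  with respect to \<open>s\<close>, and both have elementary derivatives because \<open>A\<close> and \<open>y powr (2 * \<kappa> / c) * P\<close> are
  indefinite integrals in \<open>y\<close>.
\<close>

definition P :: "real \<Rightarrow> real \<Rightarrow> real" where
  "P y \<kappa> = y * integral {0..1} (\<lambda>\<tau>. \<tau> powr (2 * \<kappa> / c) * r (y * \<tau>) * m (y * \<tau>) \<kappa>)"

definition A :: "real \<Rightarrow> real \<Rightarrow> real" where
  "A y \<kappa> = y * integral {0..1} (\<lambda>\<tau>. r (y * \<tau>) * m (y * \<tau>) \<kappa>)"

lemma integral_scale_unit:
  fixes f :: "real \<Rightarrow> real"
  assumes "y > 0"
  shows "integral {0..y} f = y * integral {0..1} (\<lambda>\<tau>. f (y * \<tau>))"
proof -
  have "(\<lambda>x. x / y) ` {0..y} = {0..1}"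
    using assms by (simp add: image_divide_atLeastAtMost)
  thus ?thesis using integral_stretch_real[of y 0 y f] assms by simp
qed

context
  fixes \<kappa> :: real assumes \<kappa>: "\<kappa> \<ge> k"
begin

lemma \<kappa>_pos: "\<kappa> > 0" using \<kappa> k_pos by simp

lemma rm_cont: "continuous_on {0..} (\<lambda>z. r z * m z \<kappa>)"
  by (intro continuous_intros r_cont m_cont)

lemma prm_cont: "continuous_on {0..} (\<lambda>z. z powr (2 * \<kappa> / c) * (r z * m z \<kappa>))"
  by (intro continuous_intros rm_cont continuous_on_powr') (use \<kappa>_pos c_pos in auto)

lemma m_PA:
  assumes "y \<ge> 0" shows "m y \<kappa> = 1 - (A y \<kappa> - P y \<kappa>) / (2 * \<kappa>)"
proof -
  have 1: "(\<lambda>\<tau>. r (y * \<tau>) * m (y * \<tau>) \<kappa>) integrable_on {0..1}"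
    by (intro integrable_continuous_real continuous_intros m_cont continuous_on_r) (use assms in auto)
  have 2: "(\<lambda>\<tau>. \<tau> powr (2 * \<kappa> / c) * r (y * \<tau>) * m (y * \<tau>) \<kappa>) integrable_on {0..1}"
    by (intro integrable_continuous_real continuous_intros m_cont continuous_on_r continuous_on_powr')
      (use assms \<kappa>_pos c_pos in auto)
  define I1 where "I1 = integral {0..1} (\<lambda>\<tau>. r (y * \<tau>) * m (y * \<tau>) \<kappa>)"
  define I2 where "I2 = integral {0..1} (\<lambda>\<tau>. \<tau> powr (2 * \<kappa> / c) * r (y * \<tau>) * m (y * \<tau>) \<kappa>)"
  have "integral {0..1} (\<lambda>\<tau>. (1 - \<tau> powr (2 * \<kappa> / c)) * r (y * \<tau>) * m (y * \<tau>) \<kappa>) =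
    integral {0..1} (\<lambda>\<tau>. r (y * \<tau>) * m (y * \<tau>) \<kappa> - \<tau> powr (2 * \<kappa> / c) * r (y * \<tau>) * m (y * \<tau>) \<kappa>)"
    by (simp add: algebra_simps)
  also have "\<dots> = I1 - I2"
    unfolding I1_def I2_def by (rule Henstock_Kurzweil_Integration.integral_diff[OF 1 2])
  finally have "m y \<kappa> = 1 - y / (2 * \<kappa>) * (I1 - I2)" by (simp only: m_eq[OF assms \<kappa>])
  thus ?thesis
    unfolding A_def P_def I1_def[symmetric] I2_def[symmetric] using \<kappa>_pos by (simp add: field_simps)
qed

lemma integral_deriv_pos:
  assumes f: "continuous_on {0..} f" and y: "y > (0::real)"
  shows "((\<lambda>y. integral {0..y} f) has_real_derivative f y) (at y)"
proof -
  have "((\<lambda>y. integral {0..y} f) has_real_derivative f y) (at y within {0..y + 1})"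
    by (rule integral_has_real_derivative) (use y continuous_on_subset[OF f] in auto)
  moreover have "at y within {0..y + 1} = at y" by (rule at_within_interior) (use y in auto)
  ultimately show ?thesis by simp
qed

lemma A_deriv:
  assumes "y > 0" shows "((\<lambda>y. A y \<kappa>) has_real_derivative r y * m y \<kappa>) (at y)"
proof (rule has_field_derivative_transform_within_open[OF integral_deriv_pos[OF rm_cont assms], of "{0<..}"])
  fix y :: real assume "y \<in> {0<..}"
  thus "integral {0..y} (\<lambda>z. r z * m z \<kappa>) = A y \<kappa>"
    unfolding A_def by (intro integral_scale_unit) simp
qed (use assms in auto)

lemma P_deriv:
  assumes "y > 0" shows "((\<lambda>y. P y \<kappa>) has_real_derivative r y * m y \<kappa> - 2 * \<kappa> / (c * y) * P y \<kappa>) (at y)"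
proof -
  define \<nu> where "\<nu> = 2 * \<kappa> / c"
  define B where "B y = integral {0..y} (\<lambda>z. z powr \<nu> * (r z * m z \<kappa>))" for y
  have PB: "P y \<kappa> = y powr (- \<nu>) * B y" if "y > 0" for y
  proof -
    have "integral {0..1} (\<lambda>\<tau>. (y * \<tau>) powr \<nu> * (r (y * \<tau>) * m (y * \<tau>) \<kappa>)) =
       integral {0..1} (\<lambda>\<tau>. y powr \<nu> * (\<tau> powr \<nu> * r (y * \<tau>) * m (y * \<tau>) \<kappa>))"
      by (rule integral_cong) (use that in \<open>auto simp: powr_mult\<close>)
    thus ?thesis using that unfolding B_def P_def \<nu>_def[symmetric] integral_scale_unit[OF that]
      by (simp add: powr_minus)
  qed
  have B: "(B has_real_derivative y powr \<nu> * (r y * m y \<kappa>)) (at y)"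
    unfolding B_def \<nu>_def by (rule integral_deriv_pos[OF prm_cont assms])
  have "((\<lambda>y. y powr (- \<nu>) * B y) has_real_derivative
      (- \<nu>) * y powr (- \<nu> - 1) * B y + y powr (- \<nu>) * (y powr \<nu> * (r y * m y \<kappa>))) (at y)"
    by (rule derivative_eq_intros B has_real_derivative_powr[OF assms] refl)+ (simp add: algebra_simps)
  also have "(- \<nu>) * y powr (- \<nu> - 1) * B y + y powr (- \<nu>) * (y powr \<nu> * (r y * m y \<kappa>)) =
      r y * m y \<kappa> - 2 * \<kappa> / (c * y) * P y \<kappa>"
    using assms by (simp add: PB \<nu>_def powr_diff powr_minus field_simps)
  finally have *: "((\<lambda>y. y powr (- \<nu>) * B y) has_real_derivative r y * m y \<kappa> - 2 * \<kappa> / (c * y) * P y \<kappa>) (at y)" .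
  show ?thesis
    by (rule has_field_derivative_transform_within_open[OF *, of "{0<..}"]) (use assms PB in auto)
qed

lemma m_deriv:
  assumes "y > 0" shows "((\<lambda>y. m y \<kappa>) has_real_derivative - P y \<kappa> / (c * y)) (at y)"
proof -
  have "((\<lambda>y. A y \<kappa> - P y \<kappa>) has_real_derivative 2 * \<kappa> / (c * y) * P y \<kappa>) (at y)"
    by (rule DERIV_cong[OF DERIV_diff[OF A_deriv[OF assms] P_deriv[OF assms]]]) simp
  hence "((\<lambda>y. 1 - (A y \<kappa> - P y \<kappa>) / (2 * \<kappa>)) has_real_derivative 0 - (2 * \<kappa> / (c * y) * P y \<kappa>) / (2 * \<kappa>)) (at y)"
    by (intro DERIV_diff DERIV_const DERIV_cdivide)
  also have "0 - (2 * \<kappa> / (c * y) * P y \<kappa>) / (2 * \<kappa>) = - P y \<kappa> / (c * y)"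
    using \<kappa>_pos by simp
  finally have "((\<lambda>y. 1 - (A y \<kappa> - P y \<kappa>) / (2 * \<kappa>)) has_real_derivative - P y \<kappa> / (c * y)) (at y)" .
  thus ?thesis
    by (rule has_field_derivative_transform_within_open[of _ _ _ "{0<..}"]) (use assms m_PA in auto)
qed

lemma volterra_term_bound:
  assumes y: "y \<ge> 0" and h: "continuous_on {0..1} h" "\<And>\<tau>. \<tau> \<in> {0..1} \<Longrightarrow> \<bar>h \<tau>\<bar> \<le> 1"
  shows "\<bar>y * integral {0..1} (\<lambda>\<tau>. h \<tau> * r (y * \<tau>) * m (y * \<tau>) \<kappa>)\<bar> \<le> 2 * C * y * exp (lam * y)"
proof -
  let ?I = "integral {0..1} (\<lambda>\<tau>. h \<tau> * r (y * \<tau>) * m (y * \<tau>) \<kappa>)"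
  have "norm (?I) \<le> integral {0..1} (\<lambda>\<tau>::real. C * (2 * exp (lam * y)))"
  proof (rule integral_norm_bound_integral)
    show "(\<lambda>\<tau>. h \<tau> * r (y * \<tau>) * m (y * \<tau>) \<kappa>) integrable_on {0..1}"
      by (intro integrable_continuous_real continuous_intros m_cont continuous_on_r h) (use y in auto)
    fix \<tau> :: real assume \<tau>: "\<tau> \<in> {0..1}"
    have "\<bar>m (y * \<tau>) \<kappa>\<bar> \<le> 2 * exp (lam * (y * \<tau>))" by (rule m_bound)
    also have "\<dots> \<le> 2 * exp (lam * y)" using \<tau> y lam_pos by (simp add: mult_left_le)
    finally have "\<bar>h \<tau>\<bar> * \<bar>r (y * \<tau>)\<bar> * \<bar>m (y * \<tau>) \<kappa>\<bar> \<le> 1 * C * (2 * exp (lam * y))"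
      using \<tau> y C_pos by (intro mult_mono r_bound h(2)) auto
    thus "norm (h \<tau> * r (y * \<tau>) * m (y * \<tau>) \<kappa>) \<le> C * (2 * exp (lam * y))"
      by (simp add: abs_mult)
  qed auto
  hence "\<bar>?I\<bar> \<le> C * (2 * exp (lam * y))" by simp
  hence "y * \<bar>?I\<bar> \<le> y * (C * (2 * exp (lam * y)))"
    using y by (rule mult_left_mono)
  thus ?thesis using y by (simp add: abs_mult mult_ac)
qed

lemma P_bound:
  assumes "y \<ge> 0" shows "\<bar>P y \<kappa>\<bar> \<le> 2 * C * y * exp (lam * y)"
  unfolding P_def using \<kappa>_pos c_pos powr_unit[of _ "2 * \<kappa> / c"]
  by (intro volterra_term_bound assms continuous_intros continuous_on_powr') auto

lemma m_minus_1_bound: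
  assumes "y \<ge> 0" shows "\<bar>m y \<kappa> - 1\<bar> \<le> C * y * exp (lam * y) / \<kappa>"
proof -
  have "\<bar>y * integral {0..1} (\<lambda>\<tau>. (1 - \<tau> powr (2 * \<kappa> / c)) * r (y * \<tau>) * m (y * \<tau>) \<kappa>)\<bar> \<le> 2 * C * y * exp (lam * y)"
    using \<kappa>_pos c_pos powr_unit[of _ "2 * \<kappa> / c"]
    by (intro volterra_term_bound assms continuous_intros continuous_on_powr') auto
  thus ?thesis using \<kappa>_pos by (simp add: m_eq[OF assms \<kappa>] abs_mult field_simps)
qed

end

text \<open>
  The Jost solution and its derivative.
\<close>

definition u :: "real \<Rightarrow> real \<Rightarrow> real" where
  "u \<kappa> s = exp (- \<kappa> * s) * m (exp (- c * s)) \<kappa>"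

definition v :: "real \<Rightarrow> real \<Rightarrow> real" where
  "v \<kappa> s = exp (- \<kappa> * s) * (P (exp (- c * s)) \<kappa> - \<kappa> * m (exp (- c * s)) \<kappa>)"

lemma u_deriv:
  assumes "\<kappa> \<ge> k" shows "(u \<kappa> has_real_derivative v \<kappa> s) (at s)"
proof -
  have "((\<lambda>s. m (exp (- c * s)) \<kappa>) has_real_derivative (- P (exp (- c * s)) \<kappa> / (c * exp (- c * s))) * (- c * exp (- c * s))) (at s)"
    by (rule DERIV_chain2[OF m_deriv[OF assms]]) (auto intro!: derivative_eq_intros)
  hence "((\<lambda>s. m (exp (- c * s)) \<kappa>) has_real_derivative P (exp (- c * s)) \<kappa>) (at s)"
    using c_pos by simp
  thus ?thesis unfolding u_def[abs_def] v_def
    by (auto intro!: derivative_eq_intros simp: algebra_simps)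
qed

lemma v_deriv:
  assumes "\<kappa> \<ge> k" shows "(v \<kappa> has_real_derivative (\<kappa>\<^sup>2 - q s) * u \<kappa> s) (at s)"
proof -
  have 1: "((\<lambda>s. m (exp (- c * s)) \<kappa>) has_real_derivative (- P (exp (- c * s)) \<kappa> / (c * exp (- c * s))) * (- c * exp (- c * s))) (at s)"
    by (rule DERIV_chain2[OF m_deriv[OF assms]]) (auto intro!: derivative_eq_intros)
  have 1: "((\<lambda>s. m (exp (- c * s)) \<kappa>) has_real_derivative P (exp (- c * s)) \<kappa>) (at s)"
    using c_pos 1 by simp
  let ?y = "exp (- c * s)"
  have 2: "((\<lambda>s. P (exp (- c * s)) \<kappa>) has_real_derivative (r ?y * m ?y \<kappa> - 2 * \<kappa> / (c * ?y) * P ?y \<kappa>) * (- c * ?y)) (at s)"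
    by (rule DERIV_chain2[OF P_deriv[OF assms]]) (auto intro!: derivative_eq_intros)
  have 2: "((\<lambda>s. P (exp (- c * s)) \<kappa>) has_real_derivative (2 * \<kappa> * P ?y \<kappa> - q s * m ?y \<kappa>)) (at s)"
    by (rule DERIV_cong[OF 2]) (use c_pos in \<open>simp add: q_def algebra_simps\<close>)
  show ?thesis unfolding v_def[abs_def] u_def
    by (rule derivative_eq_intros 1 2 refl)+ (simp add: algebra_simps power2_eq_square)
qed

lemma u_cont_\<kappa>: "continuous_on S (\<lambda>\<kappa>. u \<kappa> s)"
  unfolding u_def by (intro continuous_intros m_cont)

lemma v_cont_\<kappa>: "continuous_on {k..} (\<lambda>\<kappa>. v \<kappa> s)"
proof -
  have "continuous_on {k..} (\<lambda>\<kappa>. integral (cbox 0 1) (\<lambda>\<tau>. \<tau> powr (2 * \<kappa> / c) * r (exp (- c * s) * \<tau>) * m (exp (- c * s) * \<tau>) \<kappa>))"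
    by (rule integral_continuous_on_param, unfold case_prod_beta,
       intro continuous_intros m_cont continuous_on_r continuous_on_powr')
      (use k_pos c_pos in auto)
  hence "continuous_on {k..} (\<lambda>\<kappa>. P (exp (- c * s)) \<kappa>)"
    unfolding P_def by (intro continuous_intros) simp
  thus ?thesis unfolding v_def by (intro continuous_intros m_cont)
qed

lemma uv_bound:
  "\<exists>K. \<forall>\<kappa>\<ge>k. \<forall>s\<ge>s0. \<bar>u \<kappa> s\<bar> \<le> K * exp (- \<kappa> * s) \<and> \<bar>v \<kappa> s\<bar> \<le> (1 + \<kappa>) * K * exp (- \<kappa> * s)"
proof -
  define Y where "Y = exp (- c * s0)"
  define K where "K = 2 * exp (lam * Y) + 2 * C * Y * exp (lam * Y)"
  have "\<bar>u \<kappa> s\<bar> \<le> K * exp (- \<kappa> * s) \<and> \<bar>v \<kappa> s\<bar> \<le> (1 + \<kappa>) * K * exp (- \<kappa> * s)" if \<kappa>: "\<kappa> \<ge> k" and s: "s \<ge> s0" for \<kappa> s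
  proof -
    define y where "y = exp (- c * s)"
    have y: "0 \<le> y" "y \<le> Y" using s c_pos by (auto simp: y_def Y_def)
    have e: "exp (lam * y) \<le> exp (lam * Y)" using y lam_pos by simp
    have m: "\<bar>m y \<kappa>\<bar> \<le> K"
    proof -
      have "\<bar>m y \<kappa>\<bar> \<le> 2 * exp (lam * Y)" using m_bound[of y \<kappa>] e by linarith
      also have "\<dots> \<le> K" using C_pos by (simp add: K_def Y_def)
      finally show ?thesis .
    qed
    have P: "\<bar>P y \<kappa>\<bar> \<le> K"
    proof -
      have "\<bar>P y \<kappa>\<bar> \<le> 2 * C * y * exp (lam * y)" by (rule P_bound[OF \<kappa> y(1)])
      also have "\<dots> \<le> 2 * C * Y * exp (lam * Y)" using y e C_pos by (intro mult_mono) auto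
      also have "\<dots> \<le> K" by (simp add: K_def)
      finally show ?thesis .
    qed
    have "\<bar>P y \<kappa> - \<kappa> * m y \<kappa>\<bar> \<le> \<bar>P y \<kappa>\<bar> + \<kappa> * \<bar>m y \<kappa>\<bar>"
      using \<kappa> k_pos abs_triangle_ineq4[of "P y \<kappa>" "\<kappa> * m y \<kappa>"] by (simp add: abs_mult)
    also have "\<dots> \<le> K + \<kappa> * K" using P m \<kappa> k_pos by (intro add_mono mult_left_mono) auto
    finally have Pm: "\<bar>P y \<kappa> - \<kappa> * m y \<kappa>\<bar> \<le> (1 + \<kappa>) * K" by (simp add: algebra_simps)
    show ?thesis unfolding u_def v_def y_def[symmetric] abs_mult abs_exp_cancel
      using m Pm by (auto simp: mult.commute intro: mult_right_mono)
  qed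
  thus ?thesis by blast
qed

lemma u_pos_at_infinity:
  assumes "\<kappa> \<ge> k" shows "eventually (\<lambda>s. u \<kappa> s > 0) at_top"
proof -
  have "((\<lambda>s. C * exp (- c * s) * exp (lam * exp (- c * s)) / \<kappa>) \<longlongrightarrow> C * 0 * exp (lam * 0) / \<kappa>) at_top"
  proof -
    have "filterlim (\<lambda>s. - c * s) at_bot at_top"
      using c_pos filterlim_tendsto_neg_mult_at_bot[OF tendsto_const _ filterlim_ident, of "- c"] by simp
    hence e: "((\<lambda>s. exp (- c * s)) \<longlongrightarrow> 0) at_top"
      by (rule filterlim_compose[OF exp_at_bot])
    show ?thesis by (intro tendsto_intros e) (use assms k_pos in auto)
  qed
  hence "((\<lambda>s. C * exp (- c * s) * exp (lam * exp (- c * s)) / \<kappa>) \<longlongrightarrow> 0) at_top" by simp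
  hence "eventually (\<lambda>s. C * exp (- c * s) * exp (lam * exp (- c * s)) / \<kappa> < 1) at_top"
    by (rule order_tendstoD) simp
  thus ?thesis
  proof eventually_elim
    case (elim s)
    hence "m (exp (- c * s)) \<kappa> > 0" using m_minus_1_bound[OF assms, of "exp (- c * s)"] by simp
    thus ?case by (simp add: u_def)
  qed
qed

text \<open>
  As \<open>\<kappa>\<close> grows, the amplitude at a fixed point tends to \<open>1\<close> and its derivative stays bounded, so the
  boundary values eventually have the signs of those of \<open>exp (- \<kappa> * s)\<close>.
\<close>

lemma uv_large_\<kappa>:
  "\<exists>\<kappa>>k. u \<kappa> s > 0 \<and> v \<kappa> s + z * u \<kappa> s < 0"
proof -
  define y where "y = exp (- c * s)"
  define B where "B = C * y * exp (lam * y)"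
  have B: "B \<ge> 0" using C_pos by (simp add: B_def y_def)
  \<comment> \<open>Beyond \<open>2 * B\<close> the amplitude lies in \<open>[1/2, 3/2]\<close>; beyond \<open>4 * B + 3 * \<bar>z\<bar>\<close> the term \<open>\<kappa> * m\<close> outweighs the others.\<close>
  define \<kappa> where "\<kappa> = max k (max (2 * B) (4 * B + 3 * \<bar>z\<bar>)) + 1"
  have \<kappa>: "\<kappa> > k" "\<kappa> > 2 * B" "\<kappa> > 4 * B + 3 * \<bar>z\<bar>" by (auto simp: \<kappa>_def)
  have "\<bar>m y \<kappa> - 1\<bar> \<le> B / \<kappa>" unfolding B_def by (rule m_minus_1_bound) (use \<kappa> in \<open>auto simp: y_def\<close>)
  also have "\<dots> \<le> 1 / 2" using \<kappa> k_pos by (simp add: field_simps)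
  finally have m: "m y \<kappa> \<ge> 1 / 2" "m y \<kappa> \<le> 3 / 2" by linarith+
  have "\<bar>P y \<kappa>\<bar> \<le> 2 * B" using P_bound[of \<kappa> y] \<kappa> by (simp add: B_def y_def)
  moreover have "\<bar>z * m y \<kappa>\<bar> \<le> \<bar>z\<bar> * (3 / 2)"
    unfolding abs_mult using m by (intro mult_left_mono) auto
  moreover have "\<kappa> * m y \<kappa> \<ge> \<kappa> * (1 / 2)" using m \<kappa> k_pos by (intro mult_left_mono) auto
  ultimately have "P y \<kappa> - \<kappa> * m y \<kappa> + z * m y \<kappa> < 0" using \<kappa>(3) by linarith
  hence "exp (- \<kappa> * s) * (P y \<kappa> - \<kappa> * m y \<kappa> + z * m y \<kappa>) < 0" by (simp add: mult_less_0_iff)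
  hence "v \<kappa> s + z * u \<kappa> s < 0" unfolding u_def v_def y_def[symmetric] by (simp add: algebra_simps)
  moreover have "u \<kappa> s > 0" using m unfolding u_def y_def[symmetric] by simp
  ultimately show ?thesis using \<kappa> by blast
qed

end

section \<open>Sturm comparison and the boundary equations\<close>

text \<open>
  The energy \<open>f\<^sup>2 + g\<^sup>2\<close> grows at most exponentially in either direction, so zero initial data at any point
  force the zero solution.
\<close>

lemma linear_ode_growth:
  fixes f g Q :: "real \<Rightarrow> real"
  assumes f: "\<And>s. s \<in> {a..b} \<Longrightarrow> (f has_real_derivative g s) (at s)"
    and g: "\<And>s. s \<in> {a..b} \<Longrightarrow> (g has_real_derivative Q s * f s) (at s)"
    and Q: "continuous_on {a..b} Q"
    and x0: "x0 \<in> {a..b}" "f x0 = 0" "g x0 = 0" and x: "x \<in> {a..b}"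
  shows "f x = 0 \<and> g x = 0"
proof -
  have "bounded (Q ` {a..b})" by (intro compact_imp_bounded compact_continuous_image Q compact_Icc)
  then obtain M where M: "\<And>s. s \<in> {a..b} \<Longrightarrow> \<bar>Q s\<bar> \<le> M"
    unfolding bounded_iff by (metis imageI real_norm_def)
  define E where "E s = (f s)\<^sup>2 + (g s)\<^sup>2" for s
  have E: "(E has_real_derivative 2 * (1 + Q s) * (f s * g s)) (at s)" if "s \<in> {a..b}" for s
    unfolding E_def[abs_def]
    by (rule derivative_eq_intros f g that refl)+ (simp add: algebra_simps)
  have Eb: "\<bar>2 * (1 + Q s) * (f s * g s)\<bar> \<le> (1 + M) * E s" if s: "s \<in> {a..b}" for s
  proof -
    have "\<bar>1 + Q s\<bar> \<le> 1 + M" using M[OF s] by linarith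
    moreover have "2 * \<bar>f s * g s\<bar> \<le> E s"
      using sum_squares_bound[of "\<bar>f s\<bar>" "\<bar>g s\<bar>"] by (simp add: E_def abs_mult)
    ultimately have "\<bar>1 + Q s\<bar> * (2 * \<bar>f s * g s\<bar>) \<le> (1 + M) * E s"
      by (intro mult_mono) auto
    moreover have "\<bar>2 * (1 + Q s) * (f s * g s)\<bar> = \<bar>1 + Q s\<bar> * (2 * \<bar>f s * g s\<bar>)"
      by (simp only: abs_mult abs_numeral mult_ac)
    ultimately show ?thesis by simp
  qed
  have E0: "E s \<ge> 0" for s by (simp add: E_def)
  have "E x = 0"
  proof (cases "x0 \<le> x")
    case True
    have "exp (- (1 + M) * x) * E x \<le> exp (- (1 + M) * x0) * E x0"
    proof (rule DERIV_nonpos_imp_nonincreasing[OF True, where f="\<lambda>s. exp (- (1 + M) * s) * E s"])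
      fix s assume s: "x0 \<le> s" "s \<le> x"
      hence sab: "s \<in> {a..b}" using x0 x by auto
      have "((\<lambda>s. exp (- (1 + M) * s) * E s) has_real_derivative
         exp (- (1 + M) * s) * (2 * (1 + Q s) * (f s * g s) - (1 + M) * E s)) (at s)"
        by (rule derivative_eq_intros E sab refl)+ (simp add: algebra_simps)
      moreover have "exp (- (1 + M) * s) * (2 * (1 + Q s) * (f s * g s) - (1 + M) * E s) \<le> 0"
        using Eb[OF sab] by (intro mult_nonneg_nonpos) auto
      ultimately show "\<exists>y. ((\<lambda>s. exp (- (1 + M) * s) * E s) has_real_derivative y) (at s) \<and> y \<le> 0"
        by blast
    qed
    hence "exp (- (1 + M) * x) * E x \<le> 0" using x0 by (simp add: E_def)
    thus ?thesis using E0[of x] by (simp add: mult_le_0_iff not_le)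
  next
    case False
    have "exp ((1 + M) * x) * E x \<le> exp ((1 + M) * x0) * E x0"
    proof (rule DERIV_nonneg_imp_nondecreasing[where f="\<lambda>s. exp ((1 + M) * s) * E s"])
      show "x \<le> x0" using False by simp
      fix s assume s: "x \<le> s" "s \<le> x0"
      hence sab: "s \<in> {a..b}" using x0 x by auto
      have "((\<lambda>s. exp ((1 + M) * s) * E s) has_real_derivative
         exp ((1 + M) * s) * (2 * (1 + Q s) * (f s * g s) + (1 + M) * E s)) (at s)"
        by (rule derivative_eq_intros E sab refl)+ (simp add: algebra_simps)
      moreover have "exp ((1 + M) * s) * (2 * (1 + Q s) * (f s * g s) + (1 + M) * E s) \<ge> 0"
        using Eb[OF sab] by (intro mult_nonneg_nonneg) auto
      ultimately show "\<exists>y. ((\<lambda>s. exp ((1 + M) * s) * E s) has_real_derivative y) (at s) \<and> 0 \<le> y"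
        by blast
    qed
    hence "exp ((1 + M) * x) * E x \<le> 0" using x0 by (simp add: E_def)
    thus ?thesis using E0[of x] by (simp add: mult_le_0_iff not_le)
  qed
  thus ?thesis by (simp add: E_def sum_power2_eq_zero_iff)
qed

lemma increasing_limit_zero_imp_neg:
  fixes W :: "real \<Rightarrow> real"
  assumes d: "\<And>s. s \<ge> t \<Longrightarrow> (W has_real_derivative w s) (at s)" and w: "\<And>s. s > t \<Longrightarrow> w s > 0"
    and lim: "(W \<longlongrightarrow> 0) at_top"
  shows "W t < 0"
proof -
  have inc: "W a < W b" if "t \<le> a" "a < b" for a b
  proof (rule DERIV_pos_imp_increasing_open[OF that(2)])
    show "\<exists>y. (W has_real_derivative y) (at x) \<and> 0 < y" if "a < x" "x < b" for x
      using d[of x] w[of x] that \<open>t \<le> a\<close> by (intro exI[of _ "w x"]) auto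
    show "continuous_on {a..b} W"
      by (rule DERIV_continuous_on[of _ _ w]) (use d that in \<open>auto intro: has_field_derivative_at_within\<close>)
  qed
  have "eventually (\<lambda>s. W (t + 1) \<le> W s) at_top"
    using eventually_gt_at_top[of "t + 1"] by eventually_elim (use inc in \<open>auto intro: less_imp_le\<close>)
  hence "W (t + 1) \<le> 0" by (rule tendsto_lowerbound[OF lim]) simp
  thus ?thesis using inc[of t "t + 1"] by simp
qed

context jost
begin

lemma q_cont: "continuous_on S q"
  unfolding q_def by (intro continuous_intros continuous_on_r) auto

lemma u_cont: "\<kappa> \<ge> k \<Longrightarrow> continuous_on S (u \<kappa>)"
  by (rule DERIV_continuous_on[of _ _ "v \<kappa>"]) (auto intro: has_field_derivative_at_within u_deriv)

lemma u_nontrivial: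
  assumes "\<kappa> \<ge> k" shows "\<not> (u \<kappa> s = 0 \<and> v \<kappa> s = 0)"
proof
  assume z: "u \<kappa> s = 0 \<and> v \<kappa> s = 0"
  have "eventually (\<lambda>x. u \<kappa> x > 0 \<and> x \<ge> s) at_top"
    using u_pos_at_infinity[OF assms] eventually_ge_at_top[of s] by (rule eventually_conj)
  then obtain x where x: "u \<kappa> x > 0" "x \<ge> s" using eventually_happens by fastforce
  have "u \<kappa> x = 0 \<and> v \<kappa> x = 0"
    by (rule linear_ode_growth[OF u_deriv[OF assms] v_deriv[OF assms], of s x s x])
      (use x z in \<open>auto intro!: continuous_intros q_cont\<close>)
  thus False using x by simp
qed

lemma uv_tendsto_0:
  assumes "\<kappa> \<ge> k" shows "(u \<kappa> \<longlongrightarrow> 0) at_top" "(v \<kappa> \<longlongrightarrow> 0) at_top"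
proof -
  obtain K where K: "\<And>s. s \<ge> 0 \<Longrightarrow> \<bar>u \<kappa> s\<bar> \<le> K * exp (- \<kappa> * s)" "\<And>s. s \<ge> 0 \<Longrightarrow> \<bar>v \<kappa> s\<bar> \<le> (1 + \<kappa>) * K * exp (- \<kappa> * s)"
    using uv_bound[of 0] assms by blast
  have "filterlim (\<lambda>s. - \<kappa> * s) at_bot at_top"
    using assms k_pos filterlim_tendsto_neg_mult_at_bot[OF tendsto_const _ filterlim_ident, of "- \<kappa>"] by simp
  hence e: "((\<lambda>s. exp (- \<kappa> * s)) \<longlongrightarrow> 0) at_top"
    by (rule filterlim_compose[OF exp_at_bot])
  show "(u \<kappa> \<longlongrightarrow> 0) at_top"
  proof (rule Lim_null_comparison)
    show "eventually (\<lambda>s. norm (u \<kappa> s) \<le> K * exp (- \<kappa> * s)) at_top"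
      using eventually_ge_at_top[of 0] by eventually_elim (use K in auto)
    show "((\<lambda>s. K * exp (- \<kappa> * s)) \<longlongrightarrow> 0) at_top" using tendsto_mult_right_zero[OF e] .
  qed
  show "(v \<kappa> \<longlongrightarrow> 0) at_top"
  proof (rule Lim_null_comparison)
    show "eventually (\<lambda>s. norm (v \<kappa> s) \<le> (1 + \<kappa>) * K * exp (- \<kappa> * s)) at_top"
      using eventually_ge_at_top[of 0] by eventually_elim (use K in auto)
    show "((\<lambda>s. (1 + \<kappa>) * K * exp (- \<kappa> * s)) \<longlongrightarrow> 0) at_top" using tendsto_mult_right_zero[OF e] .
  qed
qed

lemma wronskian_deriv:
  assumes "(f has_real_derivative g s) (at s)" "(g has_real_derivative (\<kappa>1\<^sup>2 - q s) * f s) (at s)" "\<kappa>2 \<ge> k"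
  shows "((\<lambda>s. f s * v \<kappa>2 s - g s * u \<kappa>2 s) has_real_derivative (\<kappa>2\<^sup>2 - \<kappa>1\<^sup>2) * (f s * u \<kappa>2 s)) (at s)"
  by (rule derivative_eq_intros assms(1,2) u_deriv v_deriv assms(3) refl)+ (simp add: algebra_simps)

lemma wronskian_tendsto_0:
  assumes b: "\<And>s. s \<ge> t \<Longrightarrow> \<bar>f s\<bar> \<le> B \<and> \<bar>g s\<bar> \<le> B" and "\<kappa> \<ge> k"
  shows "((\<lambda>s. f s * v \<kappa> s - g s * u \<kappa> s) \<longlongrightarrow> 0) at_top"
proof (rule Lim_null_comparison)
  show "eventually (\<lambda>s. norm (f s * v \<kappa> s - g s * u \<kappa> s) \<le> B * \<bar>v \<kappa> s\<bar> + B * \<bar>u \<kappa> s\<bar>) at_top"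
    using eventually_ge_at_top[of t]
  proof eventually_elim
    case (elim s)
    have "\<bar>f s * v \<kappa> s - g s * u \<kappa> s\<bar> \<le> \<bar>f s\<bar> * \<bar>v \<kappa> s\<bar> + \<bar>g s\<bar> * \<bar>u \<kappa> s\<bar>"
      using abs_triangle_ineq4[of "f s * v \<kappa> s" "g s * u \<kappa> s"] by (simp add: abs_mult)
    also have "\<dots> \<le> B * \<bar>v \<kappa> s\<bar> + B * \<bar>u \<kappa> s\<bar>"
      using b[OF elim] by (intro add_mono mult_right_mono) auto
    finally show ?case by simp
  qed
  have "((\<lambda>s. B * \<bar>v \<kappa> s\<bar> + B * \<bar>u \<kappa> s\<bar>) \<longlongrightarrow> B * \<bar>0\<bar> + B * \<bar>0\<bar>) at_top"
    by (intro tendsto_intros uv_tendsto_0 assms)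
  thus "((\<lambda>s. B * \<bar>v \<kappa> s\<bar> + B * \<bar>u \<kappa> s\<bar>) \<longlongrightarrow> 0) at_top" by simp
qed

lemma uv_bounded:
  assumes "\<kappa> \<ge> k" shows "\<exists>B. \<forall>s\<ge>t. \<bar>u \<kappa> s\<bar> \<le> B \<and> \<bar>v \<kappa> s\<bar> \<le> B"
proof -
  obtain K where K: "\<And>s. s \<ge> t \<Longrightarrow> \<bar>u \<kappa> s\<bar> \<le> K * exp (- \<kappa> * s)" "\<And>s. s \<ge> t \<Longrightarrow> \<bar>v \<kappa> s\<bar> \<le> (1 + \<kappa>) * K * exp (- \<kappa> * s)"
    using uv_bound[of t] assms by blast
  have "0 \<le> K * exp (- \<kappa> * t)" using K(1)[of t] by linarith
  hence K0: "K \<ge> 0" by (simp add: zero_le_mult_iff)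
  have e: "exp (- \<kappa> * s) \<le> exp (- \<kappa> * t)" if "s \<ge> t" for s using that assms k_pos by simp
  have 1: "\<bar>u \<kappa> s\<bar> \<le> (1 + \<kappa>) * K * exp (- \<kappa> * t)" if "s \<ge> t" for s
  proof -
    have "\<bar>u \<kappa> s\<bar> \<le> 1 * K * exp (- \<kappa> * s)" using K(1)[OF that] by simp
    also have "\<dots> \<le> (1 + \<kappa>) * K * exp (- \<kappa> * t)"
      by (intro mult_mono e[OF that]) (use assms k_pos K0 in auto)
    finally show ?thesis .
  qed
  have 2: "\<bar>v \<kappa> s\<bar> \<le> (1 + \<kappa>) * K * exp (- \<kappa> * t)" if "s \<ge> t" for s
    by (rule order_trans[OF K(2)[OF that] mult_left_mono[OF e[OF that]]]) (use K0 assms k_pos in auto)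
  show ?thesis using 1 2 by blast
qed

lemma last_zero:
  assumes "\<kappa> \<ge> k" "u \<kappa> a \<le> 0"
  obtains t where "t \<ge> a" "u \<kappa> t = 0" "v \<kappa> t \<ge> 0" "\<And>s. s > t \<Longrightarrow> u \<kappa> s > 0"
proof -
  obtain S where S: "\<And>s. s \<ge> S \<Longrightarrow> u \<kappa> s > 0"
    using u_pos_at_infinity[OF assms(1)] unfolding eventually_at_top_linorder by blast
  have aS: "a < S" using S[of a] assms(2) by linarith
  define A where "A = {a..S} \<inter> {x. u \<kappa> x = 0}"
  have "closed {x. u \<kappa> x = 0}"
    by (rule closed_Collect_eq[OF u_cont[OF assms(1)] continuous_on_const])
  hence "compact A" unfolding A_def by (intro compact_Int_closed compact_Icc)
  moreover have "A \<noteq> {}"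
  proof -
    have "\<exists>x\<ge>a. x \<le> S \<and> u \<kappa> x = 0"
      using IVT'[of "u \<kappa>" a 0 S] assms(2) aS S[of S] u_cont[OF assms(1)] by simp
    thus ?thesis unfolding A_def by auto
  qed
  ultimately have "\<exists>t\<in>A. \<forall>x\<in>A. x \<le> t" by (rule compact_attains_sup)
  then obtain t where t: "t \<in> A" "\<And>x. x \<in> A \<Longrightarrow> x \<le> t" by blast
  have pos: "u \<kappa> s > 0" if "s > t" for s
  proof (rule ccontr)
    assume n: "\<not> u \<kappa> s > 0"
    hence "s < S" using S[of s] by linarith
    then have "\<exists>x\<ge>s. x \<le> S \<and> u \<kappa> x = 0"
      using IVT'[of "u \<kappa>" s 0 S] n S[of S] u_cont[OF assms(1)] by simp
    then obtain x where "x \<ge> s" "x \<le> S" "u \<kappa> x = 0" by blast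
    hence "x \<in> A" using t(1) that by (auto simp: A_def)
    from t(2)[OF this] show False using \<open>x \<ge> s\<close> that by linarith
  qed
  have "v \<kappa> t \<ge> 0"
  proof (rule ccontr)
    assume "\<not> v \<kappa> t \<ge> 0"
    hence "v \<kappa> t < 0" by simp
    from DERIV_neg_dec_right[OF u_deriv[OF assms(1)] this]
    obtain d where d: "d > 0" "\<And>h. 0 < h \<Longrightarrow> h < d \<Longrightarrow> u \<kappa> (t + h) < u \<kappa> t" by blast
    have "u \<kappa> (t + d / 2) < u \<kappa> t" using d(2)[of "d / 2"] d(1) by simp
    thus False using pos[of "t + d / 2"] d(1) t(1) by (simp add: A_def)
  qed
  moreover have "a \<le> t" "u \<kappa> t = 0" using t(1) by (simp_all add: A_def)
  ultimately show ?thesis using that pos by blast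
qed

text \<open>
  Raising \<open>\<kappa>\<close> removes zeros. At the last zero \<open>t\<close> of \<open>u \<kappa>2\<close> the Wronskian with \<open>f\<close> equals
  \<open>f t * v \<kappa>2 t \<ge> 0\<close>; but to the right of \<open>t\<close> it increases strictly, and it tends to \<open>0\<close> at infinity.
\<close>

lemma sturm_comparison_at_infinity:
  assumes f: "\<And>s. (f has_real_derivative g s) (at s)" and g: "\<And>s. (g has_real_derivative (\<kappa>1\<^sup>2 - q s) * f s) (at s)"
    and b: "\<And>s. s \<ge> a \<Longrightarrow> \<bar>f s\<bar> \<le> B \<and> \<bar>g s\<bar> \<le> B"
    and \<kappa>: "k \<le> \<kappa>1" "\<kappa>1 < \<kappa>2" and pos: "\<And>s. s > a \<Longrightarrow> f s > 0"
  shows "s \<ge> a \<Longrightarrow> u \<kappa>2 s > 0"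
proof (rule ccontr)
  assume "s \<ge> a" "\<not> u \<kappa>2 s > 0"
  hence le: "u \<kappa>2 s \<le> 0" by simp
  have k2: "\<kappa>2 \<ge> k" using \<kappa> by simp
  obtain t where t: "t \<ge> s" "u \<kappa>2 t = 0" "v \<kappa>2 t \<ge> 0" "\<And>x. x > t \<Longrightarrow> u \<kappa>2 x > 0"
    using last_zero[OF k2 le] by blast
  have "f t * v \<kappa>2 t - g t * u \<kappa>2 t < 0"
  proof (rule increasing_limit_zero_imp_neg[where W = "\<lambda>s. f s * v \<kappa>2 s - g s * u \<kappa>2 s"])
    show "((\<lambda>s. f s * v \<kappa>2 s - g s * u \<kappa>2 s) has_real_derivative (\<kappa>2\<^sup>2 - \<kappa>1\<^sup>2) * (f s * u \<kappa>2 s)) (at s)" for s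
      by (rule wronskian_deriv[OF f g k2])
    have "\<kappa>1\<^sup>2 < \<kappa>2\<^sup>2" using \<kappa> k_pos by (intro power_strict_mono) auto
    moreover have "f x > 0" if "x > t" for x using that t(1) \<open>s \<ge> a\<close> by (intro pos) linarith
    ultimately show "(\<kappa>2\<^sup>2 - \<kappa>1\<^sup>2) * (f x * u \<kappa>2 x) > 0" if "x > t" for x
      using t(4)[OF that] that by simp
    show "((\<lambda>s. f s * v \<kappa>2 s - g s * u \<kappa>2 s) \<longlongrightarrow> 0) at_top"
      by (rule wronskian_tendsto_0[OF b k2])
  qed
  hence "f t * v \<kappa>2 t < 0" using t by simp
  moreover have "f t \<ge> 0"
  proof -
    have "isCont f t" using f by (rule DERIV_isCont)
    hence "(f \<longlongrightarrow> f t) (at_right t)" unfolding isCont_def by (rule tendsto_within_subset) auto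
    moreover have "eventually (\<lambda>s. f s \<ge> 0) (at_right t)"
      unfolding eventually_at_right_field
    proof (intro exI[of _ "t + 1"] conjI allI impI)
      fix x assume "t < x"
      hence "x > a" using t(1) \<open>s \<ge> a\<close> by linarith
      thus "f x \<ge> 0" using pos[of x] by simp
    qed simp
    ultimately show ?thesis by (intro tendsto_lowerbound[of f "f t"]) auto
  qed
  ultimately show False using t(3) by (simp add: mult_less_0_iff)
qed

end

text \<open>
  A solution at the threshold \<open>\<kappa> = k\<close> with a single zero, at \<open>0\<close>, that stays bounded at infinity, and
  a boundary condition at \<open>s0\<close> whose value on this solution is positive. For the standing wave, \<open>u0\<close> is
  the derivative of the profile with its sign changed, up to a positive factor.
\<close>

locale jost_zero_mode = jost +
  fixes s0 z :: real and u0 v0 :: "real \<Rightarrow> real"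
  assumes u0_deriv: "\<And>s. (u0 has_real_derivative v0 s) (at s)"
    and v0_deriv: "\<And>s. (v0 has_real_derivative (k\<^sup>2 - q s) * u0 s) (at s)"
    and uv0_bounded: "\<exists>B. \<forall>s\<ge>0. \<bar>u0 s\<bar> \<le> B \<and> \<bar>v0 s\<bar> \<le> B"
    and u0_pos: "\<And>s. s > 0 \<Longrightarrow> u0 s > 0" and u0_neg: "\<And>s. s < 0 \<Longrightarrow> u0 s < 0"
    and robin_pos: "v0 s0 + z * u0 s0 > 0"
begin

text \<open>
  Boundedness makes the Wronskian with \<open>u k\<close>, a constant, tend to \<open>0\<close>. The positive factor transfers the
  signs of \<open>u0\<close> to the boundary values at \<open>\<kappa> = k\<close>, the starting point of the intermediate value
  arguments.
\<close>

lemma zero_mode_is_jost: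
  obtains A where "A > 0" "\<And>s. u0 s = A * u k s" "\<And>s. v0 s = A * v k s"
proof -
  obtain B where B: "\<And>s. s \<ge> 0 \<Longrightarrow> \<bar>u0 s\<bar> \<le> B \<and> \<bar>v0 s\<bar> \<le> B" using uv0_bounded by blast
  define W where "W s = u0 s * v k s - v0 s * u k s" for s
  have dW: "(W has_real_derivative 0) (at s)" for s
    using wronskian_deriv[OF u0_deriv v0_deriv order_refl] unfolding W_def[abs_def] by simp
  have "W s = W 0" for s using DERIV_isconst_all[of W] dW by blast
  moreover have "(W \<longlongrightarrow> 0) at_top" unfolding W_def[abs_def] by (rule wronskian_tendsto_0[OF B order_refl])
  ultimately have W0: "W s = 0" for s
    by (metis (no_types, lifting) ext tendsto_const_iff trivial_limit_at_top_linorder)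
  have "eventually (\<lambda>s. u k s > 0 \<and> s > 0) at_top"
    using u_pos_at_infinity[OF order_refl] eventually_gt_at_top[of 0] by (rule eventually_conj)
  then obtain S where S: "u k S > 0" "S > 0" using eventually_happens by fastforce
  define A where "A = u0 S / u k S"
  have A: "A > 0" using S u0_pos by (simp add: A_def)
  have uS: "u0 S - A * u k S = 0" using S by (simp add: A_def)
  have vS: "v0 S - A * v k S = 0" using S W0[of S] by (simp add: A_def W_def field_simps)
  define f where "f s = u0 s - A * u k s" for s
  define g where "g s = v0 s - A * v k s" for s
  have fd: "(f has_real_derivative g s) (at s)" for s
    unfolding f_def[abs_def] g_def by (rule derivative_eq_intros u0_deriv u_deriv order_refl refl)+ simp
  have gd: "(g has_real_derivative (k\<^sup>2 - q s) * f s) (at s)" for s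
    unfolding g_def[abs_def] f_def
    by (rule derivative_eq_intros v0_deriv v_deriv order_refl refl)+ (simp add: algebra_simps)
  have "f s = 0 \<and> g s = 0" for s
    by (rule linear_ode_growth[OF fd gd, of "min s S" "max s S" S s])
      (use uS vS in \<open>auto simp: f_def g_def intro!: continuous_intros q_cont\<close>)
  hence "u0 s = A * u k s" "v0 s = A * v k s" for s by (simp_all add: f_def g_def)
  thus ?thesis using that A by auto
qed

lemma u_pos_right:
  assumes "\<kappa> > k" "s \<ge> 0" shows "u \<kappa> s > 0"
proof -
  obtain B where B: "\<And>s. s \<ge> 0 \<Longrightarrow> \<bar>u0 s\<bar> \<le> B \<and> \<bar>v0 s\<bar> \<le> B" using uv0_bounded by blast
  show ?thesis
    by (rule sturm_comparison_at_infinity[OF u0_deriv v0_deriv B order_refl assms(1) u0_pos assms(2)])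
qed

text \<open>
  This is \<open>u0\<^sup>2 * y * y'\<close> for the quotient \<open>y = u \<kappa> / u0\<close>. Where \<open>u0 \<noteq> 0\<close> its derivative is
  \<open>(v \<kappa> - u \<kappa> * v0 / u0)\<^sup>2 + (\<kappa>\<^sup>2 - k\<^sup>2) * (u \<kappa>)\<^sup>2\<close>, Picone's identity.
\<close>

definition picone :: "real \<Rightarrow> real \<Rightarrow> real" where
  "picone \<kappa> s = u \<kappa> s * v \<kappa> s - (u \<kappa> s)\<^sup>2 * v0 s / u0 s"

lemma picone_increasing:
  assumes \<kappa>: "\<kappa> > k" and ab: "a < b" "b < 0"
  shows "picone \<kappa> a < picone \<kappa> b"
proof (rule DERIV_pos_imp_increasing[OF ab(1)])
  fix s assume s: "a \<le> s" "s \<le> b"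
  have u0: "u0 s \<noteq> 0" using u0_neg[of s] s ab by simp
  have k\<kappa>: "k \<le> \<kappa>" using \<kappa> by simp
  have "(picone \<kappa> has_real_derivative (v \<kappa> s - u \<kappa> s * v0 s / u0 s)\<^sup>2 + (\<kappa>\<^sup>2 - k\<^sup>2) * (u \<kappa> s)\<^sup>2) (at s)"
    unfolding picone_def[abs_def]
    by (rule derivative_eq_intros u_deriv[OF k\<kappa>] v_deriv[OF k\<kappa>] u0_deriv v0_deriv u0 refl)+
      (use u0 in \<open>simp add: field_simps power2_eq_square\<close>)
  moreover have "(v \<kappa> s - u \<kappa> s * v0 s / u0 s)\<^sup>2 + (\<kappa>\<^sup>2 - k\<^sup>2) * (u \<kappa> s)\<^sup>2 > 0"
  proof -
    have d: "\<kappa>\<^sup>2 - k\<^sup>2 > 0" using \<kappa> k_pos by (simp add: power_strict_mono)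
    show ?thesis
    proof (cases "u \<kappa> s = 0")
      case True
      hence "v \<kappa> s \<noteq> 0" using u_nontrivial[OF k\<kappa>] by blast
      thus ?thesis using True by simp
    next
      case False
      thus ?thesis using d by (simp add: add_nonneg_pos)
    qed
  qed
  ultimately show "\<exists>y. (picone \<kappa> has_real_derivative y) (at s) \<and> 0 < y" by blast
qed

text \<open>
  All zeros lie where \<open>u0 < 0\<close>, and there the strictly increasing Picone quantity vanishes at each of
  them.
\<close>

lemma u_unique_zero:
  assumes "\<kappa> > k" "u \<kappa> a = 0" "u \<kappa> b = 0"
  shows "a = b"
proof -
  have neg: "a < 0" "b < 0" using u_pos_right[OF assms(1)] assms by (metis less_irrefl not_le)+
  show ?thesis
    using picone_increasing[OF assms(1), of a b] picone_increasing[OF assms(1), of b a] assms neg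
    by (cases a b rule: linorder_cases) (auto simp: picone_def)
qed

lemma dirichlet_none:
  assumes "s0 \<ge> 0" "\<kappa> > k" shows "u \<kappa> s0 \<noteq> 0"
  using u_pos_right[OF assms(2,1)] by simp

text \<open>
  If \<open>s0\<close> is the zero of \<open>u \<kappa>1\<close>, then \<open>u \<kappa>1\<close> is positive to the right of it, and comparison leaves no
  zero at \<open>s0\<close> for larger \<open>\<kappa>\<close>.
\<close>

lemma dirichlet_unique:
  assumes "k < \<kappa>1" "u \<kappa>1 s0 = 0" "\<kappa>1 < \<kappa>2" shows "u \<kappa>2 s0 \<noteq> 0"
proof -
  have k1: "\<kappa>1 \<ge> k" using assms by simp
  obtain B where B: "\<And>s. s \<ge> s0 \<Longrightarrow> \<bar>u \<kappa>1 s\<bar> \<le> B \<and> \<bar>v \<kappa>1 s\<bar> \<le> B" using uv_bounded[OF k1] by blast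
  have "u \<kappa>1 s > 0" if "s > s0" for s
  proof -
    obtain t where "t \<ge> s0" "u \<kappa>1 t = 0" "\<And>s. s > t \<Longrightarrow> u \<kappa>1 s > 0"
      using last_zero[OF k1, of s0] assms by auto
    thus ?thesis using u_unique_zero[OF assms(1), of t s0] assms that by blast
  qed
  from sturm_comparison_at_infinity[OF u_deriv[OF k1] v_deriv[OF k1] B k1 assms(3) this]
  show ?thesis by (metis less_irrefl order_refl)
qed

lemma dirichlet_exists:
  assumes "s0 < 0" shows "\<exists>\<kappa>>k. u \<kappa> s0 = 0"
proof -
  obtain A where A: "A > 0" "\<And>s. u0 s = A * u k s" using zero_mode_is_jost by metis
  have neg: "u k s0 < 0" using u0_neg[OF assms] A by (simp add: mult_less_0_iff)
  obtain \<kappa> where \<kappa>: "\<kappa> > k" "u \<kappa> s0 > 0" using uv_large_\<kappa> by blast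
  have "\<exists>x\<ge>k. x \<le> \<kappa> \<and> u x s0 = 0"
    by (rule IVT'[where f="\<lambda>\<kappa>. u \<kappa> s0"]) (use neg \<kappa> u_cont_\<kappa> in auto)
  thus ?thesis using neg by (metis less_irrefl order_le_less)
qed

definition robin :: "real \<Rightarrow> real" where "robin \<kappa> = v \<kappa> s0 + z * u \<kappa> s0"

lemma robin_exists: "\<exists>\<kappa>>k. robin \<kappa> = 0"
proof -
  obtain A where A: "A > 0" "\<And>s. u0 s = A * u k s" "\<And>s. v0 s = A * v k s" using zero_mode_is_jost by metis
  have "A * robin k > 0" using robin_pos A by (simp add: robin_def algebra_simps)
  hence pos: "robin k > 0" using A(1) by (simp add: zero_less_mult_iff)
  obtain \<kappa> where \<kappa>: "\<kappa> > k" "robin \<kappa> < 0" using uv_large_\<kappa> unfolding robin_def by blast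
  have "continuous_on {k..\<kappa>} robin"
    unfolding robin_def
    by (intro continuous_intros continuous_on_subset[OF v_cont_\<kappa>] u_cont_\<kappa>) auto
  hence "\<exists>x\<ge>k. x \<le> \<kappa> \<and> robin x = 0"
    using IVT2'[of robin \<kappa> 0 k] pos \<kappa> by auto
  thus ?thesis using pos by (metis less_irrefl order_le_less)
qed

text \<open>
  A zero beyond \<open>s0\<close> would be negative, and the Picone quantity would vanish there. But the boundary
  equation makes it equal to \<open>- (u \<kappa> s0)\<^sup>2 * (v0 s0 + z * u0 s0) / u0 s0 \<ge> 0\<close> at \<open>s0\<close>, although it is
  strictly increasing.
\<close>

lemma robin_imp_pos:
  assumes \<kappa>: "\<kappa> > k" and N: "robin \<kappa> = 0" and s: "s \<ge> s0" shows "u \<kappa> s > 0"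
proof (rule ccontr)
  have k\<kappa>: "k \<le> \<kappa>" using \<kappa> by simp
  assume "\<not> u \<kappa> s > 0"
  then obtain t where t: "t \<ge> s" "u \<kappa> t = 0" using last_zero[OF k\<kappa>, of s] by (metis not_le)
  have t0: "t < 0" using u_pos_right[OF \<kappa>, of t] t by (metis less_irrefl not_le)
  have s0t: "s0 < t"
  proof (rule ccontr)
    assume "\<not> s0 < t"
    hence "t = s0" using t s by simp
    hence "u \<kappa> s0 = 0" "v \<kappa> s0 = 0" using t N by (auto simp: robin_def)
    thus False using u_nontrivial[OF k\<kappa>] by blast
  qed
  have u0: "u0 s0 < 0" using u0_neg s0t t0 by simp
  have v: "v \<kappa> s0 = - z * u \<kappa> s0" using N by (simp add: robin_def)
  have p: "picone \<kappa> s0 = - (u \<kappa> s0)\<^sup>2 * (v0 s0 + z * u0 s0) / u0 s0"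
    using u0 unfolding picone_def v by (simp add: field_simps power2_eq_square)
  have "- (u \<kappa> s0)\<^sup>2 * (v0 s0 + z * u0 s0) \<le> 0"
    by (intro mult_nonpos_nonneg) (use robin_pos in auto)
  hence "picone \<kappa> s0 \<ge> 0" unfolding p using u0 by (rule divide_nonpos_neg)
  moreover have "picone \<kappa> t = 0" using t by (simp add: picone_def)
  ultimately show False using picone_increasing[OF \<kappa> s0t t0] by simp
qed

text \<open>
  Two solutions of the same boundary equation have Wronskian \<open>0\<close> at \<open>s0\<close>, whereas positivity of both
  makes it increase strictly towards its limit \<open>0\<close>.
\<close>

lemma robin_unique:
  assumes "k < \<kappa>1" "robin \<kappa>1 = 0" "\<kappa>1 < \<kappa>2" shows "robin \<kappa>2 \<noteq> 0"
proof
  assume N2: "robin \<kappa>2 = 0"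
  have k1: "\<kappa>1 \<ge> k" and k2: "\<kappa>2 \<ge> k" and k2': "\<kappa>2 > k" using assms by auto
  obtain B where B: "\<And>s. s \<ge> s0 \<Longrightarrow> \<bar>u \<kappa>1 s\<bar> \<le> B \<and> \<bar>v \<kappa>1 s\<bar> \<le> B" using uv_bounded[OF k1] by blast
  have "u \<kappa>1 s0 * v \<kappa>2 s0 - v \<kappa>1 s0 * u \<kappa>2 s0 < 0"
  proof (rule increasing_limit_zero_imp_neg[where W = "\<lambda>s. u \<kappa>1 s * v \<kappa>2 s - v \<kappa>1 s * u \<kappa>2 s"])
    show "((\<lambda>s. u \<kappa>1 s * v \<kappa>2 s - v \<kappa>1 s * u \<kappa>2 s) has_real_derivative (\<kappa>2\<^sup>2 - \<kappa>1\<^sup>2) * (u \<kappa>1 s * u \<kappa>2 s)) (at s)" for s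
      by (rule wronskian_deriv[OF u_deriv[OF k1] v_deriv[OF k1] k2])
    have "\<kappa>1\<^sup>2 < \<kappa>2\<^sup>2" using assms k_pos by (intro power_strict_mono) auto
    thus "(\<kappa>2\<^sup>2 - \<kappa>1\<^sup>2) * (u \<kappa>1 s * u \<kappa>2 s) > 0" if "s > s0" for s
      using robin_imp_pos[OF assms(1,2), of s] robin_imp_pos[OF k2' N2, of s] that by simp
    show "((\<lambda>s. u \<kappa>1 s * v \<kappa>2 s - v \<kappa>1 s * u \<kappa>2 s) \<longlongrightarrow> 0) at_top"
      by (rule wronskian_tendsto_0[OF B k2])
  qed
  moreover have "v \<kappa>1 s0 = - z * u \<kappa>1 s0" "v \<kappa>2 s0 = - z * u \<kappa>2 s0"
    using assms(2) N2 by (simp_all add: robin_def)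
  ultimately show False by simp
qed

end

section \<open>Eigenfunctions of the point interaction\<close>

abbreviation punctured :: "real set" ("\<Omega>\<^sub>0") where "\<Omega>\<^sub>0 \<equiv> - {0}"

definition two_sided :: "(real \<Rightarrow> real) \<Rightarrow> (real \<Rightarrow> real) \<Rightarrow> real \<Rightarrow> complex" where
  "two_sided F G x = of_real (if x \<ge> 0 then F x else G x)"

lemma two_sided_measurable:
  assumes "continuous_on UNIV F" "continuous_on UNIV G"
  shows "two_sided F G \<in> borel_measurable borel"
proof -
  have [measurable]: "F \<in> borel_measurable borel" "G \<in> borel_measurable borel"
    using assms borel_measurable_continuous_onI by blast+
  show ?thesis unfolding two_sided_def[abs_def] by measurable
qed

lemma LINT_two_sided:
  assumes c: "continuous_on UNIV \<psi>" "continuous_on UNIV F" "continuous_on UNIV G"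
    and supp: "\<And>x. x \<notin> {- M..M} \<Longrightarrow> \<psi> x = 0" and M: "M \<ge> 0" and \<Omega>: "\<Omega> = UNIV \<or> \<Omega> = \<Omega>\<^sub>0"
  shows "(LINT x:\<Omega>|lborel. of_real (\<psi> x) * two_sided F G x) =
    of_real ((LINT x:{0..M}|lborel. \<psi> x * F x) + (LINT x:{- M..0}|lborel. \<psi> x * G x))"
proof -
  have [measurable]: "\<psi> \<in> borel_measurable borel" "F \<in> borel_measurable borel" "G \<in> borel_measurable borel"
    using c borel_measurable_continuous_onI by blast+
  have [measurable]: "\<Omega> \<in> sets borel" using \<Omega> by auto
  define A where "A x = indicator {0..M} x *\<^sub>R (\<psi> x * F x)" for x
  define B where "B x = indicator {- M..0} x *\<^sub>R (\<psi> x * G x)" for x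
  have iA: "integrable lborel A" unfolding A_def[abs_def]
    by (intro borel_integrable_compact compact_Icc continuous_intros continuous_on_subset[OF c(1)] continuous_on_subset[OF c(2)]) auto
  have iB: "integrable lborel B" unfolding B_def[abs_def]
    by (intro borel_integrable_compact compact_Icc continuous_intros continuous_on_subset[OF c(1)] continuous_on_subset[OF c(3)]) auto
  have "(LINT x:\<Omega>|lborel. of_real (\<psi> x) * two_sided F G x) = (LINT x|lborel. of_real (A x + B x))"
    unfolding set_lebesgue_integral_def
  proof (rule integral_cong_AE)
    show "AE x in lborel. indicator \<Omega> x *\<^sub>R (complex_of_real (\<psi> x) * two_sided F G x) = of_real (A x + B x)"
      using AE_lborel_singleton[of "0::real"]
    proof eventually_elim
      case (elim x)
      hence "x \<in> \<Omega>" using \<Omega> by auto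
      thus ?case using elim supp[of x] M
        by (cases "x \<in> {- M..M}") (auto simp: A_def B_def two_sided_def indicator_def)
    qed
  qed (simp_all add: A_def B_def two_sided_def)
  also have "\<dots> = of_real ((LINT x|lborel. A x) + (LINT x|lborel. B x))"
    using iA iB by (simp add: integral_complex_of_real del: of_real_add)
  finally show ?thesis by (simp add: A_def B_def set_lebesgue_integral_def)
qed

text \<open>
  Integration by parts on both half lines leaves the boundary term \<open>\<eta> 0 * (G 0 - F 0)\<close>. It vanishes
  because \<open>0\<close> is outside the support of \<open>\<eta>\<close>, or because the two pieces match at \<open>0\<close>.
\<close>

lemma two_sided_weak_deriv:
  assumes F: "\<And>x. (F has_real_derivative F' x) (at x)" and G: "\<And>x. (G has_real_derivative G' x) (at x)"
    and c: "continuous_on UNIV F'" "continuous_on UNIV G'"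
    and \<Omega>: "\<Omega> = \<Omega>\<^sub>0 \<or> (\<Omega> = UNIV \<and> F 0 = G 0)"
  shows "is_weak_deriv \<Omega> (two_sided F G) (two_sided F' G')"
  unfolding is_weak_deriv_def
proof
  fix \<eta> assume \<eta>: "\<eta> \<in> test_functions \<Omega>"
  obtain K where K: "compact K" "K \<subseteq> \<Omega>" "\<And>x. x \<notin> K \<Longrightarrow> \<eta> x = 0" "\<And>x. x \<notin> K \<Longrightarrow> deriv \<eta> x = 0"
    using test_function_support[OF \<eta>] by metis
  have \<eta>s: "smooth \<eta>" using \<eta> by (simp add: test_functions_alt)
  obtain a where a: "a > 0" "\<And>x. x \<in> K \<Longrightarrow> \<bar>x\<bar> \<le> a"
    using compact_imp_bounded[OF K(1)] unfolding bounded_pos by (metis real_norm_def)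
  define M where "M = a + 1"
  have M: "M \<ge> 0" "M \<notin> K" "- M \<notin> K" using a by (force simp: M_def)+
  have supp: "\<eta> x = 0" "deriv \<eta> x = 0" if "x \<notin> {- M..M}" for x
    using that a K(3,4) by (force simp: M_def)+
  have c\<eta>: "continuous_on S \<eta>" "continuous_on S (deriv \<eta>)" for S
    using \<eta>s smooth_deriv smooth_continuous by blast+
  have cF: "continuous_on S F" "continuous_on S G" "continuous_on S F'" "continuous_on S G'" for S
    using F G c by (auto intro: DERIV_continuous_on has_field_derivative_at_within continuous_on_subset)
  have parts: "(LINT x:{l..r}|lborel. deriv \<eta> x * f x) + (LINT x:{l..r}|lborel. \<eta> x * f' x) = \<eta> r * f r - \<eta> l * f l"
    if f: "\<And>x. (f has_real_derivative f' x) (at x)" "\<And>S. continuous_on S f" "\<And>S. continuous_on S f'" and "l \<le> r" for f f' :: "real \<Rightarrow> real" and l r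
  proof -
    have "(LINT x:{l..r}|lborel. deriv \<eta> x * f x + \<eta> x * f' x) = \<eta> r * f r - \<eta> l * f l"
      unfolding set_lebesgue_integral_def
    proof (rule integral_FTC_atLeastAtMost[OF that(4)])
      fix x
      have "((\<lambda>x. \<eta> x * f x) has_real_derivative deriv \<eta> x * f x + \<eta> x * f' x) (at x)"
        by (rule derivative_eq_intros smooth_has_derivative[OF \<eta>s] f refl)+ (simp add: algebra_simps)
      thus "((\<lambda>x. \<eta> x * f x) has_vector_derivative deriv \<eta> x * f x + \<eta> x * f' x) (at x within {l..r})"
        using has_real_derivative_iff_has_vector_derivative has_vector_derivative_at_within by blast
    qed (intro continuous_intros c\<eta> f)
    moreover have "(LINT x:{l..r}|lborel. deriv \<eta> x * f x + \<eta> x * f' x) =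
       (LINT x:{l..r}|lborel. deriv \<eta> x * f x) + (LINT x:{l..r}|lborel. \<eta> x * f' x)"
      by (rule set_integral_add(2)) (intro borel_integrable_atLeastAtMost' continuous_intros c\<eta> f)+
    ultimately show ?thesis by simp
  qed
  have \<Omega>': "\<Omega> = UNIV \<or> \<Omega> = \<Omega>\<^sub>0" using \<Omega> by auto
  have 1: "(LINT x:\<Omega>|lborel. of_real (deriv \<eta> x) * two_sided F G x) =
    of_real ((LINT x:{0..M}|lborel. deriv \<eta> x * F x) + (LINT x:{- M..0}|lborel. deriv \<eta> x * G x))"
    by (rule LINT_two_sided[OF c\<eta>(2) cF(1,2) supp(2) M(1) \<Omega>'])
  have 2: "(LINT x:\<Omega>|lborel. of_real (\<eta> x) * two_sided F' G' x) =
    of_real ((LINT x:{0..M}|lborel. \<eta> x * F' x) + (LINT x:{- M..0}|lborel. \<eta> x * G' x))"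
    by (rule LINT_two_sided[OF c\<eta>(1) cF(3,4) supp(1) M(1) \<Omega>'])
  have e: "\<eta> 0 * F 0 = \<eta> 0 * G 0" using \<Omega> K(2) K(3)[of 0] by auto
  have "(LINT x:{0..M}|lborel. deriv \<eta> x * F x) + (LINT x:{0..M}|lborel. \<eta> x * F' x) = - (\<eta> 0 * F 0)"
    using parts[OF F cF(1,3), of 0 M] M K(3)[of M] by simp
  moreover have "(LINT x:{- M..0}|lborel. deriv \<eta> x * G x) + (LINT x:{- M..0}|lborel. \<eta> x * G' x) = \<eta> 0 * G 0"
    using parts[OF G cF(2,4), of "- M" 0] M K(3)[of "- M"] by simp
  ultimately have "(LINT x:{0..M}|lborel. deriv \<eta> x * F x) + (LINT x:{- M..0}|lborel. deriv \<eta> x * G x)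
      = - ((LINT x:{0..M}|lborel. \<eta> x * F' x) + (LINT x:{- M..0}|lborel. \<eta> x * G' x))"
    using e by linarith
  thus "(LINT x:\<Omega>|lborel. of_real (deriv \<eta> x) * two_sided F G x) = - (LINT x:\<Omega>|lborel. of_real (\<eta> x) * two_sided F' G' x)"
    unfolding 1 2 by (simp only: of_real_minus)
qed

lemma set_integrable_exp_decay:
  fixes a :: real assumes "a > 0" shows "set_integrable lborel {0..} (\<lambda>x. exp (- a * x))"
proof -
  have "(\<lambda>x. exp (- a * x)) absolutely_integrable_on {0..}"
    by (rule nonnegative_absolutely_integrable_1[OF integrable_on_exp_minus_to_infinity[OF assms]]) simp
  thus ?thesis unfolding set_integrable_def by (subst (asm) integrable_completion) auto
qed

lemma integrable_exp_decay:
  fixes a :: real assumes "a > 0" shows "integrable lborel (\<lambda>x. exp (- a * \<bar>x\<bar>))"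
proof -
  let ?f = "\<lambda>x::real. indicator {0..} x *\<^sub>R exp (- a * x)"
  have i: "integrable lborel ?f"
    using set_integrable_exp_decay[OF assms] by (simp add: set_integrable_def)
  hence "integrable lborel (\<lambda>x. ?f (0 + (- 1) * x))"
    by (subst lborel_integrable_real_affine_iff) auto
  with i have "integrable lborel (\<lambda>x. ?f x + ?f (0 + (- 1) * x))" by (rule Bochner_Integration.integrable_add)
  thus ?thesis
    by (rule Bochner_Integration.integrable_bound) (auto simp: indicator_def)
qed

lemma L2_two_sided:
  assumes c: "continuous_on UNIV F" "continuous_on UNIV G" and a: "a > 0"
    and b: "\<And>x. x \<ge> 0 \<Longrightarrow> \<bar>F x\<bar> \<le> B * exp (- a * \<bar>x\<bar>)" "\<And>x. x < 0 \<Longrightarrow> \<bar>G x\<bar> \<le> B * exp (- a * \<bar>x\<bar>)"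
    and \<Omega>[measurable]: "\<Omega> \<in> sets borel"
  shows "two_sided F G \<in> L2 \<Omega>"
proof -
  have [measurable]: "two_sided F G \<in> borel_measurable borel" by (rule two_sided_measurable[OF c])
  have "integrable lborel (\<lambda>x. B\<^sup>2 * exp (- (2 * a) * \<bar>x\<bar>))"
    using integrable_exp_decay[of "2 * a"] a by simp
  hence "integrable lborel (\<lambda>x. indicator \<Omega> x *\<^sub>R (cmod (two_sided F G x))\<^sup>2)"
  proof (rule Bochner_Integration.integrable_bound)
    show "AE x in lborel. norm (indicator \<Omega> x *\<^sub>R (cmod (two_sided F G x))\<^sup>2) \<le> norm (B\<^sup>2 * exp (- (2 * a) * \<bar>x\<bar>))"
    proof (rule AE_I2)
      fix x
      have "cmod (two_sided F G x) \<le> B * exp (- a * \<bar>x\<bar>)" using b[of x] by (auto simp: two_sided_def simp del: of_real_mult)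
      hence "(cmod (two_sided F G x))\<^sup>2 \<le> (B * exp (- a * \<bar>x\<bar>))\<^sup>2" by (intro power_mono) auto
      also have "\<dots> = B\<^sup>2 * exp (- (2 * a) * \<bar>x\<bar>)"
        by (simp add: power_mult_distrib power2_eq_square[of "exp _"] mult_exp_exp algebra_simps)
      finally show "norm (indicator \<Omega> x *\<^sub>R (cmod (two_sided F G x))\<^sup>2) \<le> norm (B\<^sup>2 * exp (- (2 * a) * \<bar>x\<bar>))"
        by (auto simp: indicator_def)
    qed
  qed measurable
  thus ?thesis by (auto simp: L2_def set_integrable_def set_borel_measurable_def)
qed

context jost
begin

text \<open>
  The point interaction operator whose potential is \<open>k\<^sup>2 - q\<close> on the right half line, shifted by \<open>s0\<close> and
  reflected to the left.
\<close>

definition opL :: "real \<Rightarrow> (real \<Rightarrow> complex) \<Rightarrow> real \<Rightarrow> complex" where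
  "opL s0 g x = - weak_deriv \<Omega>\<^sub>0 (weak_deriv \<Omega>\<^sub>0 g) x + of_real (k\<^sup>2 - q (s0 + \<bar>x\<bar>)) * g x"

text \<open>The even (\<open>\<sigma> = 1\<close>) or odd (\<open>\<sigma> = -1\<close>) extension of a function on the half line.\<close>

definition mirror :: "real \<Rightarrow> real \<Rightarrow> (real \<Rightarrow> real) \<Rightarrow> real \<Rightarrow> complex" where
  "mirror s0 \<sigma> f = two_sided (\<lambda>x. f (s0 + x)) (\<lambda>x. \<sigma> * f (s0 - x))"

lemma mirror_weak_deriv:
  assumes "\<And>s. (f has_real_derivative f' s) (at s)" "continuous_on UNIV f'"
    and "\<Omega> = \<Omega>\<^sub>0 \<or> \<Omega> = UNIV \<and> f s0 = \<sigma> * f s0"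
  shows "is_weak_deriv \<Omega> (mirror s0 \<sigma> f) (mirror s0 (- \<sigma>) f')"
  unfolding mirror_def
proof (rule two_sided_weak_deriv)
  have "((\<lambda>x. f (s0 + x)) has_real_derivative f' (s0 + x) * 1) (at x)" for x
    by (rule DERIV_chain2[OF assms(1)]) (auto intro!: derivative_eq_intros)
  thus "((\<lambda>x. f (s0 + x)) has_real_derivative f' (s0 + x)) (at x)" for x by simp
  have "((\<lambda>x. f (s0 - x)) has_real_derivative f' (s0 - x) * (- 1)) (at x)" for x
    by (rule DERIV_chain2[OF assms(1)]) (auto intro!: derivative_eq_intros)
  from DERIV_cmult[OF this]
  show "((\<lambda>x. \<sigma> * f (s0 - x)) has_real_derivative - \<sigma> * f' (s0 - x)) (at x)" for x by simp
qed (use assms(3) in \<open>auto intro!: continuous_intros continuous_on_compose2[OF assms(2)]\<close>)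

lemma mirror_L2:
  assumes "continuous_on UNIV f" "a > 0" "\<And>s. s \<ge> s0 \<Longrightarrow> \<bar>f s\<bar> \<le> K * exp (- a * s)" "\<bar>\<sigma>\<bar> = 1" "\<Omega> \<in> sets borel"
  shows "mirror s0 \<sigma> f \<in> L2 \<Omega>"
  unfolding mirror_def
proof (rule L2_two_sided[where B="K * exp (- a * s0)", OF _ _ assms(2)])
  show "\<bar>f (s0 + x)\<bar> \<le> K * exp (- a * s0) * exp (- a * \<bar>x\<bar>)" if "x \<ge> 0" for x
    using assms(3)[of "s0 + x"] that by (simp add: mult_exp_exp mult.assoc algebra_simps)
  show "\<bar>\<sigma> * f (s0 - x)\<bar> \<le> K * exp (- a * s0) * exp (- a * \<bar>x\<bar>)" if "x < 0" for x
    using assms(3)[of "s0 - x"] that assms(4) by (simp add: abs_mult mult_exp_exp mult.assoc algebra_simps)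
qed (use assms in \<open>auto intro!: continuous_intros continuous_on_compose2[OF assms(1)]\<close>)

text \<open>
  The jump condition for the odd and for the even extension of the Jost solution, respectively; in the
  odd case it amounts to continuity at \<open>0\<close>.
\<close>

definition matching :: "real \<Rightarrow> real \<Rightarrow> real \<Rightarrow> bool" where
  "matching s0 Z \<kappa> \<longleftrightarrow> u \<kappa> s0 = 0 \<or> v \<kappa> s0 + Z / 2 * u \<kappa> s0 = 0"

text \<open>
  The sign with which the left half of an eigenfunction continues the right one.
\<close>

definition parity :: "real \<Rightarrow> real \<Rightarrow> real" where "parity s0 \<kappa> = (if u \<kappa> s0 = 0 then - 1 else 1)"

lemma v_cont: "\<kappa> \<ge> k \<Longrightarrow> continuous_on S (v \<kappa>)"
  by (rule DERIV_continuous_on) (auto intro: has_field_derivative_at_within v_deriv)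

lemma q_bounded: "\<exists>B. \<forall>s\<ge>s0. \<bar>q s\<bar> \<le> B"
proof -
  have "\<bar>q s\<bar> \<le> c * exp (- c * s0) * C" if "s \<ge> s0" for s
    unfolding q_def abs_mult using that c_pos by (intro mult_mono r_bound) auto
  thus ?thesis by blast
qed

lemma eigenfunction:
  assumes \<kappa>: "\<kappa> \<ge> k" and m: "matching s0 Z \<kappa>"
  shows "mirror s0 (parity s0 \<kappa>) (u \<kappa>) \<in> eigenspace (dom_L Z) (opL s0) (k\<^sup>2 - \<kappa>\<^sup>2)"
proof -
  define \<sigma> where "\<sigma> = parity s0 \<kappa>"
  define w where "w s = (\<kappa>\<^sup>2 - q s) * u \<kappa> s" for s
  define g where "g = mirror s0 \<sigma> (u \<kappa>)"
  define g1 where "g1 = mirror s0 (- \<sigma>) (v \<kappa>)"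
  define g2 where "g2 = mirror s0 \<sigma> w"
  have \<kappa>0: "\<kappa> > 0" using \<kappa> k_pos by simp
  have \<sigma>: "\<bar>\<sigma>\<bar> = 1" "\<bar>- \<sigma>\<bar> = 1" by (auto simp: \<sigma>_def parity_def)
  have cont0: "u \<kappa> s0 = \<sigma> * u \<kappa> s0" by (auto simp: \<sigma>_def parity_def)
  \<comment> \<open>The one-sided derivatives at \<open>0\<close> are \<open>v \<kappa> s0\<close> and \<open>- \<sigma> * v \<kappa> s0\<close>.\<close>
  have jump: "(1 + \<sigma>) * v \<kappa> s0 = - Z * u \<kappa> s0"
    using m by (auto simp: \<sigma>_def parity_def matching_def)
  have cw: "continuous_on UNIV w" unfolding w_def by (intro continuous_intros q_cont u_cont \<kappa>)
  have dw: "(v \<kappa> has_real_derivative w s) (at s)" for s unfolding w_def by (rule v_deriv[OF \<kappa>])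
  obtain K where K: "\<And>s. s \<ge> s0 \<Longrightarrow> \<bar>u \<kappa> s\<bar> \<le> K * exp (- \<kappa> * s)" "\<And>s. s \<ge> s0 \<Longrightarrow> \<bar>v \<kappa> s\<bar> \<le> (1 + \<kappa>) * K * exp (- \<kappa> * s)"
    using uv_bound[of s0] \<kappa> by blast
  obtain B where B: "\<And>s. s \<ge> s0 \<Longrightarrow> \<bar>q s\<bar> \<le> B" using q_bounded by blast
  have Kw: "\<bar>w s\<bar> \<le> (\<kappa>\<^sup>2 + B) * K * exp (- \<kappa> * s)" if "s \<ge> s0" for s
  proof -
    have "\<bar>\<kappa>\<^sup>2 - q s\<bar> \<le> \<kappa>\<^sup>2 + B" using B[OF that] zero_le_power2[of \<kappa>] by linarith
    hence "\<bar>w s\<bar> \<le> (\<kappa>\<^sup>2 + B) * (K * exp (- \<kappa> * s))"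
      unfolding w_def abs_mult by (intro mult_mono K that) auto
    thus ?thesis by simp
  qed
  have L2: "g \<in> L2 \<Omega>" "g1 \<in> L2 \<Omega>" "g2 \<in> L2 \<Omega>" if "\<Omega> \<in> sets borel" for \<Omega>
    unfolding g_def g1_def g2_def
    using mirror_L2[OF u_cont[OF \<kappa>] \<kappa>0 K(1) \<sigma>(1) that] mirror_L2[OF v_cont[OF \<kappa>] \<kappa>0 K(2) \<sigma>(2) that]
      mirror_L2[OF cw \<kappa>0 Kw \<sigma>(1) that] by auto
  have wd: "is_weak_deriv \<Omega> g g1" if "\<Omega> = \<Omega>\<^sub>0 \<or> \<Omega> = UNIV" for \<Omega>
    unfolding g_def g1_def by (rule mirror_weak_deriv[OF u_deriv[OF \<kappa>] v_cont[OF \<kappa>]]) (use that cont0 in auto)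
  have wd2: "is_weak_deriv \<Omega>\<^sub>0 g1 g2"
    unfolding g1_def g2_def using mirror_weak_deriv[OF dw cw, of \<Omega>\<^sub>0 s0 "- \<sigma>"] by simp
  have op: "open \<Omega>\<^sub>0" and bo: "\<Omega>\<^sub>0 \<in> sets borel" by auto
  have W1: "is_weak_deriv \<Omega>\<^sub>0 g (weak_deriv \<Omega>\<^sub>0 g)" "AE x in lborel. x \<in> \<Omega>\<^sub>0 \<longrightarrow> weak_deriv \<Omega>\<^sub>0 g x = g1 x"
    using weak_deriv_AE_eq[OF op L2(2)[OF bo] wd] by auto
  have W2: "AE x in lborel. x \<in> \<Omega>\<^sub>0 \<longrightarrow> weak_deriv \<Omega>\<^sub>0 (weak_deriv \<Omega>\<^sub>0 g) x = g2 x"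
    by (rule weak_deriv_AE_eq(3)[OF op L2(3)[OF bo] is_weak_deriv_transfer[OF _ W1(1) wd2]]) (use wd in auto)
  have cu: "continuous_on UNIV g"
  proof -
    have "continuous_on ({0..} \<union> {..0}) (\<lambda>x. if x \<ge> 0 then u \<kappa> (s0 + x) else \<sigma> * u \<kappa> (s0 - x))"
      by (rule continuous_on_If)
        (use cont0 in \<open>auto intro!: continuous_intros continuous_on_compose2[OF u_cont[OF \<kappa>, of UNIV]]\<close>)
    moreover have "{0..} \<union> {..0} = (UNIV :: real set)" by auto
    ultimately show ?thesis unfolding g_def mirror_def two_sided_def[abs_def]
      by (intro continuous_on_of_real) simp
  qed
  have right: "g1 x = of_real (v \<kappa> (s0 + x))" if "x > 0" for x
    using that by (simp add: g1_def mirror_def two_sided_def)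
  have left: "g1 x = of_real (- \<sigma> * v \<kappa> (s0 - x))" if "x < 0" for x
    using that by (simp add: g1_def mirror_def two_sided_def)
  have cr: "continuous_on S (\<lambda>x. complex_of_real (v \<kappa> (s0 + x)))"
    and cl: "continuous_on S (\<lambda>x. complex_of_real (- \<sigma> * v \<kappa> (s0 - x)))" for S
    by (intro continuous_intros continuous_on_compose2[OF v_cont[OF \<kappa>, of UNIV]]; auto)+
  have cv: "continuous_on \<Omega>\<^sub>0 g1"
  proof -
    have "continuous_on {0<..} g1" using cr right by (subst continuous_on_cong[OF refl]) auto
    moreover have "continuous_on {..<0} g1" using cl left by (subst continuous_on_cong[OF refl]) auto
    ultimately have "continuous_on ({0<..} \<union> {..<0}) g1" by (intro continuous_on_open_Un) auto
    moreover have "{0<..} \<union> {..<0} = (\<Omega>\<^sub>0 :: real set)" by auto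
    ultimately show ?thesis by simp
  qed
  have lr: "(g1 \<longlongrightarrow> of_real (v \<kappa> s0)) (at_right 0)"
  proof -
    have "((\<lambda>x. complex_of_real (v \<kappa> (s0 + x))) \<longlongrightarrow> of_real (v \<kappa> (s0 + 0))) (at_right 0)"
      by (rule tendsto_within_subset[OF cr[of UNIV, unfolded continuous_on_def, rule_format, OF UNIV_I]]) simp
    hence "((\<lambda>x. complex_of_real (v \<kappa> (s0 + x))) \<longlongrightarrow> of_real (v \<kappa> s0)) (at_right 0)" by simp
    thus ?thesis by (rule Lim_transform_eventually) (auto simp: right eventually_at_right_field intro: exI[of _ 1])
  qed
  have ll: "(g1 \<longlongrightarrow> of_real (- \<sigma> * v \<kappa> s0)) (at_left 0)"
  proof -
    have "((\<lambda>x. complex_of_real (- \<sigma> * v \<kappa> (s0 - x))) \<longlongrightarrow> of_real (- \<sigma> * v \<kappa> (s0 - 0))) (at_left 0)"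
      by (rule tendsto_within_subset[OF cl[of UNIV, unfolded continuous_on_def, rule_format, OF UNIV_I]]) simp
    hence "((\<lambda>x. complex_of_real (- \<sigma> * v \<kappa> (s0 - x))) \<longlongrightarrow> of_real (- \<sigma> * v \<kappa> s0)) (at_left 0)" by simp
    thus ?thesis by (rule Lim_transform_eventually) (auto simp: left eventually_at_left_field intro: exI[of _ "-1"])
  qed
  have "g \<in> dom_L Z"
    unfolding dom_L_def
  proof (intro CollectI IntI exI conjI)
    show "g \<in> sobolev 1 UNIV" using L2[of UNIV] wd[of UNIV] by auto
    show "g \<in> sobolev 2 \<Omega>\<^sub>0" using L2[OF bo] wd[of \<Omega>\<^sub>0] wd2 by (auto simp: numeral_2_eq_2)
    show "continuous_on UNIV g" by (rule cu)
    show "AE x in lborel. g x = g x" by simp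
    show "continuous_on \<Omega>\<^sub>0 g1" by (rule cv)
    show "AE x in lborel. g1 x = weak_deriv \<Omega>\<^sub>0 g x"
      using W1(2) AE_lborel_singleton[of "0::real"] by eventually_elim auto
    show "(g1 \<longlongrightarrow> of_real (v \<kappa> s0)) (at_right 0)" by (rule lr)
    show "(g1 \<longlongrightarrow> of_real (- \<sigma> * v \<kappa> s0)) (at_left 0)" by (rule ll)
    have "complex_of_real (v \<kappa> s0) - of_real (- \<sigma> * v \<kappa> s0) = of_real ((1 + \<sigma>) * v \<kappa> s0)"
      by (simp add: algebra_simps)
    also have "\<dots> = - of_real Z * of_real (u \<kappa> s0)" unfolding jump by simp
    also have "of_real (u \<kappa> s0) = g 0" by (simp add: g_def mirror_def two_sided_def)
    finally show "complex_of_real (v \<kappa> s0) - of_real (- \<sigma> * v \<kappa> s0) = - of_real Z * g 0" .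
  qed
  moreover have "AE x in lborel. opL s0 g x = of_real (k\<^sup>2 - \<kappa>\<^sup>2) * g x"
    using W2 AE_lborel_singleton[of "0::real"]
  proof eventually_elim
    case (elim x)
    have "g2 x = of_real (\<kappa>\<^sup>2 - q (s0 + \<bar>x\<bar>)) * g x"
      by (auto simp: g2_def g_def mirror_def two_sided_def w_def)
    thus ?case using elim by (simp add: opL_def algebra_simps)
  qed
  ultimately show ?thesis unfolding eigenspace_def g_def \<sigma>_def by blast
qed

lemma mirror_not_AE_zero:
  assumes \<kappa>: "\<kappa> \<ge> k" and "AE x in lborel. d * mirror s0 \<sigma> (u \<kappa>) x = 0"
  shows "d = 0"
proof (rule ccontr)
  assume d: "d \<noteq> 0"
  have u0: "u \<kappa> (s0 + x) = 0" if "x > 0" for x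
  proof (rule continuous_AE_zero_imp_zero[of "{0<..}" "\<lambda>x. u \<kappa> (s0 + x)"])
    show "AE x in lborel. x \<in> {0<..} \<longrightarrow> u \<kappa> (s0 + x) = 0"
      using assms(2) by eventually_elim (use d in \<open>auto simp: mirror_def two_sided_def\<close>)
  qed (use that in \<open>auto intro!: continuous_intros continuous_on_compose2[OF u_cont[OF \<kappa>, of UNIV]]\<close>)
  have "eventually (\<lambda>s. u \<kappa> s > 0 \<and> s > s0) at_top"
    using u_pos_at_infinity[OF \<kappa>] eventually_gt_at_top[of s0] by (rule eventually_conj)
  then obtain s where "u \<kappa> s > 0" "s > s0" using eventually_happens by fastforce
  thus False using u0[of "s - s0"] by simp
qed

end

section \<open>Eigenspaces and the number of negative eigenvalues\<close>

lemma set_integrable_const_halfline: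
  fixes w :: real
  assumes "set_integrable lborel {0<..} (\<lambda>_::real. w)"
  shows "w = 0"
proof (rule ccontr)
  assume "w \<noteq> 0"
  hence "integrable lborel (indicator {0<..} :: real \<Rightarrow> real)"
    using assms by (simp add: set_integrable_def)
  hence i: "integrable lborel (\<lambda>x::real. indicator {0<..} x :: real)" .
  hence "integrable lborel (\<lambda>x::real. indicator {0<..} (0 + (- 1) * x) :: real)"
    by (subst lborel_integrable_real_affine_iff) auto
  with i have "integrable lborel (\<lambda>x::real. indicator {0<..} x + indicator {0<..} (0 + (- 1) * x) :: real)"
    by (rule Bochner_Integration.integrable_add)
  moreover have "AE x::real in lborel. (indicator {0<..} x + indicator {0<..} (0 + (- 1) * x) :: real) = 1"
    using AE_lborel_singleton[of "0::real"] by eventually_elim (auto simp: indicator_def)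
  ultimately have "integrable lborel (\<lambda>x::real. 1::real)"
    by (subst (asm) integrable_cong_AE[where g="\<lambda>_. 1"]) auto
  hence "integrable lborel (indicator (UNIV :: real set) :: real \<Rightarrow> real)" by (simp add: indicator_def)
  thus False by (subst (asm) integrable_indicator_iff) simp
qed

lemma set_integrable_square_dominated:
  fixes f :: "real \<Rightarrow> real" and F :: "real \<Rightarrow> complex"
  assumes "set_integrable lborel A (\<lambda>x. (cmod (F x))\<^sup>2)" "continuous_on A f" "A \<in> sets borel"
    and "\<And>x. x \<in> A \<Longrightarrow> \<bar>f x\<bar> \<le> cmod (F x)"
  shows "set_integrable lborel A (\<lambda>x. (f x)\<^sup>2)"
  using assms(1)
proof (rule set_integrable_bound)
  show "set_borel_measurable lborel A (\<lambda>x. (f x)\<^sup>2)"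
    unfolding set_borel_measurable_def
    using borel_measurable_continuous_on_indicator[OF assms(3), of "\<lambda>x. (f x)\<^sup>2"] assms(2)
    by (simp add: continuous_on_power)
  show "AE x in lborel. x \<in> A \<longrightarrow> norm ((f x)\<^sup>2) \<le> norm ((cmod (F x))\<^sup>2)"
    using power_mono[OF assms(4) abs_ge_zero, of _ 2] by (intro AE_I2) auto
qed

context jost
begin

lemma jost_square_integrable:
  assumes "\<kappa> \<ge> k"
  shows "set_integrable lborel {0<..} (\<lambda>x. (u \<kappa> (s0 + x))\<^sup>2)" "set_integrable lborel {0<..} (\<lambda>x. (v \<kappa> (s0 + x))\<^sup>2)"
proof -
  have \<kappa>0: "\<kappa> > 0" using assms k_pos by simp
  obtain K where K: "\<And>s. s \<ge> s0 \<Longrightarrow> \<bar>u \<kappa> s\<bar> \<le> K * exp (- \<kappa> * s)" "\<And>s. s \<ge> s0 \<Longrightarrow> \<bar>v \<kappa> s\<bar> \<le> (1 + \<kappa>) * K * exp (- \<kappa> * s)"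
    using uv_bound[of s0] assms by blast
  have *: "set_integrable lborel {0<..} (\<lambda>x. (f (s0 + x))\<^sup>2)"
    if f: "continuous_on UNIV f" "\<And>s. s \<ge> s0 \<Longrightarrow> \<bar>f s\<bar> \<le> B * exp (- \<kappa> * s)" for f B
  proof -
    have "mirror s0 1 f \<in> L2 {0<..}" by (rule mirror_L2[OF f(1) \<kappa>0 f(2)]) auto
    hence "set_integrable lborel {0<..} (\<lambda>x. (cmod (mirror s0 1 f x))\<^sup>2)" by (simp add: L2_def)
    thus ?thesis
      by (rule set_integrable_square_dominated)
        (auto intro!: continuous_intros continuous_on_compose2[OF f(1)] simp: mirror_def two_sided_def)
  qed
  show "set_integrable lborel {0<..} (\<lambda>x. (u \<kappa> (s0 + x))\<^sup>2)" by (rule *[OF u_cont[OF assms] K(1)])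
  show "set_integrable lborel {0<..} (\<lambda>x. (v \<kappa> (s0 + x))\<^sup>2)" by (rule *[OF v_cont[OF assms] K(2)])
qed

text \<open>
  The Wronskian with the Jost solution is constant, and integrable over a half line because all four
  functions are square integrable. Hence it is \<open>0\<close>. Where \<open>u \<kappa> > 0\<close> this gives proportional initial data,
  and uniqueness for the initial value problem does the rest.
\<close>

lemma square_integrable_solution:
  fixes f g :: "real \<Rightarrow> real"
  assumes \<kappa>: "\<kappa> \<ge> k"
    and f: "\<And>x. x > 0 \<Longrightarrow> (f has_real_derivative g x) (at x)"
    and g: "\<And>x. x > 0 \<Longrightarrow> (g has_real_derivative (\<kappa>\<^sup>2 - q (s0 + x)) * f x) (at x)"
    and i: "set_integrable lborel {0<..} (\<lambda>x. (f x)\<^sup>2)" "set_integrable lborel {0<..} (\<lambda>x. (g x)\<^sup>2)"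
  shows "\<exists>A. \<forall>x>0. f x = A * u \<kappa> (s0 + x) \<and> g x = A * v \<kappa> (s0 + x)"
proof -
  define U V where "U x = u \<kappa> (s0 + x)" and "V x = v \<kappa> (s0 + x)" for x
  have dU: "(U has_real_derivative V x) (at x)" for x
    unfolding U_def[abs_def] V_def using DERIV_shift[of "u \<kappa>" "v \<kappa> (s0 + x)" x s0] u_deriv[OF \<kappa>] by (simp add: add.commute)
  have dV: "(V has_real_derivative (\<kappa>\<^sup>2 - q (s0 + x)) * U x) (at x)" for x
    unfolding V_def[abs_def] U_def using DERIV_shift[of "v \<kappa>" "(\<kappa>\<^sup>2 - q (s0 + x)) * u \<kappa> (s0 + x)" x s0] v_deriv[OF \<kappa>]
    by (simp add: add.commute)
  define W where "W x = f x * V x - g x * U x" for x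
  have dW: "(W has_real_derivative 0) (at x)" if "x > 0" for x
    unfolding W_def[abs_def]
    by (rule derivative_eq_intros f g dU dV that refl)+ (simp add: algebra_simps)
  have Wc: "W x = W 1" if "x > 0" for x
    using DERIV_isconst3[of 0 "max x 1 + 1" x 1 W] that dW by auto
  have iU: "set_integrable lborel {0<..} (\<lambda>x. (U x)\<^sup>2)" "set_integrable lborel {0<..} (\<lambda>x. (V x)\<^sup>2)"
    unfolding U_def V_def using jost_square_integrable[OF \<kappa>] by auto
  have "set_integrable lborel {0<..} (\<lambda>_::real. W 1)"
  proof (rule set_integrable_bound)
    show "set_integrable lborel {0<..} (\<lambda>x. (f x)\<^sup>2 + (g x)\<^sup>2 + ((U x)\<^sup>2 + (V x)\<^sup>2))"
      by (intro set_integral_add(1) i iU)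
    show "set_borel_measurable lborel {0<..} (\<lambda>_::real. W 1)"
      by (simp add: set_borel_measurable_def)
    show "AE x in lborel. x \<in> {0<..} \<longrightarrow> norm (W 1) \<le> norm ((f x)\<^sup>2 + (g x)\<^sup>2 + ((U x)\<^sup>2 + (V x)\<^sup>2))"
    proof (intro AE_I2 impI)
      fix x :: real assume "x \<in> {0<..}"
      hence "W 1 = f x * V x - g x * U x" using Wc[of x] by (simp add: W_def)
      moreover have "2 * \<bar>f x * V x\<bar> \<le> (f x)\<^sup>2 + (V x)\<^sup>2" "2 * \<bar>g x * U x\<bar> \<le> (g x)\<^sup>2 + (U x)\<^sup>2"
        using sum_squares_bound[of "\<bar>f x\<bar>" "\<bar>V x\<bar>"] sum_squares_bound[of "\<bar>g x\<bar>" "\<bar>U x\<bar>"] by (simp_all add: abs_mult)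
      moreover have "0 \<le> (f x)\<^sup>2" "0 \<le> (V x)\<^sup>2" "0 \<le> (g x)\<^sup>2" "0 \<le> (U x)\<^sup>2" by simp_all
      ultimately show "norm (W 1) \<le> norm ((f x)\<^sup>2 + (g x)\<^sup>2 + ((U x)\<^sup>2 + (V x)\<^sup>2))"
        unfolding real_norm_def by linarith
    qed
  qed
  hence "W 1 = 0" by (rule set_integrable_const_halfline)
  hence W0: "f x * V x = g x * U x" if "x > 0" for x using Wc[OF that] by (simp add: W_def)
  have "eventually (\<lambda>s. u \<kappa> s > 0 \<and> s > s0) at_top"
    using u_pos_at_infinity[OF \<kappa>] eventually_gt_at_top[of s0] by (rule eventually_conj)
  then obtain s where s: "u \<kappa> s > 0" "s > s0" using eventually_happens by fastforce
  define y where "y = s - s0"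
  have y: "y > 0" "U y > 0" using s by (auto simp: y_def U_def)
  define A where "A = f y / U y"
  define F where "F x = f x - A * U x" for x
  define G where "G x = g x - A * V x" for x
  have dF: "(F has_real_derivative G x) (at x)" if "x > 0" for x
    unfolding F_def[abs_def] G_def by (rule derivative_eq_intros f dU that refl)+ simp
  have dG: "(G has_real_derivative (\<kappa>\<^sup>2 - q (s0 + x)) * F x) (at x)" if "x > 0" for x
    unfolding G_def[abs_def] F_def by (rule derivative_eq_intros g dV that refl)+ (simp add: algebra_simps)
  have Fy: "F y = 0" using y by (simp add: F_def A_def)
  have Gy: "G y = 0" using y W0[of y] by (simp add: G_def A_def field_simps)
  have "F x = 0 \<and> G x = 0" if "x > 0" for x
    by (rule linear_ode_growth[OF dF dG, of "min x y" "max x y" y x])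
      (use Fy Gy that y in \<open>auto intro!: continuous_intros continuous_on_compose2[OF q_cont[of UNIV]]\<close>)
  thus ?thesis unfolding F_def G_def U_def V_def by (intro exI[of _ A]) auto
qed

lemma square_integrable_solution_complex:
  fixes f g :: "real \<Rightarrow> complex"
  assumes \<kappa>: "\<kappa> \<ge> k"
    and f: "\<And>x. x > 0 \<Longrightarrow> (f has_vector_derivative g x) (at x)"
    and g: "\<And>x. x > 0 \<Longrightarrow> (g has_vector_derivative of_real (\<kappa>\<^sup>2 - q (s0 + x)) * f x) (at x)"
    and i: "set_integrable lborel {0<..} (\<lambda>x. (cmod (f x))\<^sup>2)" "set_integrable lborel {0<..} (\<lambda>x. (cmod (g x))\<^sup>2)"
  shows "\<exists>A. \<forall>x>0. f x = A * of_real (u \<kappa> (s0 + x)) \<and> g x = A * of_real (v \<kappa> (s0 + x))"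
proof -
  have cf: "continuous_on {0<..} f"
    by (intro continuous_at_imp_continuous_on ballI has_vector_derivative_continuous[OF f]) simp
  have cg: "continuous_on {0<..} g"
    by (intro continuous_at_imp_continuous_on ballI has_vector_derivative_continuous[OF g]) simp
  have part: "\<exists>A. \<forall>x>0. L (f x) = A * u \<kappa> (s0 + x) \<and> L (g x) = A * v \<kappa> (s0 + x)"
    if L: "bounded_linear L" "\<And>a z. L (of_real a * z) = a * L z" "\<And>z. \<bar>L z\<bar> \<le> cmod z" for L :: "complex \<Rightarrow> real"
  proof (rule square_integrable_solution[OF \<kappa>])
    have d: "((\<lambda>x. L (h x)) has_real_derivative L h') (at x)" if "(h has_vector_derivative h') (at x)" for h h' and x :: real
      using bounded_linear.has_vector_derivative[OF L(1) that] by (simp add: has_real_derivative_iff_has_vector_derivative)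
    show "((\<lambda>x. L (f x)) has_real_derivative L (g x)) (at x)" if "x > 0" for x by (rule d[OF f[OF that]])
    show "((\<lambda>x. L (g x)) has_real_derivative (\<kappa>\<^sup>2 - q (s0 + x)) * L (f x)) (at x)" if "x > 0" for x
      using d[OF g[OF that]] by (simp only: L(2))
    show "set_integrable lborel {0<..} (\<lambda>x. (L (f x))\<^sup>2)"
      by (rule set_integrable_square_dominated[OF i(1) bounded_linear.continuous_on[OF L(1) cf]]) (auto intro: L(3))
    show "set_integrable lborel {0<..} (\<lambda>x. (L (g x))\<^sup>2)"
      by (rule set_integrable_square_dominated[OF i(2) bounded_linear.continuous_on[OF L(1) cg]]) (auto intro: L(3))
  qed
  obtain A where A: "\<And>x. x > 0 \<Longrightarrow> Re (f x) = A * u \<kappa> (s0 + x) \<and> Re (g x) = A * v \<kappa> (s0 + x)"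
    using part[OF bounded_linear_Re _ abs_Re_le_cmod] by auto
  obtain B where B: "\<And>x. x > 0 \<Longrightarrow> Im (f x) = B * u \<kappa> (s0 + x) \<and> Im (g x) = B * v \<kappa> (s0 + x)"
    using part[OF bounded_linear_Im _ abs_Im_le_cmod] by auto
  show ?thesis
    by (intro exI[of _ "Complex A B"]) (use A B in \<open>auto simp: complex_eq_iff\<close>)
qed

text \<open>
  The continuous representatives in the domain satisfy the differential equation classically off \<open>0\<close>,
  because the eigenvalue equation makes the second weak derivative continuous. Each half is then a
  multiple of the Jost solution, and continuity and the jump condition at \<open>0\<close> relate the two factors.
\<close>

lemma eigenfunction_form:
  assumes g: "g \<in> eigenspace (dom_L Z) (opL s0) \<mu>" and \<mu>: "\<mu> < 0"
  defines "\<kappa> \<equiv> sqrt (k\<^sup>2 - \<mu>)"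
  shows "\<exists>A. (AE x in lborel. g x = A * mirror s0 (parity s0 \<kappa>) (u \<kappa>) x) \<and> (\<not> matching s0 Z \<kappa> \<longrightarrow> A = 0)"
proof -
  have \<kappa>2: "\<kappa>\<^sup>2 = k\<^sup>2 - \<mu>" unfolding \<kappa>_def by (intro real_sqrt_pow2) (use \<mu> zero_le_power2[of k] in linarith)
  have \<kappa>: "\<kappa> \<ge> k" unfolding \<kappa>_def using \<mu> k_pos by (intro real_le_rsqrt) simp
  define h where "h = weak_deriv \<Omega>\<^sub>0 g"
  have dom: "g \<in> dom_L Z" and eig: "AE x in lborel. opL s0 g x = of_real \<mu> * g x"
    using g by (auto simp: eigenspace_def)
  have s2: "g \<in> sobolev 2 \<Omega>\<^sub>0" using dom by (auto simp: dom_L_def)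
  obtain U V r l where U: "continuous_on UNIV U" "AE x in lborel. U x = g x"
    and V: "continuous_on \<Omega>\<^sub>0 V" "AE x in lborel. V x = h x"
    and lim: "(V \<longlongrightarrow> r) (at_right 0)" "(V \<longlongrightarrow> l) (at_left 0)" and jump: "r - l = - of_real Z * U 0"
    using dom unfolding dom_L_def h_def by blast
  define H where "H x = of_real (\<kappa>\<^sup>2 - q (s0 + \<bar>x\<bar>)) * U x" for x
  have cH: "continuous_on S H" for S
    unfolding H_def[abs_def]
    by (intro continuous_intros continuous_on_compose2[OF q_cont[of UNIV]] continuous_on_subset[OF U(1)]) auto
  have gL2: "g \<in> L2 \<Omega>\<^sub>0" using s2 sobolev_subset_L2 by blast
  have hL2: "h \<in> L2 \<Omega>\<^sub>0" "is_weak_deriv \<Omega>\<^sub>0 g h"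
    unfolding h_def using weak_deriv_spec[of g 1 \<Omega>\<^sub>0] s2 by (auto simp: numeral_2_eq_2)
  have jL2: "weak_deriv \<Omega>\<^sub>0 h \<in> L2 \<Omega>\<^sub>0" "is_weak_deriv \<Omega>\<^sub>0 h (weak_deriv \<Omega>\<^sub>0 h)"
    unfolding h_def by (rule second_weak_deriv_spec[OF s2])+
  have meas: "set_borel_measurable lborel \<Omega>\<^sub>0 f" if "f \<in> L2 \<Omega>\<^sub>0" for f using that by (simp add: L2_def)
  have Hj: "AE x in lborel. H x = weak_deriv \<Omega>\<^sub>0 h x"
    using eig U(2) by eventually_elim (simp add: opL_def H_def h_def \<kappa>2 algebra_simps)
  have seg: "\<exists>a b. a < b \<and> {a..b} \<subseteq> \<Omega>\<^sub>0 \<and> x \<in> {a<..<b}" if "x \<noteq> 0" for x :: real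
    by (rule exI[of _ "x - \<bar>x\<bar> / 2"], rule exI[of _ "x + \<bar>x\<bar> / 2"]) (use that in \<open>auto simp: abs_if field_simps split: if_splits\<close>)
  have dU: "(U has_vector_derivative V x) (at x)" if x0: "x \<noteq> 0" for x
  proof -
    obtain a b where ab: "a < b" "{a..b} \<subseteq> \<Omega>\<^sub>0" "x \<in> {a<..<b}" using seg[OF x0] by blast
    show ?thesis
      by (rule weak_deriv_classical[OF ab(1,2) hL2(2) meas[OF gL2] meas[OF hL2(1)] _ _ _ _ ab(3)])
        (use U V ab in \<open>auto elim: continuous_on_subset eventually_mono\<close>)
  qed
  have dV: "(V has_vector_derivative H x) (at x)" if x0: "x \<noteq> 0" for x
  proof -
    obtain a b where ab: "a < b" "{a..b} \<subseteq> \<Omega>\<^sub>0" "x \<in> {a<..<b}" using seg[OF x0] by blast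
    show ?thesis
      by (rule weak_deriv_classical[OF ab(1,2) jL2(2) meas[OF hL2(1)] meas[OF jL2(1)] _ _ _ _ ab(3)])
        (use V ab Hj cH in \<open>auto elim: continuous_on_subset eventually_mono\<close>)
  qed
  have sqint: "set_integrable lborel \<Omega>\<^sub>0 (\<lambda>x. (cmod (F x))\<^sup>2)"
    if "f \<in> L2 \<Omega>\<^sub>0" "continuous_on \<Omega>\<^sub>0 F" "AE x in lborel. F x = f x" for f F
  proof -
    have i: "set_integrable lborel \<Omega>\<^sub>0 (\<lambda>x. (cmod (f x))\<^sup>2)" using that by (simp add: L2_def)
    thus ?thesis
    proof (rule set_integrable_bound)
      show "set_borel_measurable lborel \<Omega>\<^sub>0 (\<lambda>x. (cmod (F x))\<^sup>2)"
        unfolding set_borel_measurable_def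
        using borel_measurable_continuous_on_indicator[of \<Omega>\<^sub>0 "\<lambda>x. (cmod (F x))\<^sup>2"] that(2)
        by (simp add: continuous_on_power continuous_on_norm)
      show "AE x in lborel. x \<in> \<Omega>\<^sub>0 \<longrightarrow> norm ((cmod (F x))\<^sup>2) \<le> norm ((cmod (f x))\<^sup>2)"
        using that(3) by eventually_elim simp
    qed
  qed
  have iU: "set_integrable lborel \<Omega>\<^sub>0 (\<lambda>x. (cmod (U x))\<^sup>2)"
    by (rule sqint[OF gL2 continuous_on_subset[OF U(1)] U(2)]) simp
  have iV: "set_integrable lborel \<Omega>\<^sub>0 (\<lambda>x. (cmod (V x))\<^sup>2)" by (rule sqint[OF hL2(1) V])
  have right: "set_integrable lborel {0<..} F" and left: "set_integrable lborel {0<..} (\<lambda>x. F (- x))"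
    if "set_integrable lborel \<Omega>\<^sub>0 F" for F :: "real \<Rightarrow> real"
  proof -
    show "set_integrable lborel {0<..} F" by (rule set_integrable_subset[OF that]) auto
    have "set_integrable lborel {..<0} F" by (rule set_integrable_subset[OF that]) auto
    hence "integrable lborel (\<lambda>x. indicator {..<0} (0 + (- 1) * x) *\<^sub>R F (0 + (- 1) * x))"
      unfolding set_integrable_def by (subst lborel_integrable_real_affine_iff) auto
    thus "set_integrable lborel {0<..} (\<lambda>x. F (- x))"
      unfolding set_integrable_def by (simp add: indicator_def)
  qed
  obtain cp where cp: "\<And>x. x > 0 \<Longrightarrow> U x = cp * of_real (u \<kappa> (s0 + x)) \<and> V x = cp * of_real (v \<kappa> (s0 + x))"
  proof -
    have "\<exists>A. \<forall>x>0. U x = A * of_real (u \<kappa> (s0 + x)) \<and> V x = A * of_real (v \<kappa> (s0 + x))"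
    proof (rule square_integrable_solution_complex[OF \<kappa>])
      show "(U has_vector_derivative V x) (at x)" if "x > 0" for x using dU that by simp
      show "(V has_vector_derivative of_real (\<kappa>\<^sup>2 - q (s0 + x)) * U x) (at x)" if "x > 0" for x
        using dV[of x] that by (simp add: H_def)
    qed (use right iU iV in auto)
    thus ?thesis using that by blast
  qed
  obtain cm where cm: "\<And>x. x > 0 \<Longrightarrow> U (- x) = cm * of_real (u \<kappa> (s0 + x)) \<and> - V (- x) = cm * of_real (v \<kappa> (s0 + x))"
  proof -
    have refl: "((\<lambda>x. F (- x)) has_vector_derivative - F') (at x)" if "(F has_vector_derivative F') (at (- x))" for F :: "real \<Rightarrow> complex" and F' and x :: real
    proof -
      have "((\<lambda>x::real. - x) has_vector_derivative - 1) (at x)"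
        by (auto intro!: derivative_eq_intros simp: has_real_derivative_iff_has_vector_derivative[symmetric])
      from vector_diff_chain_at[OF this that] show ?thesis by (simp add: o_def)
    qed
    have "\<exists>A. \<forall>x>0. U (- x) = A * of_real (u \<kappa> (s0 + x)) \<and> - V (- x) = A * of_real (v \<kappa> (s0 + x))"
    proof (rule square_integrable_solution_complex[OF \<kappa>])
      show "((\<lambda>x. U (- x)) has_vector_derivative - V (- x)) (at x)" if "x > 0" for x
        by (rule refl[OF dU]) (use that in simp)
      have "((\<lambda>x. - V (- x)) has_vector_derivative - (- H (- x))) (at x)" if "x > 0" for x
        by (rule has_vector_derivative_minus[OF refl[OF dV]]) (use that in simp)
      thus "((\<lambda>x. - V (- x)) has_vector_derivative of_real (\<kappa>\<^sup>2 - q (s0 + x)) * U (- x)) (at x)" if "x > 0" for x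
        using that by (simp add: H_def)
    qed (use left[OF iU] left[OF iV] in auto)
    thus ?thesis using that by blast
  qed
  have cu: "((\<lambda>x. of_real (f (s0 + x)) :: complex) \<longlongrightarrow> of_real (f s0)) (at_right 0)" if "continuous_on UNIV f" for f :: "real \<Rightarrow> real"
  proof -
    have "continuous_on UNIV (\<lambda>x. complex_of_real (f (s0 + x)))"
      by (intro continuous_intros continuous_on_compose2[OF that]) auto
    from tendsto_within_subset[OF this[unfolded continuous_on_def, rule_format, OF UNIV_I, of 0], of "{0<..}"]
    show ?thesis by simp
  qed
  have U0r: "(U \<longlongrightarrow> U 0) (at_right 0)"
    by (rule tendsto_within_subset[OF U(1)[unfolded continuous_on_def, rule_format, OF UNIV_I]]) simp
  have U0l: "((\<lambda>x. U (- x)) \<longlongrightarrow> U 0) (at_right 0)"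
  proof -
    have "continuous_on UNIV (\<lambda>x. U (- x))" by (intro continuous_on_compose2[OF U(1)] continuous_intros) auto
    from tendsto_within_subset[OF this[unfolded continuous_on_def, rule_format, OF UNIV_I, of 0], of "{0<..}"]
    show ?thesis by simp
  qed
  have V0l: "((\<lambda>x. - V (- x)) \<longlongrightarrow> - l) (at_right 0)"
    using lim(2) by (intro tendsto_minus) (simp add: filterlim_at_left_to_right)
  have uniq: "L = c * of_real (f s0)"
    if "(F \<longlongrightarrow> L) (at_right 0)" "\<And>x. x > 0 \<Longrightarrow> F x = c * of_real (f (s0 + x))" "continuous_on UNIV f"
    for F :: "real \<Rightarrow> complex" and L c and f :: "real \<Rightarrow> real"
  proof (rule tendsto_unique[OF _ that(1)])
    have "((\<lambda>x. c * of_real (f (s0 + x))) \<longlongrightarrow> c * of_real (f s0)) (at_right 0)"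
      by (intro tendsto_mult_left cu that)
    thus "(F \<longlongrightarrow> c * of_real (f s0)) (at_right 0)"
      by (rule Lim_transform_eventually) (auto simp: that(2) eventually_at_right_field intro: exI[of _ 1])
  qed simp
  have e1: "U 0 = cp * of_real (u \<kappa> s0)" by (rule uniq[OF U0r _ u_cont[OF \<kappa>]]) (use cp in auto)
  have e2: "U 0 = cm * of_real (u \<kappa> s0)" by (rule uniq[OF U0l _ u_cont[OF \<kappa>]]) (use cm in auto)
  have e3: "r = cp * of_real (v \<kappa> s0)" by (rule uniq[OF lim(1) _ v_cont[OF \<kappa>]]) (use cp in auto)
  have e4: "- l = cm * of_real (v \<kappa> s0)" by (rule uniq[OF V0l _ v_cont[OF \<kappa>]]) (use cm in auto)
  have e5: "(cp + cm) * of_real (v \<kappa> s0) = - of_real Z * (cp * of_real (u \<kappa> s0))"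
  proof -
    have "(cp + cm) * of_real (v \<kappa> s0) = r - l"
      unfolding distrib_right e3[symmetric] e4[symmetric] by simp
    thus ?thesis using jump e1 by simp
  qed
  have par: "cm = of_real (parity s0 \<kappa>) * cp \<and> (\<not> matching s0 Z \<kappa> \<longrightarrow> cp = 0)"
  proof (cases "u \<kappa> s0 = 0")
    case True
    hence "v \<kappa> s0 \<noteq> 0" using u_nontrivial[OF \<kappa>] by blast
    hence "cp + cm = 0" using e5 True by simp
    hence "cm = - cp" by (simp add: add_eq_0_iff)
    thus ?thesis using True by (simp add: parity_def matching_def)
  next
    case False
    hence cc: "cm = cp" using e1 e2 by simp
    have "2 * (cp * of_real (v \<kappa> s0 + Z / 2 * u \<kappa> s0)) = (cp + cp) * of_real (v \<kappa> s0) + of_real Z * (cp * of_real (u \<kappa> s0))"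
      by (simp add: algebra_simps)
    also have "\<dots> = 0" using e5 unfolding cc by simp
    finally have "cp * of_real (v \<kappa> s0 + Z / 2 * u \<kappa> s0) = 0" by simp
    hence "cp = 0 \<or> v \<kappa> s0 + Z / 2 * u \<kappa> s0 = 0"
      by (metis mult_eq_0_iff of_real_eq_0_iff)
    thus ?thesis using cc False by (auto simp: parity_def matching_def)
  qed
  have "AE x in lborel. g x = cp * mirror s0 (parity s0 \<kappa>) (u \<kappa>) x"
    using U(2) AE_lborel_singleton[of "0::real"]
  proof eventually_elim
    case (elim x)
    show ?case
    proof (cases "x > 0")
      case True
      thus ?thesis using elim cp[of x] by (simp add: mirror_def two_sided_def)
    next
      case False
      thus ?thesis using elim cm[of "- x"] par by (simp add: mirror_def two_sided_def)
    qed
  qed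
  thus ?thesis using par by blast
qed

lemma multiplicity_eq:
  assumes \<mu>: "\<mu> < 0"
  shows "multiplicity_of (dom_L Z) (opL s0) \<mu> = (if matching s0 Z (sqrt (k\<^sup>2 - \<mu>)) then 1 else 0)"
proof -
  define \<kappa> where "\<kappa> = sqrt (k\<^sup>2 - \<mu>)"
  have \<kappa>2: "\<kappa>\<^sup>2 = k\<^sup>2 - \<mu>" unfolding \<kappa>_def by (intro real_sqrt_pow2) (use \<mu> zero_le_power2[of k] in linarith)
  have \<kappa>: "\<kappa> \<ge> k" unfolding \<kappa>_def using \<mu> k_pos by (intro real_le_rsqrt) simp
  define E where "E = eigenspace (dom_L Z) (opL s0) \<mu>"
  define G where "G = mirror s0 (parity s0 \<kappa>) (u \<kappa>)"
  define I where "I = {m. \<exists>f. (\<forall>i<m. f i \<in> E) \<and>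
     (\<forall>c::nat \<Rightarrow> complex. (AE x in lborel. (\<Sum>i<m. c i * f i x) = 0) \<longrightarrow> (\<forall>i<m. c i = 0))}"
  have form: "\<exists>A. (AE x in lborel. g x = A * G x) \<and> (\<not> matching s0 Z \<kappa> \<longrightarrow> A = 0)" if "g \<in> E" for g
    using eigenfunction_form[OF that[unfolded E_def] \<mu>] by (simp add: G_def \<kappa>_def)
  have "0 \<in> I" by (auto simp: I_def)
  have le1: "m \<le> 1" and le0: "\<not> matching s0 Z \<kappa> \<Longrightarrow> m = 0" if mI: "m \<in> I" for m
  proof -
    obtain f where f: "\<And>i. i < m \<Longrightarrow> f i \<in> E"
      and ind: "\<And>c::nat \<Rightarrow> complex. (AE x in lborel. (\<Sum>i<m. c i * f i x) = 0) \<Longrightarrow> (\<forall>i<m. c i = 0)"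
      using mI unfolding I_def by blast
    show "m \<le> 1"
    proof (rule ccontr)
      assume "\<not> m \<le> 1"
      hence m: "0 < m" "1 < m" by auto
      \<comment> \<open>Two members are multiples \<open>A0 * G\<close> and \<open>A1 * G\<close>, so the coefficients \<open>A1\<close> and \<open>- A0\<close> annihilate them.\<close>
      obtain A0 A1 where A: "AE x in lborel. f 0 x = A0 * G x" "AE x in lborel. f 1 x = A1 * G x"
        using form[OF f[OF m(1)]] form[OF f[OF m(2)]] by blast
      have sum: "(\<Sum>i<m. (if i = 0 then a else if i = 1 then b else 0) * f i x) = a * f 0 x + b * f 1 x" for a b x
      proof -
        have "(\<Sum>i<m. (if i = 0 then a else if i = 1 then b else 0) * f i x) =
          (\<Sum>i\<in>{0,1}. (if i = 0 then a else if i = 1 then b else 0) * f i x)"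
          by (rule sum.mono_neutral_right) (use m in auto)
        thus ?thesis by simp
      qed
      have "AE x in lborel. (\<Sum>i<m. (if i = 0 then A1 else if i = 1 then - A0 else 0) * f i x) = 0"
        unfolding sum using A by eventually_elim simp
      from ind[OF this] have "A0 = 0" using m by (auto split: if_splits)
      hence "AE x in lborel. f 0 x = 0" using A(1) by simp
      hence "AE x in lborel. (\<Sum>i<m. (if i = 0 then 1 else if i = 1 then 0 else 0) * f i x) = 0"
        unfolding sum by eventually_elim simp
      from ind[OF this] show False using m by auto
    qed
    show "m = 0" if nm: "\<not> matching s0 Z \<kappa>"
    proof (rule ccontr)
      assume "m \<noteq> 0"
      hence m: "m = 1" using \<open>m \<le> 1\<close> by simp
      have "AE x in lborel. f 0 x = 0" using form[OF f[of 0]] m nm by auto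
      hence "AE x in lborel. (\<Sum>i<m. 1 * f i x) = 0" unfolding m by simp
      from ind[OF this] show False using m by auto
    qed
  qed
  have mult: "multiplicity_of (dom_L Z) (opL s0) \<mu> = (SUP m\<in>I. enat m)"
    by (simp add: multiplicity_of_def I_def E_def)
  show ?thesis
  proof (cases "matching s0 Z \<kappa>")
    case True
    have "k\<^sup>2 - \<kappa>\<^sup>2 = \<mu>" using \<kappa>2 by simp
    hence "G \<in> E" unfolding E_def G_def using eigenfunction[OF \<kappa> True] by simp
    moreover have "d 0 = 0" if "AE x in lborel. (\<Sum>i<(1::nat). d i * G x) = 0" for d :: "nat \<Rightarrow> complex"
    proof (rule mirror_not_AE_zero[OF \<kappa>])
      show "AE x in lborel. d 0 * mirror s0 (parity s0 \<kappa>) (u \<kappa>) x = 0"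
        using that unfolding G_def by eventually_elim simp
    qed
    ultimately have "1 \<in> I" unfolding I_def mem_Collect_eq
      by (intro exI[of _ "\<lambda>_. G"]) (simp only: less_one simp_thms, blast)
    have "(SUP m\<in>I. enat m) = enat 1"
      by (rule antisym[OF SUP_least SUP_upper[OF \<open>1 \<in> I\<close>]]) (use le1 in auto)
    thus ?thesis using True mult by (simp add: \<kappa>_def one_enat_def)
  next
    case False
    have "I = {0}" using le0[OF _ False] \<open>0 \<in> I\<close> by blast
    thus ?thesis using False mult by (simp add: \<kappa>_def zero_enat_def)
  qed
qed

text \<open>
  Each eigenspace has dimension \<open>0\<close> or \<open>1\<close>, so the supremum over finite sets of negative numbers counts the
  eigenvalues, which \<open>\<kappa> \<mapsto> k\<^sup>2 - \<kappa>\<^sup>2\<close> matches with the solutions \<open>\<kappa> > k\<close> of the boundary equations.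
\<close>

lemma num_neg_eq_card:
  assumes fin: "finite {\<kappa>. \<kappa> > k \<and> matching s0 Z \<kappa>}"
  shows "num_neg_eigenvalues (dom_L Z) (opL s0) = enat (card {\<kappa>. \<kappa> > k \<and> matching s0 Z \<kappa>})"
proof -
  define K where "K = {\<kappa>. \<kappa> > k \<and> matching s0 Z \<kappa>}"
  define S where "S = (\<lambda>\<kappa>. k\<^sup>2 - \<kappa>\<^sup>2) ` K"
  have inj: "inj_on (\<lambda>\<kappa>. k\<^sup>2 - \<kappa>\<^sup>2) K"
    unfolding inj_on_def K_def using k_pos by (auto simp: power2_eq_iff_nonneg)
  have finS: "finite S" using fin by (simp add: S_def K_def)
  have cardS: "card S = card K" unfolding S_def by (rule card_image[OF inj])
  have S_iff: "\<mu> \<in> S \<longleftrightarrow> \<mu> < 0 \<and> matching s0 Z (sqrt (k\<^sup>2 - \<mu>))" for \<mu>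
  proof
    assume "\<mu> \<in> S"
    then obtain \<kappa> where "\<kappa> > k" "matching s0 Z \<kappa>" "\<mu> = k\<^sup>2 - \<kappa>\<^sup>2" by (auto simp: S_def K_def)
    thus "\<mu> < 0 \<and> matching s0 Z (sqrt (k\<^sup>2 - \<mu>))" using k_pos by (simp add: power_strict_mono)
  next
    assume m: "\<mu> < 0 \<and> matching s0 Z (sqrt (k\<^sup>2 - \<mu>))"
    have "sqrt (k\<^sup>2 - \<mu>) > k" using m by (intro real_less_rsqrt) simp
    moreover have "\<mu> = k\<^sup>2 - (sqrt (k\<^sup>2 - \<mu>))\<^sup>2"
      using m zero_le_power2[of k] by (subst real_sqrt_pow2) linarith+
    ultimately show "\<mu> \<in> S" unfolding S_def K_def using m by blast
  qed
  have sum: "(\<Sum>\<mu>\<in>F. multiplicity_of (dom_L Z) (opL s0) \<mu>) = enat (card (F \<inter> S))" if "finite F" "F \<subseteq> {..<0}" for F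
  proof -
    have "(\<Sum>\<mu>\<in>F. multiplicity_of (dom_L Z) (opL s0) \<mu>) = (\<Sum>\<mu>\<in>F. if \<mu> \<in> S then 1 else 0)"
      by (rule sum.cong) (use that multiplicity_eq S_iff in auto)
    also have "\<dots> = (\<Sum>\<mu>\<in>F \<inter> S. 1)" by (simp only: sum.inter_restrict[OF that(1)])
    also have "\<dots> = enat (card (F \<inter> S))" by (simp add: of_nat_eq_enat)
    finally show ?thesis .
  qed
  have "num_neg_eigenvalues (dom_L Z) (opL s0) = enat (card S)"
    unfolding num_neg_eigenvalues_def
  proof (rule antisym[OF SUP_least SUP_upper2[of S]])
    fix F assume "F \<in> {F. finite F \<and> F \<subseteq> {..<0::real}}"
    thus "(\<Sum>\<mu>\<in>F. multiplicity_of (dom_L Z) (opL s0) \<mu>) \<le> enat (card S)"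
      using sum[of F] finS by (simp add: card_mono)
  next
    show "S \<in> {F. finite F \<and> F \<subseteq> {..<0}}" using finS S_iff by auto
    thus "enat (card S) \<le> (\<Sum>\<mu>\<in>S. multiplicity_of (dom_L Z) (opL s0) \<mu>)" using sum[of S] by simp
  qed
  thus ?thesis using cardS by (simp add: K_def)
qed

end

context jost_zero_mode
begin

theorem num_neg_eigenvalues_zero_mode:
  assumes "z = Z / 2"
  shows "num_neg_eigenvalues (dom_L Z) (opL s0) = (if s0 < 0 then 2 else 1)"
proof -
  obtain \<kappa>R where R: "\<kappa>R > k" "robin \<kappa>R = 0" using robin_exists by blast
  have R_iff: "\<kappa> > k \<and> robin \<kappa> = 0 \<longleftrightarrow> \<kappa> = \<kappa>R" for \<kappa>
    using R robin_unique[of \<kappa> \<kappa>R] robin_unique[of \<kappa>R \<kappa>] by (cases \<kappa> \<kappa>R rule: linorder_cases) auto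
  have m: "matching s0 Z \<kappa> \<longleftrightarrow> u \<kappa> s0 = 0 \<or> robin \<kappa> = 0" for \<kappa>
    unfolding matching_def robin_def by (simp add: assms)
  show ?thesis
  proof (cases "s0 < 0")
    case True
    obtain \<kappa>D where D: "\<kappa>D > k" "u \<kappa>D s0 = 0" using dirichlet_exists[OF True] by blast
    have D_iff: "\<kappa> > k \<and> u \<kappa> s0 = 0 \<longleftrightarrow> \<kappa> = \<kappa>D" for \<kappa>
      using D dirichlet_unique[of \<kappa> \<kappa>D] dirichlet_unique[of \<kappa>D \<kappa>] by (cases \<kappa> \<kappa>D rule: linorder_cases) auto
    have "{\<kappa>. \<kappa> > k \<and> matching s0 Z \<kappa>} = {\<kappa>D, \<kappa>R}" using R_iff D_iff m by blast
    moreover have "\<kappa>D \<noteq> \<kappa>R" using D(2) robin_imp_pos[OF R, of s0] by auto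
    ultimately show ?thesis using num_neg_eq_card[of s0 Z] True by (simp add: numeral_eq_enat)
  next
    case False
    hence "{\<kappa>. \<kappa> > k \<and> matching s0 Z \<kappa>} = {\<kappa>R}" using R_iff dirichlet_none m by auto
    thus ?thesis using num_neg_eq_card[of s0 Z] False by (simp add: one_enat_def)
  qed
qed

end

section \<open>The linearization at a standing wave\<close>

text \<open>
  Here \<open>\<alpha> = a / (p + 1)\<close> and \<open>B = sqrt (\<alpha>\<^sup>2 - b / p * w)\<close>. The coefficients of the nonlinearity are recovered
  from \<open>a = \<alpha> * (p + 1)\<close> and \<open>b * k\<^sup>2 = p * (B\<^sup>2 - \<alpha>\<^sup>2)\<close>, which turns every identity below into one between
  rational functions of \<open>p\<close>, \<open>\<alpha>\<close>, \<open>B\<close> and hyperbolic functions, whatever the sign of \<open>b\<close>.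
\<close>

locale standing_wave =
  fixes p k \<alpha> B :: real
  assumes p: "p > 1" and k: "k > 0" and \<alpha>: "\<alpha> > 0" and B: "B > 0"
begin

definition c :: real where "c = (p - 1) * k"
definition D :: "real \<Rightarrow> real" where "D s = \<alpha> + B * cosh (c * s)"
definition R :: "real \<Rightarrow> real" where "R s = B * sinh (c * s) / D s"
definition R' :: "real \<Rightarrow> real" where "R' s = c * B * (\<alpha> * cosh (c * s) + B) / (D s)\<^sup>2"
definition \<phi> :: "real \<Rightarrow> real" where "\<phi> s = (D s / k\<^sup>2) powr (- 1 / (p - 1))"

text \<open>
  The part \<open>a * p * \<phi> powr (p - 1) + b * (2 * p - 1) * \<phi> powr (2 * p - 2)\<close> of the linearized operator, since
  \<open>\<phi> powr (p - 1) = k\<^sup>2 / D\<close>.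
\<close>

definition pot :: "real \<Rightarrow> real" where
  "pot s = p * (p + 1) * \<alpha> * k\<^sup>2 / D s + p * (2 * p - 1) * (B\<^sup>2 - \<alpha>\<^sup>2) * k\<^sup>2 / (D s)\<^sup>2"

text \<open>
  In \<open>y = exp (- c * s)\<close> one has \<open>1 / D s = 2 * y / (B + 2 * \<alpha> * y + B * y\<^sup>2)\<close>, so \<open>pot s / (c * y)\<close> is this
  rational function of \<open>y\<close>, continuous up to \<open>y = 0\<close>, that is up to infinity; \<open>C\<close> bounds it.
\<close>

definition r :: "real \<Rightarrow> real" where
  "r y = (p * (p + 1) * \<alpha> * k\<^sup>2 * 2 / (B + 2 * \<alpha> * y + B * y\<^sup>2)
        + p * (2 * p - 1) * (B\<^sup>2 - \<alpha>\<^sup>2) * k\<^sup>2 * 4 * (y / (B + 2 * \<alpha> * y + B * y\<^sup>2)\<^sup>2)) / c"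

definition C :: real where
  "C = (p * (p + 1) * \<alpha> * k\<^sup>2 * 2 / B + \<bar>p * (2 * p - 1) * (B\<^sup>2 - \<alpha>\<^sup>2) * k\<^sup>2 * 4\<bar> * (1 / (2 * \<alpha> * B))) / c"

lemma c: "c > 0" using p k by (simp add: c_def)

lemma D_ge: "D s \<ge> \<alpha> + B"
  using mult_left_mono[OF cosh_real_ge_1[of "c * s"], of B] B by (simp add: D_def)

lemma D_pos: "D s > 0" using D_ge[of s] \<alpha> B by linarith

lemma exp_D: "exp (- c * s) / (B + 2 * \<alpha> * exp (- c * s) + B * (exp (- c * s))\<^sup>2) = 1 / (2 * D s)"
proof -
  have "B + 2 * \<alpha> * exp (- c * s) + B * (exp (- c * s))\<^sup>2 = exp (- c * s) * (2 * D s)"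
    unfolding D_def cosh_field_def by (simp add: algebra_simps power2_eq_square mult_exp_exp)
  thus ?thesis by simp
qed

lemma jost_r: "jost c k C r"
proof
  show "c > 0" "k > 0" by (rule c, rule k)
  show "C > 0" unfolding C_def using p k \<alpha> B c by (intro divide_pos_pos add_pos_nonneg) auto
  have E: "B + 2 * \<alpha> * y + B * y\<^sup>2 \<ge> B" "B + 2 * \<alpha> * y + B * y\<^sup>2 \<ge> 2 * \<alpha> * y" if "y \<ge> 0" for y
    using that \<alpha> B by auto
  have nz: "B + 2 * \<alpha> * y + B * y\<^sup>2 \<noteq> 0" if "y \<ge> 0" for y using E[OF that] B by linarith
  show "continuous_on {0..} r"
    unfolding r_def by (intro continuous_intros) (use nz c in auto)
  fix y :: real assume y: "y \<ge> 0"
  let ?E = "B + 2 * \<alpha> * y + B * y\<^sup>2"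
  have 1: "\<bar>p * (p + 1) * \<alpha> * k\<^sup>2 * 2 / ?E\<bar> \<le> p * (p + 1) * \<alpha> * k\<^sup>2 * 2 / B"
  proof -
    have "p * (p + 1) * \<alpha> * k\<^sup>2 * 2 / ?E \<le> p * (p + 1) * \<alpha> * k\<^sup>2 * 2 / B"
      using E[OF y] B p \<alpha> by (intro divide_left_mono mult_pos_pos) auto
    moreover have "p * (p + 1) * \<alpha> * k\<^sup>2 * 2 / ?E \<ge> 0"
      using E[OF y] B p \<alpha> by (intro divide_nonneg_nonneg mult_nonneg_nonneg) auto
    ultimately show ?thesis by (simp only: abs_of_nonneg)
  qed
  have 2: "\<bar>y / ?E\<^sup>2\<bar> \<le> 1 / (2 * \<alpha> * B)"
  proof -
    have "(2 * \<alpha> * y) * B \<le> ?E * ?E"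
      using E[OF y] B \<alpha> y by (intro mult_mono) auto
    moreover have "?E\<^sup>2 > 0" using nz[OF y] by simp
    ultimately show ?thesis using \<alpha> B y by (simp add: field_simps power2_eq_square)
  qed
  have "\<bar>r y\<bar> = \<bar>p * (p + 1) * \<alpha> * k\<^sup>2 * 2 / ?E + p * (2 * p - 1) * (B\<^sup>2 - \<alpha>\<^sup>2) * k\<^sup>2 * 4 * (y / ?E\<^sup>2)\<bar> / c"
    unfolding r_def using c by simp
  also have "\<dots> \<le> C"
    unfolding C_def
  proof (intro divide_right_mono order_trans[OF abs_triangle_ineq] add_mono 1)
    show "\<bar>p * (2 * p - 1) * (B\<^sup>2 - \<alpha>\<^sup>2) * k\<^sup>2 * 4 * (y / ?E\<^sup>2)\<bar>
      \<le> \<bar>p * (2 * p - 1) * (B\<^sup>2 - \<alpha>\<^sup>2) * k\<^sup>2 * 4\<bar> * (1 / (2 * \<alpha> * B))"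
      unfolding abs_mult[of _ "y / ?E\<^sup>2"] by (rule mult_left_mono[OF 2]) simp
  qed (use c in simp)
  finally show "\<bar>r y\<bar> \<le> C" .
qed

lemma q_eq_pot: "jost.q c r s = pot s"
proof -
  let ?y = "exp (- c * s)"
  let ?E = "B + 2 * \<alpha> * ?y + B * ?y\<^sup>2"
  have E: "?y / ?E = 1 / (2 * D s)" by (rule exp_D)
  have "jost.q c r s = p * (p + 1) * \<alpha> * k\<^sup>2 * 2 * (?y / ?E) + p * (2 * p - 1) * (B\<^sup>2 - \<alpha>\<^sup>2) * k\<^sup>2 * 4 * (?y / ?E)\<^sup>2"
    unfolding jost.q_def[OF jost_r] r_def using c by (simp add: field_simps power2_eq_square)
  thus ?thesis unfolding E pot_def using D_pos[of s] by (simp add: power_divide power2_eq_square)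
qed

lemma D_deriv: "(D has_real_derivative c * B * sinh (c * s)) (at s)"
  unfolding D_def[abs_def] by (auto intro!: derivative_eq_intros)

lemma R_deriv: "(R has_real_derivative R' s) (at s)"
proof -
  have "(R has_real_derivative (B * (c * cosh (c * s)) * D s - B * sinh (c * s) * (c * B * sinh (c * s))) / (D s * D s)) (at s)"
    unfolding R_def[abs_def]
    by (rule derivative_eq_intros D_deriv refl)+ (use D_pos[of s] in auto)
  moreover have "B * (c * cosh (c * s)) * D s - B * sinh (c * s) * (c * B * sinh (c * s)) = c * B * (\<alpha> * cosh (c * s) + B)"
    unfolding D_def using cosh_square_eq[of "c * s"] by (simp add: algebra_simps power2_eq_square)
  ultimately show ?thesis by (simp add: R'_def power2_eq_square)
qed

lemma R'_deriv: "(R' has_real_derivative c\<^sup>2 * B * sinh (c * s) * (\<alpha> * D s - 2 * B * (\<alpha> * cosh (c * s) + B)) / D s ^ 3) (at s)"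
proof -
  have "(R' has_real_derivative (c * B * (\<alpha> * (c * sinh (c * s))) * (D s)\<^sup>2 - c * B * (\<alpha> * cosh (c * s) + B) * (2 * D s * (c * B * sinh (c * s)))) / ((D s)\<^sup>2 * (D s)\<^sup>2)) (at s)"
    unfolding R'_def[abs_def]
    by (rule derivative_eq_intros D_deriv refl)+ (use D_pos[of s] in auto)
  moreover have "(c * B * (\<alpha> * (c * sinh (c * s))) * (D s)\<^sup>2 - c * B * (\<alpha> * cosh (c * s) + B) * (2 * D s * (c * B * sinh (c * s)))) / ((D s)\<^sup>2 * (D s)\<^sup>2)
     = c\<^sup>2 * B * sinh (c * s) * (\<alpha> * D s - 2 * B * (\<alpha> * cosh (c * s) + B)) / D s ^ 3"
    using D_pos[of s] by (simp add: field_simps power2_eq_square power3_eq_cube)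
  ultimately show ?thesis by simp
qed

lemma \<phi>_deriv: "(\<phi> has_real_derivative - k * R s * \<phi> s) (at s)"
proof -
  have Y: "D s / k\<^sup>2 > 0" using D_pos[of s] k by simp
  have "((\<lambda>s. (D s / k\<^sup>2) powr (- 1 / (p - 1))) has_real_derivative
     (- 1 / (p - 1)) * (D s / k\<^sup>2) powr (- 1 / (p - 1) - 1) * (c * B * sinh (c * s) / k\<^sup>2)) (at s)"
    by (rule DERIV_chain2[OF has_real_derivative_powr[OF Y] DERIV_cdivide[OF D_deriv]])
  also have "(- 1 / (p - 1)) * (D s / k\<^sup>2) powr (- 1 / (p - 1) - 1) * (c * B * sinh (c * s) / k\<^sup>2) = - k * R s * \<phi> s"
    using D_pos[of s] k p unfolding powr_diff R_def \<phi>_def c_def by (simp add: field_simps)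
  finally show ?thesis unfolding \<phi>_def[abs_def] .
qed

lemma \<phi>_pos: "\<phi> s > 0" using D_pos[of s] k by (simp add: \<phi>_def)

lemma R'_pos: "R' s > 0"
  unfolding R'_def using c B \<alpha> D_pos[of s] cosh_real_pos[of "c * s"]
  by (intro divide_pos_pos mult_pos_pos add_pos_pos) auto

text \<open>
  The translation mode: \<open>\<phi>' = - k * R * \<phi>\<close>, and the derivative of a solution of the stationary equation
  solves the linearized one.
\<close>

definition u0 :: "real \<Rightarrow> real" where "u0 s = R s * \<phi> s"
definition v0 :: "real \<Rightarrow> real" where "v0 s = (R' s - k * (R s)\<^sup>2) * \<phi> s"

lemma u0_deriv: "(u0 has_real_derivative v0 s) (at s)"
  unfolding u0_def[abs_def] v0_def
  by (rule derivative_eq_intros R_deriv \<phi>_deriv refl)+ (simp add: algebra_simps power2_eq_square)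

text \<open>
  The linearized equation for \<open>R * \<phi>\<close> after division by \<open>\<phi>\<close>. Multiplied by \<open>D\<^sup>3 / (k\<^sup>2 * B * sinh (c * s))\<close> it
  becomes the polynomial identity in the proof.
\<close>

lemma R_ode:
  "c\<^sup>2 * B * sinh (c * s) * (\<alpha> * D s - 2 * B * (\<alpha> * cosh (c * s) + B)) / D s ^ 3
     - 3 * k * R s * R' s + k\<^sup>2 * R s ^ 3 = (k\<^sup>2 - pot s) * R s"
proof -
  define S X d where "S = sinh (c * s)" and "X = cosh (c * s)" and "d = D s"
  have d: "d > 0" "d = \<alpha> + B * X" using D_pos by (simp_all add: d_def D_def X_def)
  have S2: "S\<^sup>2 = X\<^sup>2 - 1" unfolding S_def X_def using cosh_square_eq[of "c * s"] by simp
  have poly: "(p - 1)\<^sup>2 * (\<alpha> * d - 2 * B * (\<alpha> * X + B)) - 3 * (p - 1) * B * (\<alpha> * X + B) + B\<^sup>2 * S\<^sup>2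
     = d\<^sup>2 - p * (p + 1) * \<alpha> * d - p * (2 * p - 1) * (B\<^sup>2 - \<alpha>\<^sup>2)"
    unfolding S2 d(2) by algebra
  have "c\<^sup>2 * B * S * (\<alpha> * d - 2 * B * (\<alpha> * X + B)) / d ^ 3 - 3 * k * (B * S / d) * (c * B * (\<alpha> * X + B) / d\<^sup>2) + k\<^sup>2 * (B * S / d) ^ 3
    = k\<^sup>2 * B * S * ((p - 1)\<^sup>2 * (\<alpha> * d - 2 * B * (\<alpha> * X + B)) - 3 * (p - 1) * B * (\<alpha> * X + B) + B\<^sup>2 * S\<^sup>2) / d ^ 3"
    unfolding c_def using d(1) by (simp add: field_simps power2_eq_square power3_eq_cube)
  also have "\<dots> = (k\<^sup>2 - (p * (p + 1) * \<alpha> * k\<^sup>2 / d + p * (2 * p - 1) * (B\<^sup>2 - \<alpha>\<^sup>2) * k\<^sup>2 / d\<^sup>2)) * (B * S / d)"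
    unfolding poly using d(1) by (simp add: field_simps power2_eq_square power3_eq_cube)
  finally show ?thesis unfolding R_def R'_def pot_def S_def X_def d_def .
qed

lemma v0_deriv: "(v0 has_real_derivative (k\<^sup>2 - pot s) * u0 s) (at s)"
proof -
  let ?R'' = "c\<^sup>2 * B * sinh (c * s) * (\<alpha> * D s - 2 * B * (\<alpha> * cosh (c * s) + B)) / D s ^ 3"
  have "(v0 has_real_derivative (?R'' - k * (2 * R s * R' s)) * \<phi> s + (R' s - k * (R s)\<^sup>2) * (- k * R s * \<phi> s)) (at s)"
    unfolding v0_def[abs_def]
    by (rule derivative_eq_intros R_deriv R'_deriv \<phi>_deriv refl)+ (simp add: algebra_simps)
  also have "(?R'' - k * (2 * R s * R' s)) * \<phi> s + (R' s - k * (R s)\<^sup>2) * (- k * R s * \<phi> s)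
     = (?R'' - 3 * k * R s * R' s + k\<^sup>2 * R s ^ 3) * \<phi> s"
    by (simp add: algebra_simps power2_eq_square power3_eq_cube)
  also have "\<dots> = (k\<^sup>2 - pot s) * u0 s" unfolding R_ode u0_def by simp
  finally show ?thesis .
qed

lemma R_pos: "s > 0 \<Longrightarrow> R s > 0" and R_neg: "s < 0 \<Longrightarrow> R s < 0"
  using c B D_pos[of s] by (auto simp: R_def mult_pos_neg intro!: divide_pos_pos divide_neg_pos mult_pos_pos)

lemma R_bound: "\<bar>R s\<bar> \<le> 1"
proof -
  have "\<bar>sinh (c * s)\<bar> \<le> cosh (c * s)"
    using sinh_less_cosh_real[of "c * s"] sinh_less_cosh_real[of "- (c * s)"] by simp
  hence "B * \<bar>sinh (c * s)\<bar> \<le> B * cosh (c * s)" using B by (intro mult_left_mono) auto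
  hence "B * \<bar>sinh (c * s)\<bar> \<le> D s" using \<alpha> unfolding D_def by linarith
  thus ?thesis using D_pos[of s] B by (simp add: R_def abs_mult divide_le_eq)
qed

lemma R'_bound: "R' s \<le> c"
proof -
  have X: "cosh (c * s) \<ge> 1" by (rule cosh_real_ge_1)
  have "B * (\<alpha> * cosh (c * s) + B) \<le> (D s)\<^sup>2"
  proof -
    have "B\<^sup>2 * 1 \<le> B\<^sup>2 * (cosh (c * s))\<^sup>2" using X by (intro mult_left_mono) (auto simp: one_le_power)
    moreover have "(D s)\<^sup>2 = \<alpha>\<^sup>2 + 2 * (\<alpha> * B * cosh (c * s)) + B\<^sup>2 * (cosh (c * s))\<^sup>2"
      by (simp add: D_def power2_eq_square algebra_simps)
    moreover have "\<alpha> * B * cosh (c * s) \<ge> 0" using \<alpha> B X by simp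
    moreover have "B * (\<alpha> * cosh (c * s) + B) = \<alpha> * B * cosh (c * s) + B\<^sup>2"
      by (simp add: power2_eq_square algebra_simps)
    ultimately show ?thesis using zero_le_power2[of \<alpha>] by linarith
  qed
  hence "c * (B * (\<alpha> * cosh (c * s) + B)) \<le> c * (D s)\<^sup>2" using c by (intro mult_left_mono) auto
  thus ?thesis using D_pos[of s] by (simp add: R'_def divide_le_eq mult.assoc)
qed

lemma \<phi>_bound: "\<phi> s \<le> (\<alpha> / k\<^sup>2) powr (- 1 / (p - 1))"
  unfolding \<phi>_def
proof (rule powr_mono2')
  show "- 1 / (p - 1) \<le> 0" using p by simp
  show "0 < \<alpha> / k\<^sup>2" using \<alpha> k by simp
  show "\<alpha> / k\<^sup>2 \<le> D s / k\<^sup>2" using D_ge[of s] B by (intro divide_right_mono) auto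
qed

lemma R_surj:
  assumes "\<bar>t\<bar> < 1" shows "\<exists>s. R s = t"
proof -
  have lim: "(R \<longlongrightarrow> 1) at_top"
  proof -
    have "filterlim (\<lambda>s. - c * s) at_bot at_top"
      using c filterlim_tendsto_neg_mult_at_bot[OF tendsto_const _ filterlim_ident, of "- c"] by simp
    hence e: "((\<lambda>s. exp (- c * s)) \<longlongrightarrow> 0) at_top" by (rule filterlim_compose[OF exp_at_bot])
    have "((\<lambda>s. B * (1 - (exp (- c * s))\<^sup>2) / (B + 2 * \<alpha> * exp (- c * s) + B * (exp (- c * s))\<^sup>2)) \<longlongrightarrow> B * (1 - 0\<^sup>2) / (B + 2 * \<alpha> * 0 + B * 0\<^sup>2)) at_top"
      by (intro tendsto_intros e) (use B in simp)
    moreover have "B * (1 - (exp (- c * s))\<^sup>2) / (B + 2 * \<alpha> * exp (- c * s) + B * (exp (- c * s))\<^sup>2) = R s" for s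
    proof -
      have "B * (1 - (exp (- c * s))\<^sup>2) = exp (- c * s) * (2 * (B * sinh (c * s)))"
        unfolding sinh_field_def by (simp add: algebra_simps power2_eq_square mult_exp_exp)
      moreover have "x * y / t = y * (x / t)" for x y t :: real by simp
      ultimately have "B * (1 - (exp (- c * s))\<^sup>2) / (B + 2 * \<alpha> * exp (- c * s) + B * (exp (- c * s))\<^sup>2)
          = 2 * (B * sinh (c * s)) * (exp (- c * s) / (B + 2 * \<alpha> * exp (- c * s) + B * (exp (- c * s))\<^sup>2))"
        by metis
      also have "\<dots> = 2 * (B * sinh (c * s)) * (1 / (2 * D s))" by (simp only: exp_D)
      finally have "B * (1 - (exp (- c * s))\<^sup>2) / (B + 2 * \<alpha> * exp (- c * s) + B * (exp (- c * s))\<^sup>2)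
          = 2 * (B * sinh (c * s)) * (1 / (2 * D s))" .
      thus ?thesis by (simp add: R_def)
    qed
    ultimately show ?thesis using B by simp
  qed
  have "eventually (\<lambda>s. R s > \<bar>t\<bar> \<and> s > 0) at_top"
    using order_tendstoD(1)[OF lim assms] eventually_gt_at_top[of 0] by (rule eventually_conj)
  then obtain s where s: "R s > \<bar>t\<bar>" "s > 0" using eventually_happens by fastforce
  have odd: "R (- s) = - R s" by (simp add: R_def D_def)
  have "\<exists>x\<ge>- s. x \<le> s \<and> R x = t"
  proof (rule IVT')
    show "continuous_on {- s..s} R"
      by (rule DERIV_continuous_on[OF has_field_derivative_at_within[OF R_deriv]])
  qed (use s odd in linarith)+
  thus ?thesis by blast
qed

text \<open>
  At \<open>s0\<close> the term \<open>- k * R\<^sup>2 * \<phi>\<close> of \<open>v0\<close> cancels against \<open>z * u0\<close>, and \<open>R' * \<phi> > 0\<close> remains.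
\<close>

lemma zero_mode:
  assumes "z = k * R s0"
  shows "jost_zero_mode c k C r s0 z u0 v0"
proof -
  interpret jost c k C r by (rule jost_r)
  show ?thesis
  proof
    show "(u0 has_real_derivative v0 s) (at s)" for s by (rule u0_deriv)
    show "(v0 has_real_derivative (k\<^sup>2 - q s) * u0 s) (at s)" for s
      using v0_deriv[of s] by (simp add: q_eq_pot)
    define M where "M = (\<alpha> / k\<^sup>2) powr (- 1 / (p - 1))"
    have \<phi>M: "\<bar>\<phi> s\<bar> \<le> M" for s using \<phi>_bound[of s] \<phi>_pos[of s] by (simp add: M_def)
    have M: "M \<ge> 0" by (simp add: M_def)
    have "\<bar>u0 s\<bar> \<le> (1 + (c + k)) * M \<and> \<bar>v0 s\<bar> \<le> (1 + (c + k)) * M" for s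
    proof
      have R2: "(R s)\<^sup>2 \<le> 1" using R_bound[of s] by (simp add: abs_square_le_1)
      have "\<bar>u0 s\<bar> \<le> 1 * M" unfolding u0_def abs_mult by (intro mult_mono R_bound \<phi>M) auto
      also have "\<dots> \<le> (1 + (c + k)) * M" using M c k by (intro mult_right_mono) auto
      finally show "\<bar>u0 s\<bar> \<le> (1 + (c + k)) * M" .
      have "k * (R s)\<^sup>2 \<le> k * 1" using R2 k by (intro mult_left_mono) auto
      moreover have "k * (R s)\<^sup>2 \<ge> 0" using k by simp
      ultimately have "\<bar>R' s - k * (R s)\<^sup>2\<bar> \<le> 1 + (c + k)" using R'_pos[of s] R'_bound[of s] k c by linarith
      thus "\<bar>v0 s\<bar> \<le> (1 + (c + k)) * M" unfolding v0_def abs_mult by (intro mult_mono \<phi>M) auto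
    qed
    thus "\<exists>K. \<forall>s\<ge>0. \<bar>u0 s\<bar> \<le> K \<and> \<bar>v0 s\<bar> \<le> K" by blast
    show "u0 s > 0" if "s > 0" for s using R_pos[OF that] \<phi>_pos[of s] by (simp add: u0_def)
    show "u0 s < 0" if "s < 0" for s using R_neg[OF that] \<phi>_pos[of s] by (simp add: u0_def mult_neg_pos)
    have "v0 s0 + z * u0 s0 = R' s0 * \<phi> s0"
      unfolding assms v0_def u0_def by (simp add: algebra_simps power2_eq_square)
    thus "v0 s0 + z * u0 s0 > 0" using R'_pos[of s0] \<phi>_pos[of s0] by simp
  qed
qed

end

theorem lemma6:
  fixes p a b w Z :: real
  assumes "p > 1"
    and "(a > 0 \<and> b > 0 \<and> Z\<^sup>2 / 4 < - w) \<or>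
         (a > 0 \<and> b < 0 \<and> Z\<^sup>2 / 4 < - w \<and> - w < - (p * a\<^sup>2 / ((p + 1)\<^sup>2 * b)))"
  shows "(Z < 0 \<longrightarrow> num_neg_eigenvalues (dom_L Z) (neg_L p a b w Z) = 2) \<and>
         (Z \<ge> 0 \<longrightarrow> num_neg_eigenvalues (dom_L Z) (neg_L p a b w Z) = 1)"
proof -
  define k where "k = sqrt (- w)"
  define \<alpha> where "\<alpha> = a / (p + 1)"
  define B where "B = sqrt (\<alpha>\<^sup>2 - b / p * w)"
  have a: "a > 0" and Zw: "Z\<^sup>2 / 4 < - w" using assms(2) by auto
  have w: "- w > 0" using Zw zero_le_power2[of Z] by linarith
  have k: "k > 0" and k2: "k\<^sup>2 = - w" using w by (simp_all add: k_def)
  have \<alpha>: "\<alpha> > 0" using a assms(1) by (simp add: \<alpha>_def)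
  have disc: "\<alpha>\<^sup>2 - b / p * w > 0"
  proof (cases "b > 0")
    case True
    hence "b / p * (- w) > 0" using w assms(1) by (intro mult_pos_pos divide_pos_pos) auto
    thus ?thesis using zero_le_power2[of \<alpha>] unfolding mult_minus_right by linarith
  next
    case False
    hence b: "b < 0" and wb: "- w < - (p * a\<^sup>2 / ((p + 1)\<^sup>2 * b))" using assms(2) by auto
    have "(- b / p) * (- w) < (- b / p) * (- (p * a\<^sup>2 / ((p + 1)\<^sup>2 * b)))"
      using wb b assms(1) by (intro mult_strict_left_mono) (auto simp: divide_neg_pos)
    also have "\<dots> = \<alpha>\<^sup>2" using b assms(1) by (simp add: \<alpha>_def power_divide)
    finally show ?thesis by simp
  qed
  have B: "B > 0" and B2: "B\<^sup>2 = \<alpha>\<^sup>2 - b / p * w" using disc by (simp_all add: B_def)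
  interpret W: standing_wave p k \<alpha> B by unfold_locales (use assms(1) k \<alpha> B in auto)
  have R_fun: "R_fun p a b w = W.R"
    by (rule ext) (simp only: R_fun_def Let_def W.R_def W.D_def W.c_def \<alpha>_def[symmetric] B_def[symmetric] k_def[symmetric])
  define s0 where "s0 = inv W.R (Z / (2 * k))"
  have "(Z / 2)\<^sup>2 < k\<^sup>2" using Zw k2 by (simp add: power_divide)
  hence "\<bar>Z / 2\<bar> < k" using k abs_le_square_iff[of k "Z / 2"] by (simp add: not_le[symmetric])
  hence "\<bar>Z / (2 * k)\<bar> < 1" using k by (simp add: abs_mult field_simps)
  hence "Z / (2 * k) \<in> range W.R" using W.R_surj by (metis rangeI)
  hence Rs0: "W.R s0 = Z / (2 * k)" unfolding s0_def by (rule f_inv_into_f)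
  have sgn: "s0 < 0 \<longleftrightarrow> Z < 0"
  proof -
    have Z: "Z = 2 * k * W.R s0" using Rs0 k by simp
    consider "s0 < 0" | "s0 = 0" | "s0 > 0" by linarith
    thus ?thesis
    proof cases
      case 1
      thus ?thesis using W.R_neg[OF 1] k by (simp add: Z mult_pos_neg)
    next
      case 2
      thus ?thesis using Z by (simp add: W.R_def)
    next
      case 3
      hence "Z > 0" using W.R_pos[OF 3] k by (simp add: Z)
      thus ?thesis using 3 by simp
    qed
  qed
  interpret J: jost_zero_mode W.c k W.C W.r s0 "Z / 2" W.u0 W.v0
    by (rule W.zero_mode) (use Rs0 k in simp)
  have phi: "phi p a b w Z x = (W.D (s0 + \<bar>x\<bar>) / k\<^sup>2) powr (- 1 / (p - 1))" for x
  proof -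
    have "\<alpha> / (- w) + B / (- w) * cosh ((p - 1) * k * (\<bar>x\<bar> + s0)) = W.D (s0 + \<bar>x\<bar>) / k\<^sup>2"
      unfolding k2 W.D_def W.c_def by (simp add: add_divide_distrib add.commute)
    thus ?thesis
      unfolding phi_def Let_def R_fun s0_def \<alpha>_def[symmetric] B_def[symmetric] k_def[symmetric] by simp
  qed
  have "neg_L p a b w Z g x = J.opL s0 g x" for g x
  proof -
    define d where "d = W.D (s0 + \<bar>x\<bar>)"
    have d: "d > 0" unfolding d_def by (rule W.D_pos)
    have Y: "d / k\<^sup>2 > 0" using d k by simp
    have p1: "phi p a b w Z x powr (p - 1) = k\<^sup>2 / d"
      unfolding phi d_def[symmetric] powr_powr using assms(1) Y d by (simp add: powr_minus_divide)
    have "- 1 / (p - 1) * (2 * p - 2) = - 2" using assms(1) by (simp add: field_simps)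
    hence p2: "phi p a b w Z x powr (2 * p - 2) = (k\<^sup>2 / d)\<^sup>2"
      unfolding phi d_def[symmetric] powr_powr using Y d by (simp add: powr_minus_divide power_divide)
    have a: "a = \<alpha> * (p + 1)" using assms(1) by (simp add: \<alpha>_def)
    have bk: "b * k\<^sup>2 = p * (B\<^sup>2 - \<alpha>\<^sup>2)" unfolding B2 k2 using assms(1) by simp
    have "a * p * (k\<^sup>2 / d) + b * (2 * p - 1) * (k\<^sup>2 / d)\<^sup>2
        = p * (p + 1) * \<alpha> * k\<^sup>2 / d + (2 * p - 1) * (b * k\<^sup>2) * k\<^sup>2 / d\<^sup>2"
      unfolding a using d by (simp add: power2_eq_square field_simps)
    also have "\<dots> = W.pot (s0 + \<bar>x\<bar>)" unfolding bk W.pot_def d_def by (simp add: mult_ac)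
    finally have pot: "J.q (s0 + \<bar>x\<bar>) = a * p * (k\<^sup>2 / d) + b * (2 * p - 1) * (k\<^sup>2 / d)\<^sup>2"
      by (simp add: W.q_eq_pot)
    show ?thesis unfolding neg_L_def J.opL_def p1 p2 pot k2[symmetric] using k2
      by (simp add: algebra_simps)
  qed
  hence "neg_L p a b w Z = J.opL s0" by (intro ext)
  thus ?thesis using J.num_neg_eigenvalues_zero_mode[of Z] sgn by auto
qed

end
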